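(* There is an absolute constant $C>0$ such that for every squarefree integer $D\neq 1$, $$\limsup_{X\to\infty}\frac{\#\{E\in\mathcal{E}(X) : \eta_{E,D}\text{ is not an isomorphism}\}}{\#\mathcal{E}(X)}\le C\left(\frac{23}{24}\right)^{\omega(D)}.$$
   Context: $\omega(n)$ is the number of distinct prime divisors of a nonzero integer $n$. $\mathcal{E}$ is the set of elliptic curves $E_{A,B}:y^2=x^3+Ax+B$ with $A,B\in\mathbb{Z}$, $4A^3+27B^2\neq0$ and $\gcd(A^3,B^2)$ not divisible by the $12$th power of any prime. The height of $E_{A,B}\in\mathcal{E}$ is $H(E_{A,B})=\max\{4|A|^3,27B^2\}$, and $\mathcal{E}(X)$ is the finite set of $E\in\mathcal{E}$ with $H(E)\le X$. For a squarefree integer $D\neq1$ let $K=\mathbb{Q}(\sqrt D)$. For $E=E_{A,B}$ the quadratic twist is $E_D: Dy^2=x^3+Ax+B$, and $\varphi_D:E_D\to E$, $(x,y)\mapsto(x,y\sqrt D)$, is an isomorphism defined over $K$. The homomorphism $\eta_{E,D}:E_D(\mathbb{Q})\times E(\mathbb{Q})\to E(K)$ is $(P,Q)\mapsto\varphi_D(P)+Q$. *)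

theory Defs
  imports
    Complex_Main
    "HOL-Library.Extended_Real"
    "HOL-Computational_Algebra.Primes"
    "HOL-Computational_Algebra.Squarefree"
    "HOL-Algebra.Group"
begin

definition omega :: "int \<Rightarrow> nat" where
  "omega n = card {p. prime p \<and> p dvd n}"

text \<open>A pair \<open>(A, B)\<close> of integers stands for the curve \<open>y\<^sup>2 = x\<^sup>3 + A x + B\<close>.\<close>

definition curves :: "(int \<times> int) set" where
  "curves = {(A, B). 4 * A ^ 3 + 27 * B ^ 2 \<noteq> 0 \<and>
     (\<forall>p. prime p \<longrightarrow> \<not> p ^ 12 dvd gcd (A ^ 3) (B ^ 2))}"

fun height :: "int \<times> int \<Rightarrow> int" where
  "height (A, B) = max (4 * \<bar>A\<bar> ^ 3) (27 * B ^ 2)"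

definition curves_upto :: "real \<Rightarrow> (int \<times> int) set" where
  "curves_upto X = {E \<in> curves. real_of_int (height E) \<le> X}"

lemma finite_curves_upto: "finite (curves_upto X)"
proof -
  define N where "N = \<lfloor>X\<rfloor>"
  have "curves_upto X \<subseteq> {-N..N} \<times> {-N..N}"
  proof (clarify)
    fix A B assume "(A, B) \<in> curves_upto X"
    then have "max (4 * \<bar>A\<bar> ^ 3) (27 * B ^ 2) \<le> N"
      unfolding N_def le_floor_iff by (simp add: curves_upto_def)
    then have h: "4 * \<bar>A\<bar> ^ 3 \<le> N" "27 * B ^ 2 \<le> N"
      by simp_all
    have self: "\<bar>n\<bar> \<le> \<bar>n\<bar> ^ Suc k" for n :: int and k
      by (cases "n = 0") (auto intro: self_le_power)
    have "\<bar>A\<bar> \<le> N" using h(1) self[of A 2] by (simp add: numeral_3_eq_3)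
    moreover have "\<bar>B\<bar> \<le> N" using h(2) self[of B 1] by (simp add: numeral_2_eq_2)
    ultimately show "A \<in> {-N..N} \<and> B \<in> {-N..N}" by auto
  qed
  then show ?thesis by (rule finite_subset) simp
qed

datatype 'a point = Infinity | Affine 'a 'a

text \<open>
  Points with coordinates in \<open>F\<close> of the projective closure of \<open>d y\<^sup>2 = x\<^sup>3 + a x + b\<close>.
  The parameter \<open>d\<close> covers both the curve itself (\<open>d = 1\<close>) and its quadratic twists.
\<close>
definition points :: "'a::field \<Rightarrow> 'a \<Rightarrow> 'a \<Rightarrow> 'a set \<Rightarrow> 'a point set" where
  "points d a b F =
     insert Infinity {Affine x y | x y. x \<in> F \<and> y \<in> F \<and> d * y ^ 2 = x ^ 3 + a * x + b}"

text \<open>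
  Chord-and-tangent addition on \<open>d y\<^sup>2 = x\<^sup>3 + a x + b\<close>: \<open>l\<close> is the slope of the chord
  or tangent, and the three abscissae on a line of slope \<open>l\<close> add up to \<open>d l\<^sup>2\<close>.
\<close>
fun point_add :: "'a::field \<Rightarrow> 'a \<Rightarrow> 'a point \<Rightarrow> 'a point \<Rightarrow> 'a point" where
  "point_add d a Infinity Q = Q"
| "point_add d a P Infinity = P"
| "point_add d a (Affine x1 y1) (Affine x2 y2) =
     (if x1 = x2 \<and> y1 = - y2 then Infinity
      else let l = (if x1 = x2 then (3 * x1 ^ 2 + a) / (2 * d * y1) else (y2 - y1) / (x2 - x1));
               x3 = d * l ^ 2 - x1 - x2
           in Affine x3 (l * (x1 - x3) - y1))"

definition point_group :: "'a::field \<Rightarrow> 'a \<Rightarrow> 'a \<Rightarrow> 'a set \<Rightarrow> 'a point monoid" where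
  "point_group d a b F =
     \<lparr>carrier = points d a b F, mult = point_add d a, one = Infinity\<rparr>"

text \<open>
  All the fields involved are taken inside the complex numbers, so that \<open>E(\<rat>) \<subseteq> E(K)\<close>
  holds literally.
\<close>
definition quadratic_field :: "int \<Rightarrow> complex set" where
  "quadratic_field D = {a + b * csqrt (of_int D) | a b. a \<in> \<rat> \<and> b \<in> \<rat>}"

fun curve_group :: "int \<times> int \<Rightarrow> complex set \<Rightarrow> complex point monoid" where
  "curve_group (A, B) F = point_group 1 (of_int A) (of_int B) F"

fun twist_group :: "int \<times> int \<Rightarrow> int \<Rightarrow> complex set \<Rightarrow> complex point monoid" where
  "twist_group (A, B) D F = point_group (of_int D) (of_int A) (of_int B) F"

fun twist_map :: "int \<Rightarrow> complex point \<Rightarrow> complex point" where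
  "twist_map D Infinity = Infinity"
| "twist_map D (Affine x y) = Affine x (y * csqrt (of_int D))"

definition eta :: "int \<times> int \<Rightarrow> int \<Rightarrow> complex point \<times> complex point \<Rightarrow> complex point" where
  "eta E D = (\<lambda>(P, Q). twist_map D P \<otimes>\<^bsub>curve_group E (quadratic_field D)\<^esub> Q)"

definition eta_is_iso :: "int \<times> int \<Rightarrow> int \<Rightarrow> bool" where
  "eta_is_iso E D \<longleftrightarrow>
     eta E D \<in> iso (twist_group E D \<rat> \<times>\<times> curve_group E \<rat>) (curve_group E (quadratic_field D))"

end

theory Submission
  imports Defs "HOL-Computational_Algebra.Polynomial" "HOL-Number_Theory.Cong"
begin

text \<open>
  If \<open>E\<close> has no rational 2-torsion and \<open>R + \<sigma> R \<in> 2 E(\<rat>)\<close> for all \<open>R \<in> E(K)\<close>, then \<open>\<eta>\<close> is an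
  isomorphism. Otherwise some \<open>R + \<sigma> R\<close> is not a double, and the 2-covering attached to it is given by
  an integral binary quartic form \<open>g\<close> with invariants proportional to \<open>A\<close> and \<open>B\<close> and without
  rational roots. The slope of the line through \<open>R\<close> and \<open>\<sigma> R\<close> shows that \<open>g\<close> represents \<open>D\<close> times
  a square, so \<open>g\<close> has a root modulo every prime dividing \<open>D\<close>. For each prime \<open>p \<ge> 5\<close> this
  holds for a proportion of at most \<open>23 / 24\<close> of the quartics mod \<open>p\<close>. Reduction theory brings \<open>g\<close>
  into one of the boxes \<open>\<bar>a\<bar> \<le> N / 4\<^sup>k\<close>, \<open>\<bar>b\<bar> \<le> N / 2\<^sup>k\<close>, \<open>\<bar>c\<bar> \<le> N\<close>, \<open>\<bar>d\<bar> \<le> 2\<^sup>k N\<close>, \<open>\<bar>e\<bar> \<le> 4\<^sup>k N\<close>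
  with \<open>N\<close> of order \<open>X\<^bsup>1/6\<^esup>\<close> and \<open>a \<noteq> 0\<close>. Each class has about \<open>2\<^sup>k\<close> translates there, so the
  \<open>k\<close>-th box contributes \<open>O(N\<^sup>5 / 2\<^sup>k)\<close> classes, times the local densities as long as \<open>k\<close> is
  bounded; and \<open>N\<^sup>5\<close> is the order of the number of all curves.
\<close>

section \<open>The group law\<close>

text \<open>Let \<open>M\<close> be the product of the primes \<open>p \<ge> 5\<close> dividing
  \<open>D\<close>. A count of forms by residues modulo \<open>M\<close> is proportional to the
  volume of a box only if no side is shorter than \<open>M\<close>, and the side for
  \<open>a\<close> has length of order \<open>N / 4 ^ k\<close>. Local conditions are therefore used
  just for \<open>k < K\<close>, with \<open>1 / 2 ^ K \<le> \<delta>\<close>, where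
  \<open>\<delta>\<close> is \<open>23 / 24\<close> to the number of these primes. For the other
  \<open>k\<close> the factor \<open>1 / 2 ^ k\<close> gained from the translates already sums to
  \<open>O(\<delta>)\<close>. \<open>K\<close> and \<open>M\<close> depend on \<open>D\<close>
  alone, which the limsup permits, while the implied constants are absolute.

  A curve is charged with the translates of one form. They determine it, since substitutions of
  determinant 1 preserve \<open>I = - 4 * A\<close> and \<open>J = - 4 * B\<close>.

  Such curves are set apart; with \<open>X = m ^ 6\<close> there are \<open>O(m ^ 3)\<close> of
  them, against at least a constant times \<open>m ^ 5\<close> curves in all.\<close>

fun point_neg :: "'a::field point \<Rightarrow> 'a point" where
  "point_neg Infinity = Infinity"
| "point_neg (Affine x y) = Affine x (- y)"

lemma point_neg_neg [simp]: "point_neg (point_neg P) = P"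
  by (cases P) auto

locale weierstrass =
  fixes a b :: "'a::field_char_0"
  assumes nonsing: "4 * a ^ 3 + 27 * b ^ 2 \<noteq> 0"
begin

abbreviation E :: "'a point set" where "E \<equiv> points 1 a b UNIV"
abbreviation add :: "'a point \<Rightarrow> 'a point \<Rightarrow> 'a point" (infixl "\<oplus>" 65) where "P \<oplus> Q \<equiv> point_add 1 a P Q"

lemma Affine_in_E [simp]: "Affine x y \<in> E \<longleftrightarrow> y ^ 2 = x ^ 3 + a * x + b"
  by (auto simp: points_def)

lemma Infinity_in_E [simp]: "Infinity \<in> E"
  by (simp add: points_def)

lemma neg_in_E [simp]: "P \<in> E \<Longrightarrow> point_neg P \<in> E"
  by (cases P) auto

text \<open>The identity \<open>x\<^sup>3 + a x + b - (l x + n)\<^sup>2 = (x - x\<^sub>1) (x - x\<^sub>2) (x - x\<^sub>3)\<close>, compared coefficientwise.\<close>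
definition chord :: "'a \<Rightarrow> 'a \<Rightarrow> 'a \<Rightarrow> 'a \<Rightarrow> 'a \<Rightarrow> bool" where
  "chord l n x1 x2 x3 \<longleftrightarrow> l ^ 2 = x1 + x2 + x3 \<and> a - 2 * l * n = x1 * x2 + x1 * x3 + x2 * x3 \<and> n ^ 2 - b = x1 * x2 * x3"

lemma chord_swap: "chord l n x1 x2 x3 \<Longrightarrow> chord l n x2 x1 x3"
  unfolding chord_def by (simp add: ac_simps)

lemma chord_rot: "chord l n x1 x2 x3 \<Longrightarrow> chord l n x2 x3 x1"
  unfolding chord_def by (simp add: ac_simps)

lemma chord_on_curve: "chord l n x1 x2 x3 \<Longrightarrow> (l * x1 + n) ^ 2 = x1 ^ 3 + a * x1 + b"
  unfolding chord_def by algebra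

lemma nonsing_point:
  assumes "x ^ 3 + a * x + b = 0" shows "3 * x ^ 2 + a \<noteq> 0"
proof
  assume "3 * x ^ 2 + a = 0"
  with assms have "4 * a ^ 3 + 27 * b ^ 2 = 0" by algebra
  with nonsing show False by simp
qed

text \<open>A repeated abscissa is a double root, so the derivative of the identity vanishes there:
  \<open>3 * x1 ^ 2 + a = 2 * l * (l * x1 + n)\<close>. Nonsingularity then excludes a vanishing
  ordinate, and the tangent slope is \<open>l\<close> again. One predicate thus serves chords and
  tangents alike.\<close>

lemma chord_sum:
  assumes "chord l n x1 x2 x3"
  shows "Affine x1 (l * x1 + n) \<oplus> Affine x2 (l * x2 + n) = Affine x3 (- (l * x3 + n))"
proof (cases "x1 = x2")
  case False
  have "(l * x2 + n - (l * x1 + n)) / (x2 - x1) = l"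
    using False by (simp add: field_simps)
  moreover have "l ^ 2 - x1 - x2 = x3" using assms by (simp add: chord_def)
  ultimately show ?thesis using False by (simp add: Let_def algebra_simps)
next
  case True
  have d: "3 * x1 ^ 2 + a = 2 * l * (l * x1 + n)"
    using assms unfolding chord_def True by algebra
  have y: "l * x1 + n \<noteq> 0"
    using chord_on_curve[OF assms] nonsing_point[of x1] d by auto
  then have y2: "l * x1 + n \<noteq> - (l * x1 + n)"
    by (metis add.inverse_neutral eq_neg_iff_add_eq_0 mult_2 mult_eq_0_iff zero_neq_numeral)
  have "2 * l * w / (2 * w) = l" if "w \<noteq> 0" for w :: 'a
    using that by simp
  from this[OF y] have "(3 * x1 ^ 2 + a) / (2 * (l * x1 + n)) = l"
    unfolding d .
  moreover have "l ^ 2 - x1 - x2 = x3" using assms by (simp add: chord_def)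
  ultimately show ?thesis using True y2 by (simp add: Let_def algebra_simps)
qed

lemma chord_exists:
  assumes "Affine x1 y1 \<in> E" "Affine x2 y2 \<in> E" "\<not> (x1 = x2 \<and> y1 = - y2)"
  obtains l n x3 where "chord l n x1 x2 x3" "y1 = l * x1 + n" "y2 = l * x2 + n"
proof (cases "x1 = x2")
  case False
  define l n where "l = (y2 - y1) / (x2 - x1)" and "n = y1 - l * x1"
  have 1: "y1 = l * x1 + n" by (simp add: n_def)
  have "l * (x2 - x1) = y2 - y1" using False by (simp add: l_def)
  then have 2: "y2 = l * x2 + n" unfolding n_def by algebra
  have e: "(l * x1 + n) ^ 2 = x1 ^ 3 + a * x1 + b" "(l * x2 + n) ^ 2 = x2 ^ 3 + a * x2 + b"
    using assms 1 2 by auto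
  have c: "x1 - x2 \<noteq> 0" using False by simp
  have "(x1 - x2) * (a - 2 * l * n - (x1 * x2 + (x1 + x2) * (l ^ 2 - x1 - x2))) = 0"
    using e by algebra
  then have a: "a - 2 * l * n = x1 * x2 + (x1 + x2) * (l ^ 2 - x1 - x2)"
    using c by simp
  have "n ^ 2 - b = x1 * x2 * (l ^ 2 - x1 - x2)" using e a by algebra
  then have "chord l n x1 x2 (l ^ 2 - x1 - x2)"
    using a by (simp add: chord_def algebra_simps)
  then show ?thesis using 1 2 that by blast
next
  case True
  then have "(y1 - y2) * (y1 + y2) = 0" using assms by (simp add: algebra_simps power2_eq_square)
  then have y: "y1 = y2" "y1 \<noteq> 0" using assms True by (auto simp: eq_neg_iff_add_eq_0)
  define l n where "l = (3 * x1 ^ 2 + a) / (2 * y1)" and "n = y1 - l * x1"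
  have 1: "y1 = l * x1 + n" by (simp add: n_def)
  have l: "l * (2 * y1) = 3 * x1 ^ 2 + a" using y by (simp add: l_def)
  have e: "y1 ^ 2 = x1 ^ 3 + a * x1 + b" using assms by simp
  have "chord l n x1 x1 (l ^ 2 - 2 * x1)"
    unfolding chord_def
  proof (intro conjI)
    show a: "a - 2 * l * n = x1 * x1 + x1 * (l\<^sup>2 - 2 * x1) + x1 * (l\<^sup>2 - 2 * x1)"
      using 1 l by algebra
    show "n\<^sup>2 - b = x1 * x1 * (l\<^sup>2 - 2 * x1)" using 1 l e by algebra
  qed simp
  then show ?thesis using 1 y True that by blast
qed

text \<open>Apart from trivial sums, the two summands lie on one common line; this replaces the case
  distinctions of \<open>point_add\<close> from here on.\<close>

lemma point_cases:
  assumes "P \<in> E" "Q \<in> E"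
  obtains "P = Infinity" | "Q = Infinity" | "P \<noteq> Infinity" "Q = point_neg P"
  | x1 x2 x3 l n where "chord l n x1 x2 x3" "P = Affine x1 (l * x1 + n)" "Q = Affine x2 (l * x2 + n)"
proof (cases P)
  case P: (Affine x1 y1)
  show ?thesis
  proof (cases Q)
    case Q: (Affine x2 y2)
    show ?thesis
    proof (cases "x1 = x2 \<and> y1 = - y2")
      case True
      then show ?thesis using that(3) P Q by simp
    next
      case False
      then show ?thesis using chord_exists assms that(4) unfolding P Q by metis
    qed
  qed (use that in blast)
qed (use that in blast)

lemma add_Infinity_right [simp]: "P \<oplus> Infinity = P"
  by (cases P) auto

lemma add_neg_right [simp]: "P \<oplus> point_neg P = Infinity"
  by (cases P) auto

lemma add_neg_left [simp]: "point_neg P \<oplus> P = Infinity"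
  by (cases P) auto

lemma add_comm: "P \<in> E \<Longrightarrow> Q \<in> E \<Longrightarrow> P \<oplus> Q = Q \<oplus> P"
proof (erule (1) point_cases)
  fix x1 x2 x3 l n
  assume c: "chord l n x1 x2 x3" "P = Affine x1 (l * x1 + n)" "Q = Affine x2 (l * x2 + n)"
  show "P \<oplus> Q = Q \<oplus> P"
    unfolding c(2,3) chord_sum[OF c(1)] chord_sum[OF chord_swap[OF c(1)]] ..
qed auto

lemma add_closed:
  assumes "P \<in> E" "Q \<in> E" shows "P \<oplus> Q \<in> E"
  using assms
proof (rule point_cases)
  fix x1 x2 x3 l n
  assume c: "chord l n x1 x2 x3" "P = Affine x1 (l * x1 + n)" "Q = Affine x2 (l * x2 + n)"
  show "P \<oplus> Q \<in> E"
    using chord_on_curve[OF chord_rot[OF chord_rot[OF c(1)]]]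
    unfolding c(2,3) chord_sum[OF c(1)] by (simp only: Affine_in_E power2_minus)
qed (use assms in auto)

text \<open>Reflecting the line through \<open>P\<close> and \<open>Q\<close> in the x-axis gives a
  line through \<open>- P\<close> and \<open>P + Q\<close> whose third point is \<open>- Q\<close>.
  This special case of associativity later settles the degenerate configurations.\<close>

lemma add_cancel:
  assumes "P \<in> E" "Q \<in> E" shows "point_neg P \<oplus> (P \<oplus> Q) = Q"
  using assms
proof (cases rule: point_cases)
  case (4 x1 x2 x3 l n)
  have "chord (- l) (- n) x1 x3 x2"
    using chord_swap[OF chord_rot[OF chord_rot[OF 4(1)]]] by (simp add: chord_def)
  from chord_sum[OF this] show ?thesis
    unfolding 4(2,3) chord_sum[OF 4(1)] by (simp del: point_add.simps(3))
next
  case 3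
  then show ?thesis by (cases P) auto
qed auto

lemma neg_add: "P \<in> E \<Longrightarrow> Q \<in> E \<Longrightarrow> point_neg (P \<oplus> Q) = point_neg P \<oplus> point_neg Q"
proof (erule (1) point_cases)
  fix x1 x2 x3 l n
  assume c: "chord l n x1 x2 x3" "P = Affine x1 (l * x1 + n)" "Q = Affine x2 (l * x2 + n)"
  have "chord (- l) (- n) x1 x2 x3" using c(1) by (simp add: chord_def)
  from chord_sum[OF this] show "point_neg (P \<oplus> Q) = point_neg P \<oplus> point_neg Q"
    unfolding c(2,3) chord_sum[OF c(1)] by (simp del: point_add.simps(3))
qed auto

section \<open>Associativity of the addition\<close>

lemma chord_root: "chord l n x1 x2 x3 \<Longrightarrow> x ^ 3 + a * x + b - (l * x + n) ^ 2 = (x - x1) * (x - x2) * (x - x3)"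
  unfolding chord_def by algebra

text \<open>Substituting the parabola into the curve and splitting off
  \<open>(x - x1) * (x - x2)\<close> leaves a quadratic in \<open>x\<close>, and \<open>x3\<close>
  is a root of it. If \<open>x2 = x3\<close> there is no factor \<open>x3 - x2\<close> to cancel,
  hence the separate computation.\<close>

lemma chord_fourth_root:
  assumes "chord l n x1 x2 u" "chord m k x2 x3 v" "l * x2 + n = m * x2 + k"
    "c * (x3 - x1) = m - l" "x1 \<noteq> x3"
  shows "(x3 - u) - 2 * c * (l * x3 + n) - c ^ 2 * (x3 - x1) * (x3 - x2) = 0"
proof -
  have k: "k = l * x2 + n - m * x2" using assms(3) by algebra
  have m: "m = l + c * (x3 - x1)" using assms(4) by algebra
  have h1: "l ^ 2 = x1 + x2 + u" "a - 2 * l * n = x1 * x2 + x1 * u + x2 * u" "n ^ 2 - b = x1 * x2 * u"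
    using assms(1) by (auto simp: chord_def)
  have h2: "m ^ 2 = x2 + x3 + v" "a - 2 * m * k = x2 * x3 + x2 * v + x3 * v" "k ^ 2 - b = x2 * x3 * v"
    using assms(2) by (auto simp: chord_def)
  have "(x3 - x1) * ((x3 - u) - 2 * c * (l * x3 + n) - c ^ 2 * (x3 - x1) * (x3 - x2)) = 0"
    if "x2 \<noteq> x3"
  proof -
    have "(m * x3 + k) ^ 2 = x3 ^ 3 + a * x3 + b"
      using chord_on_curve[OF chord_rot[OF assms(2)]] .
    moreover have "m * x3 + k = l * x3 + n + c * (x3 - x1) * (x3 - x2)"
      using k m by algebra
    moreover have "x3 ^ 3 + a * x3 + b - (l * x3 + n) ^ 2 = (x3 - x1) * (x3 - x2) * (x3 - u)"
      by (rule chord_root[OF assms(1)])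
    ultimately have "(x3 - x2) * ((x3 - x1) * ((x3 - u) - 2 * c * (l * x3 + n) - c ^ 2 * (x3 - x1) * (x3 - x2))) = 0"
      by algebra
    then show ?thesis using that by simp
  qed
  moreover have "(x3 - x1) * ((x3 - u) - 2 * c * (l * x3 + n) - c ^ 2 * (x3 - x1) * (x3 - x2)) = 0"
    if "x2 = x3"
    using h1 h2 k m unfolding that by algebra
  ultimately show ?thesis
    using assms(5) by (metis mult_eq_0_iff right_minus_eq)
qed

text \<open>
  The parabola \<open>y = l x + n + c (x - x\<^sub>1) (x - x\<^sub>2)\<close> through the three points meets the curve in a
  fourth point, whose abscissa is symmetric in the three points. It lies on a line with
  \<open>P\<^sub>1 + P\<^sub>2\<close> and \<open>P\<^sub>3\<close>, and that line has slope \<open>1 / c - l\<close>.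
\<close>
lemma chord_parabola:
  assumes "chord l n x1 x2 u" "chord m k x2 x3 v" "l * x2 + n = m * x2 + k"
    "c * (x3 - x1) = m - l" "x1 \<noteq> x3" "c * e = 1"
  shows "chord (e - l) (- u * e - n) u x3 (e ^ 2 - 2 * l * e + x1 + x2 - x3)"
proof -
  have h1: "l ^ 2 = x1 + x2 + u" "a - 2 * l * n = x1 * x2 + x1 * u + x2 * u" "n ^ 2 - b = x1 * x2 * u"
    using assms(1) by (auto simp: chord_def)
  have g: "e ^ 2 * (x3 - u) - 2 * e * (l * x3 + n) - (x3 - x1) * (x3 - x2) = 0"
    using chord_fourth_root[OF assms(1-5)] assms(6) by algebra
  have "(e - l) ^ 2 = u + x3 + (e ^ 2 - 2 * l * e + x1 + x2 - x3)"
    using h1 by algebra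
  moreover have "a - 2 * (e - l) * (- u * e - n) = u * x3 + u * (e ^ 2 - 2 * l * e + x1 + x2 - x3) + x3 * (e ^ 2 - 2 * l * e + x1 + x2 - x3)"
    using h1 g by algebra
  moreover have "(- u * e - n) ^ 2 - b = u * x3 * (e ^ 2 - 2 * l * e + x1 + x2 - x3)"
    using h1 g by algebra
  ultimately show ?thesis
    by (simp add: chord_def)
qed

lemma add_assoc_parabola:
  assumes L: "chord l n x1 x2 u" and M: "chord m k x2 x3 v"
    and p2: "l * x2 + n = m * x2 + k" and c: "c * (x3 - x1) = m - l" and ne: "x1 \<noteq> x3" and e: "c * e = 1"
  defines "x4 \<equiv> e ^ 2 - 2 * l * e + x1 + x2 - x3"
  shows "(Affine x1 (l * x1 + n) \<oplus> Affine x2 (l * x2 + n)) \<oplus> Affine x3 (m * x3 + k) =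
    Affine x4 (- ((e - l) * x4 + (- u * e - n)))"
proof -
  have 1: "(e - l) * u + (- u * e - n) = - (l * u + n)" by (simp add: algebra_simps)
  have 2: "(e - l) * x3 + (- u * e - n) = m * x3 + k"
    using chord_fourth_root[OF L M p2 c ne] c e p2 by algebra
  show ?thesis
    unfolding chord_sum[OF L] unfolding 1[symmetric] 2[symmetric] x4_def
    by (rule chord_sum[OF chord_parabola[OF L M p2 c ne e]])
qed

text \<open>Both bracketings are the negative of the fourth point on the parabola through the three
  points, and \<open>c\<close> does not change when \<open>P1\<close> and \<open>P3\<close> are
  exchanged. If the slopes agree, the three points are collinear and both sides are
  \<open>Infinity\<close>.\<close>

lemma add_assoc_chord:
  assumes L: "chord l n x1 x2 u" and M: "chord m k x2 x3 v"
    and p2: "l * x2 + n = m * x2 + k" and ne: "x1 \<noteq> x3"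
  defines "P1 \<equiv> Affine x1 (l * x1 + n)" and "P2 \<equiv> Affine x2 (l * x2 + n)" and "P3 \<equiv> Affine x3 (m * x3 + k)"
  shows "(P1 \<oplus> P2) \<oplus> P3 = P1 \<oplus> (P2 \<oplus> P3)"
proof -
  have P2: "P2 = Affine x2 (m * x2 + k)" by (simp add: P2_def p2)
  have s1: "P1 \<oplus> P2 = Affine u (- (l * u + n))"
    unfolding P1_def P2_def by (rule chord_sum[OF L])
  have s2: "P2 \<oplus> P3 = Affine v (- (m * v + k))"
    unfolding P2 P3_def by (rule chord_sum[OF M])
  have inE: "P1 \<in> E" "P2 \<in> E" "P3 \<in> E"
    using chord_on_curve[OF L] chord_on_curve[OF chord_rot[OF L]] chord_on_curve[OF chord_rot[OF M]]
    by (simp_all add: P1_def P2_def P3_def)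
  have h1: "l ^ 2 = x1 + x2 + u" "a - 2 * l * n = x1 * x2 + x1 * u + x2 * u"
    using L by (auto simp: chord_def)
  have h2: "m ^ 2 = x2 + x3 + v" "a - 2 * m * k = x2 * x3 + x2 * v + x3 * v"
    using M by (auto simp: chord_def)
  show ?thesis
  proof (cases "l = m")
    case False
    define c where "c = (m - l) / (x3 - x1)"
    define e where "e = 1 / c"
    have c: "c * (x3 - x1) = m - l" "c \<noteq> 0" using ne False by (auto simp: c_def)
    have c': "c * (x1 - x3) = l - m" using c by algebra
    have e: "c * e = 1" using c by (simp add: e_def)
    define x4 where "x4 = e ^ 2 - 2 * l * e + x1 + x2 - x3"
    have x4: "x4 = e ^ 2 - 2 * m * e + x3 + x2 - x1"
      unfolding x4_def using c e by algebra
    have "(P1 \<oplus> P2) \<oplus> P3 = Affine x4 (- ((e - l) * x4 + (- u * e - n)))"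
      unfolding P1_def P2_def P3_def x4_def
      by (rule add_assoc_parabola[OF L M p2 c(1) ne e])
    also have "(e - l) * x4 + (- u * e - n) = (e - m) * x4 + (- v * e - k)"
      using x4_def c(1) e h1 h2 p2 by algebra
    also have "Affine x4 (- \<dots>) = (P3 \<oplus> P2) \<oplus> P1"
      unfolding P1_def P2 P3_def x4
      by (rule add_assoc_parabola[OF chord_swap[OF M] chord_swap[OF L] p2[symmetric] c' ne[symmetric] e, symmetric])
    also have "\<dots> = P1 \<oplus> (P2 \<oplus> P3)"
      using inE by (metis add_comm add_closed)
    finally show ?thesis .
  next
    case True
    then have nk: "n = k" using p2 by simp
    have "(x1 - x3) * (x1 - v) = 0"
      using h1 h2 unfolding True nk by algebra
    then have v: "x1 = v" using ne by simp
    moreover have "u = x3"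
    proof -
      have "x1 + x2 + u = x1 + x2 + x3" using h1(1) h2(1) True v by (simp add: ac_simps)
      then show ?thesis by simp
    qed
    ultimately have "P1 \<oplus> P2 = point_neg P3" "P2 \<oplus> P3 = point_neg P1"
      unfolding s1 s2 by (simp_all add: P1_def P3_def True nk)
    then show ?thesis by simp
  qed
qed

lemma add_assoc:
  assumes "P \<in> E" "Q \<in> E" "R \<in> E"
  shows "(P \<oplus> Q) \<oplus> R = P \<oplus> (Q \<oplus> R)"
  using assms(1,2)
proof (cases rule: point_cases)
  case 3
  then show ?thesis using add_cancel[of "point_neg P" R] assms by simp
next
  case PQ: (4 x1 x2 u l n)
  show ?thesis
    using assms(2,3)
  proof (cases rule: point_cases)
    case 3
    have "(P \<oplus> Q) \<oplus> R = point_neg Q \<oplus> (Q \<oplus> P)"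
      unfolding 3(2) using assms by (metis add_comm add_closed neg_in_E)
    also have "\<dots> = P" using add_cancel assms by blast
    finally show ?thesis by (simp add: 3(2))
  next
    case QR: (4 x2' x3 v m k)
    have x2: "x2' = x2" and p2: "l * x2 + n = m * x2 + k" using PQ QR by auto
    show ?thesis
    proof (cases "x1 = x3")
      case False
      have "(P \<oplus> Q) \<oplus> Affine x3 (m * x3 + k) = P \<oplus> (Q \<oplus> Affine x3 (m * x3 + k))"
        unfolding PQ(2,3) by (rule add_assoc_chord[OF PQ(1) QR(1)[unfolded x2] p2 False])
      then show ?thesis by (simp add: QR)
    next
      case True
      \<comment> \<open>Equal abscissae leave \<open>R = P\<close>, which is commutativity, or
        \<open>R = point_neg P\<close>, which is cancellation.\<close>
      have "(l * x1 + n) ^ 2 = (m * x3 + k) ^ 2"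
        using assms unfolding PQ(2) QR(3) True by simp
      then have "l * x1 + n = m * x3 + k \<or> l * x1 + n = - (m * x3 + k)"
        by (simp only: power2_eq_iff)
      then have "P = R \<or> R = point_neg P"
        unfolding PQ(2) QR(3) using True by (elim disjE) (simp_all only: point_neg.simps minus_minus simp_thms)
      then show ?thesis
      proof
        assume "P = R" then show ?thesis using assms by (metis add_comm add_closed)
      next
        assume R: "R = point_neg P"
        have "(P \<oplus> Q) \<oplus> R = point_neg P \<oplus> (P \<oplus> Q)"
          unfolding R using assms by (metis add_comm add_closed neg_in_E)
        also have "\<dots> = Q" using add_cancel assms by blast
        also have "Q = point_neg (point_neg P) \<oplus> (point_neg P \<oplus> Q)"
          using add_cancel[of "point_neg P" Q] assms by simp
        also have "\<dots> = P \<oplus> (Q \<oplus> R)"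
          unfolding R using assms by (metis add_comm neg_in_E point_neg_neg)
        finally show ?thesis .
      qed
    qed
  qed (use assms in auto)
qed (use assms in auto)

end

section \<open>Quadratic twists\<close>

lemma Rats_powr2_of_int:
  assumes "q \<in> \<rat>" "q ^ 2 = (of_int D :: complex)" "squarefree D"
  shows "D = 1"
proof -
  obtain m n where mn: "n > 0" "coprime m n" "q = of_int m / of_int n"
    using assms(1) by (elim Rats_cases') (metis that)
  then have "of_int m = q * of_int n" by simp
  then have "(of_int m :: complex) ^ 2 = of_int D * of_int n ^ 2"
    using assms(2) by (simp add: power_mult_distrib)
  then have "(of_int (m ^ 2) :: complex) = of_int (D * n ^ 2)"
    by simp
  then have e: "m ^ 2 = D * n ^ 2" by (simp only: of_int_eq_iff)
  then have "n ^ 2 dvd m ^ 2" by simp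
  then have "n dvd m" by simp
  then have "n = 1" using mn by (metis coprime_common_divisor dvd_refl zdvd1_eq abs_of_pos)
  with e have D: "D = m ^ 2" by simp
  then have "m ^ 2 dvd D" by simp
  with assms(3) have "m dvd 1" by (auto simp: squarefree_def)
  then show ?thesis unfolding D by (simp add: power2_eq_1_iff) linarith
qed

section \<open>The quadratic field and its conjugation\<close>

locale quadratic =
  fixes D :: int
  assumes sqf: "squarefree D" and ne1: "D \<noteq> 1"
begin

definition w :: complex where "w = csqrt (of_int D)"

lemma w2: "w ^ 2 = of_int D"
  by (simp add: w_def)

lemma w_irrational: "w \<notin> \<rat>"
  using Rats_powr2_of_int[OF _ w2 sqf] ne1 by auto

lemma w_nonzero [simp]: "w \<noteq> 0"
  using w_irrational by auto

abbreviation K where "K \<equiv> quadratic_field D"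

lemma K_I: "x \<in> \<rat> \<Longrightarrow> y \<in> \<rat> \<Longrightarrow> x + y * w \<in> K"
  by (auto simp: quadratic_field_def w_def)

lemma K_E:
  assumes "z \<in> K" obtains x y where "x \<in> \<rat>" "y \<in> \<rat>" "z = x + y * w"
  using assms by (auto simp: quadratic_field_def w_def)

lemma Rats_in_K [simp]: "x \<in> \<rat> \<Longrightarrow> x \<in> K"
  using K_I[of x 0] by simp

lemma K_unique:
  assumes "x \<in> \<rat>" "y \<in> \<rat>" "x' \<in> \<rat>" "y' \<in> \<rat>" "x + y * w = x' + y' * w"
  shows "x = x' \<and> y = y'"
proof (cases "y = y'")
  case False
  have "(y - y') * w = x' - x" using assms(5) by (simp add: algebra_simps)
  then have "w = (x' - x) / (y - y')" using False by (simp add: field_simps)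
  then have "w \<in> \<rat>" using assms by simp
  then show ?thesis using w_irrational by simp
qed (use assms in simp)

text \<open>The nontrivial automorphism of \<open>K\<close>. It is specified only on
  \<open>K\<close>, where \<open>K_unique\<close> makes it well defined, so the rules about it carry
  membership premises.\<close>

definition quad_conj :: "complex \<Rightarrow> complex" where
  "quad_conj z = (THE v. \<exists>x\<in>\<rat>. \<exists>y\<in>\<rat>. z = x + y * w \<and> v = x - y * w)"

lemma conj_eq: "x \<in> \<rat> \<Longrightarrow> y \<in> \<rat> \<Longrightarrow> quad_conj (x + y * w) = x - y * w"
  unfolding quad_conj_def by (rule the_equality) (use K_unique in blast)+

lemma conj_Rats [simp]: "x \<in> \<rat> \<Longrightarrow> quad_conj x = x"
  using conj_eq[of x 0] by simp

lemma K_add: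
  assumes "z \<in> K" "v \<in> K" shows "z + v \<in> K \<and> quad_conj (z + v) = quad_conj z + quad_conj v"
proof -
  obtain x y where z: "x \<in> \<rat>" "y \<in> \<rat>" "z = x + y * w" using assms K_E by metis
  obtain x' y' where v: "x' \<in> \<rat>" "y' \<in> \<rat>" "v = x' + y' * w" using assms K_E by metis
  have e: "z + v = (x + x') + (y + y') * w" using z v by (simp add: algebra_simps)
  show ?thesis unfolding e using z v K_I[of "x + x'" "y + y'"]
    by (subst conj_eq) (auto simp: conj_eq algebra_simps)
qed

lemma K_minus:
  assumes "z \<in> K" shows "- z \<in> K \<and> quad_conj (- z) = - quad_conj z"
proof -
  obtain x y where z: "x \<in> \<rat>" "y \<in> \<rat>" "z = x + y * w" using assms K_E by metis
  have e: "- z = (- x) + (- y) * w" using z by (simp add: algebra_simps)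
  show ?thesis unfolding e using z K_I[of "- x" "- y"]
    by (subst conj_eq) (auto simp: conj_eq algebra_simps)
qed

lemma K_mult:
  assumes "z \<in> K" "v \<in> K" shows "z * v \<in> K \<and> quad_conj (z * v) = quad_conj z * quad_conj v"
proof -
  obtain x y where z: "x \<in> \<rat>" "y \<in> \<rat>" "z = x + y * w" using assms K_E by metis
  obtain x' y' where v: "x' \<in> \<rat>" "y' \<in> \<rat>" "v = x' + y' * w" using assms K_E by metis
  have e: "z * v = (x * x' + of_int D * y * y') + (x * y' + x' * y) * w"
    unfolding z v w2[symmetric] by (simp add: algebra_simps power2_eq_square)
  have e2: "quad_conj z * quad_conj v = (x * x' + of_int D * y * y') - (x * y' + x' * y) * w"
    unfolding z(3) v(3) conj_eq[OF z(1,2)] conj_eq[OF v(1,2)] w2[symmetric] by (simp add: algebra_simps power2_eq_square)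
  show ?thesis unfolding e e2 using z v K_I conj_eq by simp
qed

lemma conj_in_K: "z \<in> K \<Longrightarrow> quad_conj z \<in> K"
  by (elim K_E) (use K_I[of _ "- _"] in \<open>auto simp: conj_eq\<close>)

lemma conj_conj: "z \<in> K \<Longrightarrow> quad_conj (quad_conj z) = z"
  by (elim K_E) (use conj_eq[of _ "- _"] in \<open>auto simp: conj_eq\<close>)

lemma conj_eq_0_iff [simp]: "z \<in> K \<Longrightarrow> quad_conj z = 0 \<longleftrightarrow> z = 0"
  by (metis conj_conj conj_Rats Rats_0)

lemma conj_eq_iff: "z \<in> K \<Longrightarrow> v \<in> K \<Longrightarrow> quad_conj z = quad_conj v \<longleftrightarrow> z = v"
  by (metis conj_conj)

lemma norm_Rats:
  assumes "z \<in> K" shows "z * quad_conj z \<in> \<rat>"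
proof -
  obtain x y where z: "x \<in> \<rat>" "y \<in> \<rat>" "z = x + y * w" using assms K_E by metis
  have "z * quad_conj z = x ^ 2 - of_int D * y ^ 2"
    unfolding z(3) conj_eq[OF z(1,2)] w2[symmetric] by (simp add: algebra_simps power2_eq_square)
  then show ?thesis using z by simp
qed

lemma K_inverse:
  assumes "z \<in> K" shows "inverse z \<in> K \<and> quad_conj (inverse z) = inverse (quad_conj z)"
proof (cases "z = 0")
  case False
  then have c: "quad_conj z \<noteq> 0" using assms by simp
  then have e: "inverse z = quad_conj z * inverse (z * quad_conj z)" by (simp add: field_simps)
  have r: "inverse (z * quad_conj z) \<in> \<rat>" using norm_Rats[OF assms] by (rule Rats_inverse)
  have i: "inverse z \<in> K" unfolding e using K_mult[OF conj_in_K[OF assms] Rats_in_K[OF r]] by blast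
  have "quad_conj z * quad_conj (inverse z) = quad_conj (z * inverse z)" using K_mult[OF assms i] by simp
  also have "\<dots> = 1" using False by simp
  finally show ?thesis using i c by (simp add: inverse_unique)
qed simp

lemma K_diff: "z \<in> K \<Longrightarrow> v \<in> K \<Longrightarrow> z - v \<in> K \<and> quad_conj (z - v) = quad_conj z - quad_conj v"
  using K_add[of z "- v"] K_minus[of v] by simp

lemma K_divide: "z \<in> K \<Longrightarrow> v \<in> K \<Longrightarrow> z / v \<in> K \<and> quad_conj (z / v) = quad_conj z / quad_conj v"
  using K_mult[of z "inverse v"] K_inverse[of v] by (simp add: divide_inverse)

lemma K_power2: "z \<in> K \<Longrightarrow> z ^ 2 \<in> K \<and> quad_conj (z ^ 2) = quad_conj z ^ 2"
  using K_mult[of z z] by (simp add: power2_eq_square)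

lemmas K_closed = K_add[THEN conjunct1] K_minus[THEN conjunct1] K_mult[THEN conjunct1]
  K_diff[THEN conjunct1] K_divide[THEN conjunct1] K_power2[THEN conjunct1]

lemmas conj_simps = K_add[THEN conjunct2] K_minus[THEN conjunct2] K_mult[THEN conjunct2]
  K_diff[THEN conjunct2] K_divide[THEN conjunct2] K_power2[THEN conjunct2]

lemma conj_fixed:
  assumes "z \<in> K" "quad_conj z = z" shows "z \<in> \<rat>"
proof -
  obtain x y where z: "x \<in> \<rat>" "y \<in> \<rat>" "z = x + y * w" using assms K_E by metis
  then have "x - y * w = x + y * w" using assms conj_eq by simp
  then show ?thesis using z by (simp add: algebra_simps)
qed

lemma conj_anti:
  assumes "z \<in> K" "quad_conj z = - z" obtains y where "y \<in> \<rat>" "z = y * w"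
proof -
  obtain x y where z: "x \<in> \<rat>" "y \<in> \<rat>" "z = x + y * w" using assms K_E by metis
  then have "x - y * w = - x - y * w" using assms conj_eq by simp
  then have "x = 0" by (simp add: algebra_simps)
  then show ?thesis using z that by simp
qed

fun conj_point :: "complex point \<Rightarrow> complex point" where
  "conj_point Infinity = Infinity"
| "conj_point (Affine x y) = Affine (quad_conj x) (quad_conj y)"

text \<open>Addition is given by rational functions over the rationals, which commute with
  conjugation; the equality tests in \<open>point_add\<close> survive because conjugation is
  injective on \<open>K\<close>.\<close>

lemma add_conj_aux:
  assumes "x1 \<in> K" "y1 \<in> K" "x2 \<in> K" "y2 \<in> K" "a \<in> \<rat>"
  shows "point_add 1 a (Affine x1 y1) (Affine x2 y2) \<in> {Infinity} \<union> {Affine x y |x y. x \<in> K \<and> y \<in> K} \<and>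
    conj_point (point_add 1 a (Affine x1 y1) (Affine x2 y2)) =
    point_add 1 a (Affine (quad_conj x1) (quad_conj y1)) (Affine (quad_conj x2) (quad_conj y2))"
proof -
  define l where "l = (if x1 = x2 then (3 * x1 ^ 2 + a) / (2 * 1 * y1) else (y2 - y1) / (x2 - x1))"
  have lK: "l \<in> K" unfolding l_def using assms by (simp add: K_closed)
  have cl: "quad_conj l = (if quad_conj x1 = quad_conj x2 then (3 * quad_conj x1 ^ 2 + a) / (2 * 1 * quad_conj y1) else (quad_conj y2 - quad_conj y1) / (quad_conj x2 - quad_conj x1))"
    unfolding l_def using assms by (simp add: K_closed conj_simps conj_eq_iff)
  have c: "quad_conj x1 = quad_conj x2 \<and> quad_conj y1 = - quad_conj y2 \<longleftrightarrow> x1 = x2 \<and> y1 = - y2"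
    using assms conj_eq_iff[of x1 x2] conj_eq_iff[of y1 "- y2"] by (simp add: conj_simps K_closed)
  show ?thesis
    unfolding point_add.simps c Let_def l_def[symmetric] cl[symmetric]
    using assms lK by (simp add: conj_simps K_closed)
qed

text \<open>Scaling ordinates by \<open>w\<close> scales slopes by \<open>w\<close>, and
  \<open>(l * w) ^ 2 = D * l ^ 2\<close> accounts for the coefficient in
  \<open>point_add\<close>.\<close>

lemma twist_map_add:
  "twist_map D (point_add (of_int D) a P Q) = point_add 1 a (twist_map D P) (twist_map D Q)"
proof (cases "P = Infinity \<or> Q = Infinity")
  case True
  then show ?thesis by (cases P; cases Q) auto
next
  case False
  then obtain x1 y1 x2 y2 where P: "P = Affine x1 y1" and Q: "Q = Affine x2 y2"
    by (metis point.exhaust)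
  define l where "l = (if x1 = x2 then (3 * x1 ^ 2 + a) / (2 * of_int D * y1) else (y2 - y1) / (x2 - x1))"
  have D: "of_int D = w * w" using w2 by (simp add: power2_eq_square)
  have l: "(if x1 = x2 then (3 * x1 ^ 2 + a) / (2 * 1 * (y1 * w)) else (y2 * w - y1 * w) / (x2 - x1)) = l * w"
  proof (cases "x1 = x2")
    case True
    have "c / (2 * 1 * (y * w)) = c / (2 * (w * w) * y) * w" for c y
      by (cases "y = 0") (simp_all add: field_simps)
    then show ?thesis using True by (simp only: l_def D simp_thms if_True)
  next
    case False
    then show ?thesis by (simp add: l_def field_simps)
  qed
  have c: "y1 * w = - (y2 * w) \<longleftrightarrow> y1 = - y2"
    by (metis mult_minus_left mult_right_cancel w_nonzero)
  have tw: "twist_map D (Affine x y) = Affine x (y * w)" for x y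
    by (simp add: w_def)
  show ?thesis
    unfolding P Q tw point_add.simps c Let_def l l_def[symmetric]
    by (auto simp: tw D algebra_simps power2_eq_square simp del: twist_map.simps(2))
qed

end

section \<open>Conjugation of points and the map eta\<close>

locale twisted_curve = quadratic D for D +
  fixes A B :: int
  assumes disc: "4 * A ^ 3 + 27 * B ^ 2 \<noteq> 0"
begin

sublocale weierstrass "of_int A :: complex" "of_int B"
proof
  have "(of_int (4 * A ^ 3 + 27 * B ^ 2) :: complex) \<noteq> 0" using disc by (simp only: of_int_eq_0_iff not_False_eq_True)
  then show "4 * (of_int A :: complex) ^ 3 + 27 * of_int B ^ 2 \<noteq> 0"
    by (simp only: of_int_add of_int_mult of_int_power of_int_numeral not_False_eq_True)
qed

notation add (infixl "\<oplus>" 65)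

abbreviation EQ where "EQ \<equiv> points 1 (of_int A) (of_int B) (\<rat> :: complex set)"
abbreviation EK where "EK \<equiv> points 1 (of_int A) (of_int B) K"
abbreviation ED where "ED \<equiv> points (of_int D) (of_int A) (of_int B) (\<rat> :: complex set)"

lemma EK_E: "P \<in> EK \<Longrightarrow> P \<in> E"
  by (auto simp: points_def)

lemma EQ_EK: "P \<in> EQ \<Longrightarrow> P \<in> EK"
  by (auto simp: points_def)

lemma EQ_E: "P \<in> EQ \<Longrightarrow> P \<in> E"
  by (auto simp: points_def)

lemma EK_add_conj:
  assumes "P \<in> EK" "Q \<in> EK"
  shows "P \<oplus> Q \<in> EK" and "conj_point (P \<oplus> Q) = conj_point P \<oplus> conj_point Q"
proof -
  have "P \<oplus> Q \<in> EK \<and> conj_point (P \<oplus> Q) = conj_point P \<oplus> conj_point Q"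
  proof (cases "P = Infinity \<or> Q = Infinity")
    case True
    then show ?thesis using assms by auto
  next
    case False
    then obtain x1 y1 x2 y2 where P: "P = Affine x1 y1" and Q: "Q = Affine x2 y2"
      by (metis point.exhaust)
    have K: "x1 \<in> K" "y1 \<in> K" "x2 \<in> K" "y2 \<in> K" using assms P Q by (auto simp: points_def)
    have "P \<oplus> Q \<in> E" using assms EK_E add_closed by blast
    then show ?thesis using add_conj_aux[OF K, of "of_int A"]
      unfolding P Q conj_point.simps by (auto simp: points_def simp del: point_add.simps)
  qed
  then show "P \<oplus> Q \<in> EK" and "conj_point (P \<oplus> Q) = conj_point P \<oplus> conj_point Q" by auto
qed

lemma EK_neg: "P \<in> EK \<Longrightarrow> point_neg P \<in> EK"
  by (cases P) (auto simp: points_def K_closed)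

lemma EQ_neg: "P \<in> EQ \<Longrightarrow> point_neg P \<in> EQ"
  by (cases P) (auto simp: points_def)

lemma conj_point_neg: "P \<in> EK \<Longrightarrow> conj_point (point_neg P) = point_neg (conj_point P)"
  by (cases P) (auto simp: points_def conj_simps)

lemma conj_point_EQ: "P \<in> EQ \<Longrightarrow> conj_point P = P"
  by (cases P) (auto simp: points_def)

lemma conj_point_fixed: "P \<in> EK \<Longrightarrow> conj_point P = P \<Longrightarrow> P \<in> EQ"
  by (cases P) (auto simp: points_def conj_fixed)

lemma conj_point_EK:
  assumes "P \<in> EK" shows "conj_point P \<in> EK"
proof (cases P)
  case (Affine x y)
  then have h: "x \<in> K" "y \<in> K" "y ^ 2 = x ^ 3 + of_int A * x + of_int B" using assms by (auto simp: points_def)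
  have "quad_conj (y ^ 2) = quad_conj (x * x ^ 2 + of_int A * x + of_int B)"
    using h by (simp add: power3_eq_cube power2_eq_square mult.assoc)
  then have "quad_conj y ^ 2 = quad_conj x ^ 3 + of_int A * quad_conj x + of_int B"
    using h by (simp add: conj_simps K_closed power3_eq_cube power2_eq_square mult.assoc)
  then show ?thesis using Affine h conj_in_K by (simp add: points_def)
qed (auto simp: points_def)

lemma twist_EK: "P \<in> ED \<Longrightarrow> twist_map D P \<in> EK \<and> conj_point (twist_map D P) = point_neg (twist_map D P)"
proof (cases P)
  case (Affine x y)
  assume "P \<in> ED"
  then have h: "x \<in> \<rat>" "y \<in> \<rat>" "of_int D * y ^ 2 = x ^ 3 + of_int A * x + of_int B"
    using Affine by (auto simp: points_def)
  have "(y * w) ^ 2 = x ^ 3 + of_int A * x + of_int B"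
    using h(3) unfolding w2[symmetric] by (simp add: power_mult_distrib mult.commute)
  moreover have "y * w \<in> K" "quad_conj (y * w) = - (y * w)"
    using K_I[of 0 y] conj_eq[of 0 y] h by auto
  ultimately show ?thesis using Affine h by (simp add: points_def w_def)
qed (auto simp: points_def)

text \<open>With \<open>twist_EK\<close>, the image of the twist is exactly the set of points that
  conjugation negates: \<open>x\<close> is rational and \<open>y\<close> a rational multiple of
  \<open>w\<close>.\<close>

lemma EK_anti:
  assumes "P \<in> EK" "conj_point P = point_neg P"
  shows "P \<in> twist_map D ` ED"
proof (cases P)
  case Infinity
  then have "P = twist_map D Infinity" by simp
  then show ?thesis by (rule image_eqI) (simp add: points_def)
next
  case (Affine x y)
  then have h: "x \<in> K" "y \<in> K" "y ^ 2 = x ^ 3 + of_int A * x + of_int B" "quad_conj x = x" "quad_conj y = - y"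
    using assms by (auto simp: points_def)
  then obtain v where v: "v \<in> \<rat>" "y = v * w" using conj_anti by metis
  have "of_int D * v ^ 2 = x ^ 3 + of_int A * x + of_int B"
    using h(3) unfolding v(2) w2[symmetric] by (simp add: power_mult_distrib mult.commute)
  then have "Affine x v \<in> ED" using h v conj_fixed by (auto simp: points_def)
  moreover have "P = twist_map D (Affine x v)" using Affine v by (simp add: w_def)
  ultimately show ?thesis by blast
qed

lemma twist_map_inj: "twist_map D P = twist_map D Q \<Longrightarrow> P = Q"
  using w_nonzero by (cases P; cases Q) (auto simp: w_def)

lemma twist_map_eq: "eta (A, B) D (P, Q) = twist_map D P \<oplus> Q"
  by (simp add: eta_def point_group_def)

lemma add_add_swap:
  assumes "P \<in> E" "Q \<in> E" "R \<in> E" "S \<in> E"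
  shows "(P \<oplus> Q) \<oplus> (R \<oplus> S) = (P \<oplus> R) \<oplus> (Q \<oplus> S)"
proof -
  have "Q \<oplus> (R \<oplus> S) = R \<oplus> (Q \<oplus> S)"
    using assms add_assoc[of Q R S] add_assoc[of R Q S] add_comm[of Q R] by simp
  then show ?thesis using assms by (simp add: add_assoc add_closed)
qed

lemma add_neg_cancel:
  assumes "P \<in> E" "Q \<in> E"
  shows "(P \<oplus> Q) \<oplus> point_neg Q = P" "(P \<oplus> point_neg Q) \<oplus> Q = P"
  using add_assoc[of P Q "point_neg Q"] add_assoc[of P "point_neg Q" Q] assms by simp_all

lemma eta_hom:
  assumes "P \<in> ED" "Q \<in> EQ" "P' \<in> ED" "Q' \<in> EQ"
  shows "twist_map D (point_add (of_int D) (of_int A) P P') \<oplus> (Q \<oplus> Q') = (twist_map D P \<oplus> Q) \<oplus> (twist_map D P' \<oplus> Q')"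
proof -
  have 1: "twist_map D P \<in> E" "twist_map D P' \<in> E" "Q \<in> E" "Q' \<in> E"
    using assms twist_EK EK_E EQ_E by blast+
  show ?thesis unfolding twist_map_add
    using add_add_swap[OF 1(1,2,3,4)] .
qed

text \<open>Injectivity: two preimages differ by a rational point that conjugation also negates, so
  it equals its own negative and is \<open>Infinity\<close> by \<open>no2\<close>. Surjectivity: if
  \<open>R \<oplus> conj_point R = Q \<oplus> Q\<close>, then conjugation negates
  \<open>R \<oplus> point_neg Q\<close>, which therefore comes from the twist.\<close>

lemma eta_is_iso_if:
  assumes no2: "\<And>x :: complex. x \<in> \<rat> \<Longrightarrow> x ^ 3 + of_int A * x + of_int B \<noteq> 0"
    and halve: "\<And>R. R \<in> EK \<Longrightarrow> \<exists>Q\<in>EQ. R \<oplus> conj_point R = Q \<oplus> Q"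
  shows "eta_is_iso (A, B) D"
proof -
  let ?G = "twist_group (A, B) D \<rat> \<times>\<times> curve_group (A, B) \<rat>"
  let ?H = "curve_group (A, B) K"
  have GH: "carrier ?G = ED \<times> EQ" "carrier ?H = EK"
    by (simp_all add: point_group_def DirProd_def)
  have "eta (A, B) D \<in> hom ?G ?H"
  proof (rule homI)
    fix p assume "p \<in> carrier ?G"
    then obtain P Q where "p = (P, Q)" "P \<in> ED" "Q \<in> EQ" unfolding GH by auto
    then show "eta (A, B) D p \<in> carrier ?H"
      unfolding GH using twist_map_eq EK_add_conj twist_EK EQ_EK by auto
  next
    fix p q assume "p \<in> carrier ?G" "q \<in> carrier ?G"
    then obtain P Q P' Q' where "p = (P, Q)" "P \<in> ED" "Q \<in> EQ" "q = (P', Q')" "P' \<in> ED" "Q' \<in> EQ"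
      unfolding GH by auto
    then show "eta (A, B) D (p \<otimes>\<^bsub>?G\<^esub> q) = eta (A, B) D p \<otimes>\<^bsub>?H\<^esub> eta (A, B) D q"
      using eta_hom by (simp add: DirProd_def twist_map_eq point_group_def)
  qed
  moreover have "inj_on (eta (A, B) D) (ED \<times> EQ)"
  proof (rule inj_onI)
    fix pq pq' assume "pq \<in> ED \<times> EQ" "pq' \<in> ED \<times> EQ" and e: "eta (A, B) D pq = eta (A, B) D pq'"
    then obtain P Q P' Q' where p: "pq = (P, Q)" "P \<in> ED" "Q \<in> EQ" "pq' = (P', Q')" "P' \<in> ED" "Q' \<in> EQ"
      by auto
    define p1 p2 where "p1 = twist_map D P" and "p2 = twist_map D P'"
    have pE: "p1 \<in> EK" "p2 \<in> EK" "Q \<in> EK" "Q' \<in> EK"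
      using p twist_EK EQ_EK by (auto simp: p1_def p2_def)
    have pE': "p1 \<in> E" "p2 \<in> E" "Q \<in> E" "Q' \<in> E" using pE EK_E by auto
    have "p1 \<oplus> Q = p2 \<oplus> Q'" using e p twist_map_eq by (simp add: p1_def p2_def)
    then have "p1 = (p2 \<oplus> Q') \<oplus> point_neg Q"
      using add_neg_cancel(1)[of p1 Q] pE' by simp
    also have "\<dots> = p2 \<oplus> (Q' \<oplus> point_neg Q)" using pE' by (simp add: add_assoc)
    finally have p1: "p1 = p2 \<oplus> (Q' \<oplus> point_neg Q)" .
    define S where "S = Q' \<oplus> point_neg Q"
    have SK: "S \<in> EK" unfolding S_def using pE EK_add_conj EK_neg by blast
    then have SE: "S \<in> E" by (rule EK_E)
    have S: "S = point_neg p2 \<oplus> p1" unfolding p1 S_def[symmetric] using add_cancel pE' SE by simp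
    have "conj_point S = S" unfolding S_def
      using pE p EK_neg EQ_neg by (simp add: EK_add_conj conj_point_EQ)
    then have SQ: "S \<in> EQ" using SK conj_point_fixed by blast
    have "conj_point S = point_neg S"
      unfolding S using pE pE' p EK_neg twist_EK
      by (simp add: EK_add_conj conj_point_neg neg_add p1_def p2_def)
    with \<open>conj_point S = S\<close> have "S = point_neg S" by simp
    then have Si: "S = Infinity"
    proof (cases S)
      case (Affine x y)
      with \<open>S = point_neg S\<close> have "y = 0" by simp
      then show ?thesis using SQ no2[of x] Affine by (auto simp: points_def)
    qed
    then have "p1 = p2" using p1 S_def by simp
    moreover have "Q = Q'" using Si[unfolded S_def] add_neg_cancel(2)[of Q' Q] pE' by simp
    ultimately show "pq = pq'" using p twist_map_inj by (simp add: p1_def p2_def)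
  qed
  moreover have "eta (A, B) D ` (ED \<times> EQ) = EK"
  proof (intro equalityI subsetI)
    fix R assume "R \<in> eta (A, B) D ` (ED \<times> EQ)"
    then show "R \<in> EK" using twist_map_eq EK_add_conj twist_EK EQ_EK by auto
  next
    fix R assume R: "R \<in> EK"
    then obtain Q where Q: "Q \<in> EQ" "R \<oplus> conj_point R = Q \<oplus> Q" using halve by blast
    define S where "S = R \<oplus> point_neg Q"
    have QK: "Q \<in> EK" using Q EQ_EK by blast
    have inE: "R \<in> E" "conj_point R \<in> E" "Q \<in> E" using R Q conj_point_EK EK_E EQ_E by auto
    have SK: "S \<in> EK" unfolding S_def using R QK EK_neg EK_add_conj by blast
    have "S \<oplus> conj_point S = (R \<oplus> point_neg Q) \<oplus> (conj_point R \<oplus> point_neg Q)"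
      unfolding S_def using R QK Q EK_neg by (simp add: EK_add_conj conj_point_neg conj_point_EQ)
    also have "\<dots> = (R \<oplus> conj_point R) \<oplus> (point_neg Q \<oplus> point_neg Q)"
      using inE by (intro add_add_swap neg_in_E)
    also have "\<dots> = Infinity"
      unfolding Q(2) neg_add[OF inE(3) inE(3), symmetric] by simp
    finally have "S \<oplus> conj_point S = Infinity" .
    then have "conj_point S = point_neg S"
      using add_cancel[of S "conj_point S"] SK EK_E conj_point_EK by simp
    then obtain P where P: "P \<in> ED" "S = twist_map D P" using EK_anti SK by blast
    have "R = twist_map D P \<oplus> Q"
      unfolding P(2)[symmetric] S_def using inE add_neg_cancel(2) by simp
    then show "R \<in> eta (A, B) D ` (ED \<times> EQ)"
      using P Q twist_map_eq by (metis SigmaI image_eqI)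
  qed
  ultimately show ?thesis
    unfolding eta_is_iso_def iso_def GH bij_betw_def by simp
qed

text \<open>
  Let \<open>U = (r, s)\<close> be the negative of \<open>R + \<sigma> R\<close>. The line of slope \<open>m\<close> through \<open>U\<close> meets the curve in two
  further points, and the quartic in \<open>m\<close> below is the discriminant of the quadratic for their
  abscissae: for the line through \<open>R\<close> and \<open>\<sigma> R\<close> it is \<open>D\<close> times a square, and it vanishes for
  tangents, which give a half of \<open>- U\<close>.
\<close>
lemma not_halved:
  assumes R: "R \<in> EK" and nh: "\<And>Q. Q \<in> EQ \<Longrightarrow> R \<oplus> conj_point R \<noteq> Q \<oplus> Q"
  obtains r s l z :: complex where "r \<in> \<rat>" "s \<in> \<rat>" "l \<in> \<rat>" "z \<in> \<rat>" "s ^ 2 = r ^ 3 + of_int A * r + of_int B"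
    "l ^ 4 - 6 * r * l ^ 2 + 8 * s * l - 3 * r ^ 2 - 4 * of_int A = of_int D * z ^ 2"
    "\<And>m::complex. m \<in> \<rat> \<Longrightarrow> m ^ 4 - 6 * r * m ^ 2 + 8 * s * m - 3 * r ^ 2 - 4 * of_int A \<noteq> 0"
proof (cases R)
  case Infinity
  then show ?thesis using nh[of Infinity] by (simp add: points_def)
next
  case (Affine X Y)
  define X' Y' where "X' = quad_conj X" and "Y' = quad_conj Y"
  have K: "X \<in> K" "Y \<in> K" "X' \<in> K" "Y' \<in> K" "quad_conj X' = X" "quad_conj Y' = Y"
    using R Affine conj_in_K conj_conj by (auto simp: points_def X'_def Y'_def)
  have R': "conj_point R = Affine X' Y'" by (simp add: Affine X'_def Y'_def)
  have inE: "Affine X Y \<in> E" "Affine X' Y' \<in> E"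
    using EK_E[OF R, unfolded Affine] EK_E[OF conj_point_EK[OF R], unfolded R'] .
  \<comment> \<open>Otherwise the sum is a double: of the then rational point \<open>R\<close>, or
    of \<open>Infinity\<close>.\<close>
  have ne: "X \<noteq> X'"
  proof
    assume x: "X = X'"
    then have "Y ^ 2 = Y' ^ 2" using inE by simp
    then have "Y' = Y \<or> Y' = - Y" by (auto simp: power2_eq_iff)
    then show False
    proof
      assume "Y' = Y"
      then have "conj_point R = R" using R' Affine x by simp
      then show False using nh[of R] conj_point_fixed R by auto
    next
      assume "Y' = - Y"
      then show False using nh[of Infinity] R' Affine x by (simp add: points_def)
    qed
  qed
  then obtain l n r where c: "chord l n X X' r" and Y: "Y = l * X + n" "Y' = l * X' + n"
    using chord_exists[OF inE] by blast
  \<comment> \<open>Conjugation exchanges the two points and hence fixes the line through them, so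
    \<open>l\<close>, \<open>n\<close> and the third intersection are rational.\<close>
  have l: "l = (Y - Y') / (X - X')" using Y ne by (simp add: field_simps)
  have lK: "l \<in> K" unfolding l using K by (simp add: K_closed)
  have "quad_conj l = (Y' - Y) / (X' - X)"
    unfolding l using K by (simp add: K_closed conj_simps X'_def[symmetric] Y'_def[symmetric])
  also have "\<dots> = l" unfolding l by (metis minus_diff_eq minus_divide_divide)
  finally have lQ: "l \<in> \<rat>" using conj_fixed lK by simp
  have n: "n = Y - l * X" "n = Y' - l * X'" using Y by simp_all
  have "quad_conj n = n" unfolding n(1) using K lK lQ n
    by (simp add: K_closed conj_simps X'_def[symmetric] Y'_def[symmetric])
  moreover have "n \<in> K" unfolding n(1) using K lK by (simp add: K_closed)
  ultimately have nQ: "n \<in> \<rat>" using conj_fixed by simp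
  have rr: "r = l ^ 2 - (X + X')" using c by (simp add: chord_def)
  have "X + X' \<in> \<rat>"
    using K by (intro conj_fixed) (simp_all add: K_closed conj_simps X'_def[symmetric])
  then have rQ: "r \<in> \<rat>" unfolding rr using lQ by simp
  define s where "s = l * r + n"
  have sQ: "s \<in> \<rat>" unfolding s_def using lQ rQ nQ by simp
  have s2: "s ^ 2 = r ^ 3 + of_int A * r + of_int B"
    unfolding s_def using chord_on_curve[OF chord_rot[OF chord_rot[OF c]]] .
  have "quad_conj (X - X') = - (X - X')" using K by (simp add: conj_simps X'_def[symmetric])
  then obtain z where z: "z \<in> \<rat>" "X - X' = z * w" using conj_anti K_closed(4) K by metis
  have "l ^ 4 - 6 * r * l ^ 2 + 8 * s * l - 3 * r ^ 2 - 4 * of_int A = (X - X') ^ 2"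
  proof -
    have "l ^ 2 = X + X' + r" "of_int A - 2 * l * n = X * X' + X * r + X' * r"
      using c by (auto simp: chord_def)
    then show ?thesis unfolding s_def by algebra
  qed
  also have "\<dots> = of_int D * z ^ 2" unfolding z(2) w2[symmetric] by (simp add: power_mult_distrib)
  finally have Gl: "l ^ 4 - 6 * r * l ^ 2 + 8 * s * l - 3 * r ^ 2 - 4 * of_int A = of_int D * z ^ 2" .
  have nonzero: "m ^ 4 - 6 * r * m ^ 2 + 8 * s * m - 3 * r ^ 2 - 4 * of_int A \<noteq> 0" if m: "m \<in> \<rat>" for m
  proof
    assume G: "m ^ 4 - 6 * r * m ^ 2 + 8 * s * m - 3 * r ^ 2 - 4 * of_int A = 0"
    \<comment> \<open>The abscissae on a line of slope \<open>m\<close> add up to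
      \<open>m ^ 2\<close>; \<open>x0\<close> is the double one besides \<open>r\<close>.\<close>
    define x0 where "x0 = (m ^ 2 - r) / 2"
    define n0 where "n0 = s - m * r"
    have x0: "2 * x0 = m ^ 2 - r" by (simp add: x0_def)
    have "4 * (of_int A - 2 * m * n0) = 4 * (x0 * x0 + x0 * r + x0 * r)"
      using x0 G unfolding n0_def by algebra
    from iffD1[OF mult_left_cancel[OF numeral_neq_zero] this]
    have a: "of_int A - 2 * m * n0 = x0 * x0 + x0 * r + x0 * r" .
    have b: "n0 ^ 2 - of_int B = x0 * x0 * r" using s2 a x0 unfolding n0_def by algebra
    have "chord m n0 x0 x0 r" unfolding chord_def using x0 a b by (simp add: algebra_simps)
    note tangent = chord_sum[OF this] chord_on_curve[OF this]
    have "x0 \<in> \<rat>" "m * x0 + n0 \<in> \<rat>" using m rQ sQ by (simp_all add: x0_def n0_def)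
    then have "Affine x0 (m * x0 + n0) \<in> EQ" using tangent(2) by (simp add: points_def)
    moreover have "R \<oplus> conj_point R = Affine r (- s)"
      unfolding R' unfolding Affine Y s_def using chord_sum[OF c] .
    moreover have "m * r + n0 = s" by (simp add: n0_def)
    ultimately show False using nh tangent(1) by metis
  qed
  show ?thesis by (rule that[OF rQ sQ lQ z(1) s2 Gl nonzero])
qed

end

text \<open>From here on everything lives in type \<open>rat\<close>, where numerators and
  denominators are at hand.\<close>

theorem eta_not_iso_cases:
  assumes "squarefree D" "D \<noteq> 1" "4 * A ^ 3 + 27 * B ^ 2 \<noteq> 0" "\<not> eta_is_iso (A, B) D"
  shows "(\<exists>q::rat. q ^ 3 + of_int A * q + of_int B = 0) \<or>
    (\<exists>r s l z::rat. s ^ 2 = r ^ 3 + of_int A * r + of_int B \<and>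
      l ^ 4 - 6 * r * l ^ 2 + 8 * s * l - 3 * r ^ 2 - 4 * of_int A = of_int D * z ^ 2 \<and>
      (\<forall>m. m ^ 4 - 6 * r * m ^ 2 + 8 * s * m - 3 * r ^ 2 - 4 * of_int A \<noteq> 0))"
proof -
  interpret twisted_curve D A B using assms by unfold_locales auto
  have tr: "(x :: rat) = y \<longleftrightarrow> (of_rat x :: complex) = of_rat y" for x y by simp
  show ?thesis
  proof (cases "\<exists>x::complex. x \<in> \<rat> \<and> x ^ 3 + of_int A * x + of_int B = 0")
    case True
    then obtain q where "(of_rat q :: complex) ^ 3 + of_int A * of_rat q + of_int B = 0"
      by (auto elim: Rats_cases)
    then have "q ^ 3 + of_int A * q + of_int B = 0"
      unfolding tr by (simp add: of_rat_add of_rat_mult of_rat_power)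
    then show ?thesis by blast
  next
    case False
    then obtain R where R: "R \<in> EK" and nh: "\<And>Q. Q \<in> EQ \<Longrightarrow> R \<oplus> conj_point R \<noteq> Q \<oplus> Q"
      using eta_is_iso_if assms(4) by blast
    obtain r' s' l' z' :: complex where Q: "r' \<in> \<rat>" "s' \<in> \<rat>" "l' \<in> \<rat>" "z' \<in> \<rat>" and e:
      "s' ^ 2 = r' ^ 3 + of_int A * r' + of_int B"
      "l' ^ 4 - 6 * r' * l' ^ 2 + 8 * s' * l' - 3 * r' ^ 2 - 4 * of_int A = of_int D * z' ^ 2"
      "\<And>m::complex. m \<in> \<rat> \<Longrightarrow> m ^ 4 - 6 * r' * m ^ 2 + 8 * s' * m - 3 * r' ^ 2 - 4 * of_int A \<noteq> 0"
      using not_halved[OF R nh] by blast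
    obtain r s l z where r: "r' = of_rat r" "s' = of_rat s" "l' = of_rat l" "z' = of_rat z"
      using Q by (metis Rats_cases)
    have "s ^ 2 = r ^ 3 + of_int A * r + of_int B"
      unfolding tr using e(1) by (simp add: r of_rat_add of_rat_mult of_rat_power)
    moreover have "l ^ 4 - 6 * r * l ^ 2 + 8 * s * l - 3 * r ^ 2 - 4 * of_int A = of_int D * z ^ 2"
      unfolding tr using e(2) by (simp add: r of_rat_add of_rat_diff of_rat_mult of_rat_power)
    moreover have "m ^ 4 - 6 * r * m ^ 2 + 8 * s * m - 3 * r ^ 2 - 4 * of_int A \<noteq> 0" for m
      unfolding tr using e(3)[of "of_rat m"] by (simp add: r of_rat_add of_rat_diff of_rat_mult of_rat_power)
    ultimately show ?thesis by blast
  qed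
qed

section \<open>The quartic of a 2-covering\<close>

text \<open>With the binomial factors split off, the invariants \<open>I\<close> and
  \<open>J\<close> are integral polynomials in \<open>a\<close>, ..., \<open>e\<close>.\<close>

definition quartic :: "'a::comm_ring_1 \<Rightarrow> 'a \<Rightarrow> 'a \<Rightarrow> 'a \<Rightarrow> 'a \<Rightarrow> 'a \<Rightarrow> 'a \<Rightarrow> 'a" where
  "quartic a b c d e x y =
     a * x ^ 4 + 4 * b * x ^ 3 * y + 6 * c * x ^ 2 * y ^ 2 + 4 * d * x * y ^ 3 + e * y ^ 4"

text \<open>The quartic of \<open>not_halved\<close>, homogenised in the slope. For
  \<open>(r, s)\<close> on the curve its invariants are \<open>I = - 4 * A\<close> and
  \<open>J = - 4 * B\<close>.\<close>

definition point_quartic :: "'a::comm_ring_1 \<Rightarrow> 'a \<Rightarrow> 'a \<Rightarrow> 'a \<Rightarrow> 'a \<Rightarrow> 'a" where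
  "point_quartic A r s x y = quartic 1 0 (- r) (2 * s) (- 4 * A - 3 * r ^ 2) x y"

lemma of_int_quartic:
  "of_int (quartic a b c d e x y) =
     quartic (of_int a) (of_int b) (of_int c) (of_int d) (of_int e) (of_int x) (of_int y)"
  by (simp add: quartic_def)

lemma quartic_homogeneous:
  fixes a :: "'a::comm_ring_1"
  shows "quartic a b c d e (v * x) (v * y) = v ^ 4 * quartic a b c d e x y"
  unfolding quartic_def by (simp add: power_mult_distrib power2_eq_square power3_eq_cube power4_eq_xxxx algebra_simps)

lemma rat_coprime_quotient:
  obtains m n :: int where "n > 0" "coprime m n" "q = of_int m / (of_int n :: rat)"
  by (metis quotient_of_denom_pos quotient_of_coprime quotient_of_div surj_pair)

text \<open>Clearing denominators gives \<open>u ^ 2 * n ^ 3 = v ^ 2 * w\<close>, where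
  \<open>n\<close> is coprime to \<open>w\<close> and \<open>v\<close> to \<open>u\<close>. Hence
  \<open>n ^ 3 = v ^ 2\<close>, which forces a square and a cube of one integer.\<close>

lemma rational_point:
  fixes A B :: int and r s :: rat
  assumes "s ^ 2 = r ^ 3 + of_int A * r + of_int B"
  obtains m u t :: int where "t > 0" "coprime m t" "r = of_int m / of_int t ^ 2" "s = of_int u / of_int t ^ 3"
    "u ^ 2 = m ^ 3 + A * m * t ^ 4 + B * t ^ 6"
proof -
  obtain m n where r: "n > 0" "coprime m n" "r = of_int m / of_int n" by (rule rat_coprime_quotient)
  obtain u v where s: "v > 0" "coprime u v" "s = of_int u / of_int v" by (rule rat_coprime_quotient)
  define w where "w = m ^ 3 + A * m * n ^ 2 + B * n ^ 3"
  have "(of_int u :: rat) ^ 2 * of_int n ^ 3 = of_int v ^ 2 * (of_int m ^ 3 + of_int A * of_int m * of_int n ^ 2 + of_int B * of_int n ^ 3)"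
    using assms r s by (simp add: field_simps power2_eq_square power3_eq_cube)
  then have "(of_int (u ^ 2 * n ^ 3) :: rat) = of_int (v ^ 2 * w)" by (simp add: w_def)
  then have e: "u ^ 2 * n ^ 3 = v ^ 2 * w" by (simp only: of_int_eq_iff)
  have "w = m ^ 3 + n * (A * m * n + B * n ^ 2)" by (simp add: w_def algebra_simps power2_eq_square power3_eq_cube)
  then have "gcd n w = gcd n (m ^ 3)" by (metis gcd_add_mult mult.commute add.commute)
  then have "coprime n w" using r(2) by (metis coprime_iff_gcd_eq_1 coprime_power_right_iff coprime_commute)
  then have "coprime (n ^ 3) w" by simp
  moreover have "n ^ 3 dvd v ^ 2 * w" using e by (metis dvd_triv_right)
  ultimately have 1: "n ^ 3 dvd v ^ 2" by (simp add: coprime_dvd_mult_left_iff)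
  have "coprime (v ^ 2) (u ^ 2)" using s(2) by (simp add: coprime_commute)
  moreover have "v ^ 2 dvd u ^ 2 * n ^ 3" using e by simp
  ultimately have 2: "v ^ 2 dvd n ^ 3" by (simp add: coprime_dvd_mult_right_iff)
  have nv: "n ^ 3 = v ^ 2" using 1 2 r(1) s(1) by (simp add: zdvd_antisym_nonneg)
  have "n ^ 2 dvd v ^ 2" unfolding nv[symmetric] by (rule le_imp_power_dvd) simp
  then have "n dvd v" by simp
  then obtain t where t: "v = n * t" by (elim dvdE)
  have "n ^ 2 * t ^ 2 = n ^ 2 * n" using nv
    by (metis t power_mult_distrib power_add_numeral2 power_Suc2 power2_eq_square power3_eq_cube mult.assoc)
  then have nt: "n = t ^ 2" using r(1) mult_left_cancel[of "n ^ 2" "t ^ 2" n] by simp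
  have tpos: "t > 0" using s(1) r(1) unfolding t by (simp add: zero_less_mult_iff)
  have v: "v = t ^ 3" using t nt by (simp add: power2_eq_square power3_eq_cube)
  have "v ^ 2 * u ^ 2 = v ^ 2 * w" using e unfolding nv by (simp add: mult.commute)
  then have "u ^ 2 = w" using s(1) by simp
  then have "u ^ 2 = m ^ 3 + A * m * t ^ 4 + B * t ^ 6" unfolding w_def nt by simp
  moreover have "coprime m t" using r(2) unfolding nt by simp
  ultimately show ?thesis using that tpos r(3) s(3) nt v by simp
qed

text \<open>The premises are the coefficients after the substitution, divided by
  \<open>T ^ 2\<close>. Its determinant is \<open>T\<close>, and the invariants scale by the 4th and
  6th power of the determinant, so this division restores their values.\<close>

lemma quartic_substitution:
  fixes a :: "'a::idom"
  assumes "a = T ^ 2" "b = k * T" "c = k ^ 2 - r" "T * d = k ^ 3 - 3 * r * k + 2 * s"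
    "T ^ 2 * e = k ^ 4 - 6 * r * k ^ 2 + 8 * s * k - 3 * r ^ 2 - 4 * A"
  shows "T ^ 2 * quartic a b c d e x y = point_quartic A r s (T * x + k * y) y"
proof -
  have "T ^ 2 * quartic a b c d e x y =
    T ^ 2 * a * x ^ 4 + 4 * T ^ 2 * b * x ^ 3 * y + 6 * T ^ 2 * c * x ^ 2 * y ^ 2 + 4 * T * (T * d) * x * y ^ 3 + (T ^ 2 * e) * y ^ 4"
    by (simp add: quartic_def algebra_simps power2_eq_square)
  also have "\<dots> = point_quartic A r s (T * x + k * y) y"
    unfolding assms point_quartic_def quartic_def by algebra
  finally show ?thesis .
qed

text \<open>The shift must make all five coefficients integral. Since \<open>u ^ 2\<close> is
  congruent to \<open>m ^ 3\<close> modulo \<open>t ^ 4\<close>, the quotient \<open>u / m\<close>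
  is a square root of \<open>m\<close> there; an integer congruent to \<open>u / m\<close> modulo
  \<open>t ^ 6\<close>, divided by \<open>t\<close>, is the required shift.\<close>

lemma integral_quartic:
  fixes A B :: int and r s :: rat
  assumes "s ^ 2 = r ^ 3 + of_int A * r + of_int B"
  obtains t a b c d e :: int and k :: rat where "t > 0"
    "(of_int a :: rat) = of_int t ^ 2" "of_int b = k * of_int t" "of_int c = k ^ 2 - r"
    "of_int t * of_int d = k ^ 3 - 3 * r * k + 2 * s"
    "of_int t ^ 2 * of_int e = k ^ 4 - 6 * r * k ^ 2 + 8 * s * k - 3 * r ^ 2 - 4 * of_int A"
    "a * e - 4 * b * d + 3 * c ^ 2 = - 4 * A"
    "a * c * e + 2 * b * c * d - a * d ^ 2 - b ^ 2 * e - c ^ 3 = - 4 * B"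
proof -
  obtain m u t :: int where t: "t > 0" "coprime m t" and r: "r = of_int m / of_int t ^ 2" and s: "s = of_int u / of_int t ^ 3"
    and u: "u ^ 2 = m ^ 3 + A * m * t ^ 4 + B * t ^ 6"
    using rational_point[OF assms] by metis
  obtain i i' where "i * m + i' * t ^ 6 = 1"
    using bezout_int[of m "t ^ 6"] t(2) by (metis coprime_iff_gcd_eq_1 coprime_power_right_iff)
  then have "(i * u) * m = u + t ^ 6 * (- i' * u)" by algebra
  then obtain k j where k: "k * m = u + t ^ 6 * j" by blast
  have cop: "coprime (t ^ p) (m ^ q)" for p q using t(2) by (simp add: coprime_commute)
  \<comment> \<open>Divisibility by powers of \<open>t\<close> is tested after multiplication by
    powers of \<open>m\<close>, which is coprime to \<open>t\<close>.\<close>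
  have "m ^ 2 * (k ^ 2 - m) = t ^ 4 * (A * m + B * t ^ 2 + t ^ 2 * (2 * u * j + t ^ 6 * j ^ 2))"
    using u k by algebra
  then have "t ^ 4 dvd m ^ 2 * (k ^ 2 - m)" by simp
  then have "t ^ 4 dvd k ^ 2 - m" using cop coprime_dvd_mult_right_iff by blast
  then obtain g where g: "k ^ 2 - m = t ^ 4 * g" by (elim dvdE)
  have m1: "m = k ^ 2 - t ^ 4 * g" and u1: "u = k * m - t ^ 6 * j" using g k by simp_all
  have cancel: "y = z" if "t ^ p * y = t ^ p * z" for y z p
    using that t(1) by simp
  have "t ^ 4 * (m * (g * m - A)) = t ^ 4 * (t ^ 2 * (B + 2 * u * j + t ^ 6 * j ^ 2))"
    using u k g by algebra
  from cancel[OF this] have "t ^ 2 dvd m ^ 1 * (g * m - A)" by simp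
  then have "t ^ 2 dvd g * m - A" using cop coprime_dvd_mult_right_iff by blast
  then obtain f where f: "g * m - A = t ^ 2 * f" by (elim dvdE)
  then have A1: "A = g * m - t ^ 2 * f" by simp
  define d e where "d = k * g - 2 * t ^ 2 * j" and "e = 4 * f + t ^ 2 * g ^ 2 - 8 * j * k"
  have I: "t ^ 2 * e - 4 * k * d + 3 * (t ^ 2 * g) ^ 2 = - 4 * A"
    unfolding d_def e_def A1 m1 by algebra
  \<comment> \<open>\<open>B\<close> is accessible only through the curve equation, as
    \<open>B * t ^ 6\<close>; hence the factor that is cancelled afterwards.\<close>
  have "t ^ 6 * (t ^ 2 * (t ^ 2 * g) * e + 2 * k * (t ^ 2 * g) * d - t ^ 2 * d ^ 2 - k ^ 2 * e - (t ^ 2 * g) ^ 3) =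
    - 4 * (u ^ 2 - m ^ 3 - A * m * t ^ 4)"
    unfolding d_def e_def u1 A1 m1 by algebra
  also have "\<dots> = t ^ 6 * (- 4 * B)" using u by simp
  finally have J: "t ^ 2 * (t ^ 2 * g) * e + 2 * k * (t ^ 2 * g) * d - t ^ 2 * d ^ 2 - k ^ 2 * e - (t ^ 2 * g) ^ 3 = - 4 * B"
    by (rule cancel)
  define T k' A' g' j' f' where "T = (of_int t :: rat)" and "k' = of_int k / T" and "A' = (of_int A :: rat)" and
     "g' = (of_int g :: rat)" and "j' = (of_int j :: rat)" and "f' = (of_int f :: rat)"
  have T: "T \<noteq> 0" using t by (simp add: T_def)
  have m': "of_int m = r * T ^ 2" using r T by (simp add: T_def)
  have u': "of_int u = s * T ^ 3" using s T by (simp add: T_def)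
  have kk: "of_int k = k' * T" using T by (simp add: k'_def)
  have "(of_int (k ^ 2 - m) :: rat) = of_int (t ^ 4 * g)" using g by simp
  then have "T ^ 2 * (T ^ 2 * g') = T ^ 2 * (k' ^ 2 - r)"
    by (simp add: m' kk T_def[symmetric] g'_def[symmetric] algebra_simps power2_eq_square power4_eq_xxxx)
  then have g1: "T ^ 2 * g' = k' ^ 2 - r" using T mult_left_cancel[of "T ^ 2"] by (metis power_not_zero)
  have "(of_int (k * m) :: rat) = of_int (u + t ^ 6 * j)" using k by simp
  then have "T ^ 3 * (T ^ 3 * j') = T ^ 3 * (k' * r - s)"
    unfolding of_int_mult of_int_add of_int_power m' kk u' T_def[symmetric] j'_def[symmetric] by algebra
  then have j1: "T ^ 3 * j' = k' * r - s" using T mult_left_cancel[of "T ^ 3"] by (metis power_not_zero)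
  have "(of_int (g * m - A) :: rat) = of_int (t ^ 2 * f)" using f by simp
  then have f1: "T ^ 2 * f' = g' * r * T ^ 2 - A'"
    unfolding of_int_mult of_int_diff of_int_power m' T_def[symmetric] g'_def[symmetric] f'_def[symmetric] A'_def[symmetric]
    by algebra
  have c: "of_int (t ^ 2 * g) = k' ^ 2 - r" using g1 by (simp add: T_def g'_def)
  have "of_int t * of_int d = T * (k' * T * g' - 2 * T ^ 2 * j')"
    by (simp add: d_def kk T_def[symmetric] g'_def j'_def)
  also have "\<dots> = k' * (T ^ 2 * g') - 2 * (T ^ 3 * j')"
    by (simp add: algebra_simps power2_eq_square power3_eq_cube)
  also have "\<dots> = k' ^ 3 - 3 * r * k' + 2 * s" unfolding g1 j1 by algebra
  finally have d: "of_int t * of_int d = k' ^ 3 - 3 * r * k' + 2 * s" .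
  have "of_int t ^ 2 * of_int e = T ^ 2 * (4 * f' + T ^ 2 * g' ^ 2 - 8 * j' * (k' * T))"
    by (simp add: e_def kk T_def[symmetric] g'_def j'_def f'_def)
  also have "\<dots> = 4 * (T ^ 2 * f') + (T ^ 2 * g') ^ 2 - 8 * k' * (T ^ 3 * j')"
    by (simp add: algebra_simps power2_eq_square power3_eq_cube)
  also have "T ^ 2 * f' = (T ^ 2 * g') * r - A'" using f1 by (simp add: mult_ac)
  also have "4 * (T ^ 2 * g' * r - A') + (T ^ 2 * g') ^ 2 - 8 * k' * (T ^ 3 * j') =
    k' ^ 4 - 6 * r * k' ^ 2 + 8 * s * k' - 3 * r ^ 2 - 4 * A'" unfolding g1 j1 by algebra
  finally have e: "of_int t ^ 2 * of_int e = k' ^ 4 - 6 * r * k' ^ 2 + 8 * s * k' - 3 * r ^ 2 - 4 * of_int A"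
    by (simp add: A'_def)
  show ?thesis by (rule that[OF t(1) _ _ c d e I J]) (simp_all add: kk T_def)
qed

text \<open>Unless \<open>g = 0\<close>, its valuation at \<open>p\<close> is \<open>1\<close> plus
  an even number, so it cannot be \<open>0\<close>.\<close>

lemma squarefree_represented:
  fixes D g :: int and z :: rat
  assumes "squarefree D" "of_int g = of_int D * z ^ 2" "prime p" "p dvd D"
  shows "p dvd g"
proof (rule ccontr)
  assume pg: "\<not> p dvd g"
  obtain m n where z: "n > 0" "coprime m n" "z = of_int m / of_int n" by (rule rat_coprime_quotient)
  have "(of_int (g * n ^ 2) :: rat) = of_int (D * m ^ 2)" using assms(2) z by (simp add: field_simps)
  then have e: "g * n ^ 2 = D * m ^ 2" by (simp only: of_int_eq_iff)
  then have "p dvd g * n ^ 2" using assms(4) by simp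
  then have pn: "p dvd n" using pg assms(3) by (metis prime_dvd_mult_iff prime_dvd_power)
  then have "p ^ 2 dvd g * n ^ 2" by simp
  then have "p ^ 2 dvd D * m ^ 2" using e by simp
  moreover have "coprime p m" using pn z(2) by (meson coprime_commute coprime_divisors dvd_refl)
  then have "coprime (p ^ 2) (m ^ 2)" by simp
  ultimately have "p ^ 2 dvd D" by (simp add: coprime_dvd_mult_left_iff)
  then have "p dvd 1" using assms(1) by (auto simp: squarefree_def)
  then show False using assms(3) not_prime_unit by blast
qed

theorem covering_quartic:
  fixes A B D :: int and r s l z :: rat
  assumes s: "s ^ 2 = r ^ 3 + of_int A * r + of_int B" and D: "squarefree D"
    and l: "point_quartic (of_int A) r s l 1 = of_int D * z ^ 2"
    and nz: "\<And>m. point_quartic (of_int A) r s m 1 \<noteq> 0"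
  obtains a b c d e t :: int and k :: real where
    "a * e - 4 * b * d + 3 * c ^ 2 = - 4 * A"
    "a * c * e + 2 * b * c * d - a * d ^ 2 - b ^ 2 * e - c ^ 3 = - 4 * B"
    "\<And>x y :: int. quartic a b c d e x y = 0 \<Longrightarrow> x = 0 \<and> y = 0"
    "\<And>p. prime p \<Longrightarrow> p dvd D \<Longrightarrow> \<exists>x y. coprime x y \<and> p dvd quartic a b c d e x y"
    "t > 0"
    "\<And>x y :: real. of_int t ^ 2 * quartic (of_int a) (of_int b) (of_int c) (of_int d) (of_int e) x y
      = point_quartic (of_int A) (of_rat r) (of_rat s) (of_int t * x + k * y) y"
proof -
  obtain t a b c d e :: int and k :: rat where t: "t > 0" and
    co: "(of_int a :: rat) = of_int t ^ 2" "of_int b = k * of_int t" "of_int c = k ^ 2 - r"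
    "of_int t * of_int d = k ^ 3 - 3 * r * k + 2 * s"
    "of_int t ^ 2 * of_int e = k ^ 4 - 6 * r * k ^ 2 + 8 * s * k - 3 * r ^ 2 - 4 * of_int A" and
    IJ: "a * e - 4 * b * d + 3 * c ^ 2 = - 4 * A"
    "a * c * e + 2 * b * c * d - a * d ^ 2 - b ^ 2 * e - c ^ 3 = - 4 * B"
    by (rule integral_quartic[OF s])
  note id = quartic_substitution[OF co]
  have nz': "x = 0 \<and> y = 0" if "quartic a b c d e x y = 0" for x y
  proof -
    define X Y where "X = of_int t * of_int x + k * of_int y" and "Y = (of_int y :: rat)"
    have e0: "point_quartic (of_int A) r s X Y = 0"
      unfolding X_def Y_def id[symmetric] of_int_quartic[symmetric] that by simp
    have "y = 0"
    proof (rule ccontr)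
      assume "y \<noteq> 0"
      then have Y: "Y \<noteq> 0" by (simp add: Y_def)
      then have "point_quartic (of_int A) r s X Y = Y ^ 4 * point_quartic (of_int A) r s (X / Y) 1"
        unfolding point_quartic_def quartic_homogeneous[symmetric] by simp
      then show False using e0 nz Y by simp
    qed
    moreover from this have "X = 0" using e0 by (simp add: Y_def point_quartic_def quartic_def)
    ultimately show ?thesis using t by (simp add: X_def)
  qed
  have "\<exists>x y. coprime x y \<and> p dvd quartic a b c d e x y" if p: "prime p" "p dvd D" for p
  proof -
    \<comment> \<open>The slope \<open>l\<close> is the image of \<open>(l - k) / t\<close> under
      the substitution; lowest terms provide the coprime arguments.\<close>
    obtain x y where xy: "y > 0" "coprime x y" "(l - k) / of_int t = of_int x / of_int y"
      by (rule rat_coprime_quotient)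
    define q where "q = (of_int x :: rat) / of_int y"
    have lq: "of_int t * q + k * 1 = l" using xy(3)[symmetric] t unfolding q_def[symmetric] by (simp add: field_simps)
    have 1: "of_int t ^ 2 * quartic (of_int a) (of_int b) (of_int c) (of_int d) (of_int e) q 1 = of_int D * z ^ 2"
      unfolding id lq l ..
    have "of_int (quartic a b c d e x y) = of_int y ^ 4 * quartic (of_int a) (of_int b) (of_int c) (of_int d) (of_int e) q (1 :: rat)"
      unfolding of_int_quartic quartic_homogeneous[symmetric] using xy(1) by (simp add: q_def)
    also have "\<dots> = of_int D * (z * of_int y ^ 2 / of_int t) ^ 2"
      using 1 t by (simp add: field_simps power_mult_distrib power_divide flip: power_mult)
    finally have "p dvd quartic a b c d e x y" using squarefree_represented[OF D _ p] by blast
    then show ?thesis using xy(2) by blast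
  qed
  moreover have "of_int t ^ 2 * quartic (of_int a) (of_int b) (of_int c) (of_int d) (of_int e) x y
      = point_quartic (of_int A) (of_rat r) (of_rat s) (of_int t * x + of_rat k * y) y" for x y :: real
    using co[THEN arg_cong[of _ _ "of_rat :: rat \<Rightarrow> real"]]
    by (intro quartic_substitution) (simp_all add: of_rat_add of_rat_diff of_rat_mult of_rat_power)
  ultimately show ?thesis using that[OF IJ] nz' t by blast
qed

section \<open>Reduction of binary quartic forms\<close>

text \<open>Makes the square roots \<open>\<rho>\<close> and \<open>k\<close> of
  \<open>point_quartic_even\<close> real and positive. A root below \<open>r\<close> with negative
  derivative is the middle one of three real roots, and then the smallest root works.\<close>

lemma cubic_root_below:
  fixes A B r :: real
  assumes disc: "4 * A ^ 3 + 27 * B ^ 2 \<noteq> 0" and r: "r ^ 3 + A * r + B > 0"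
  obtains e where "e < r" "e ^ 3 + A * e + B = 0" "3 * e ^ 2 + A > 0"
proof -
  define f where "f x = x ^ 3 + A * x + B" for x
  define M where "M = 1 + \<bar>A\<bar> + \<bar>B\<bar> + \<bar>r\<bar>"
  have M1: "M \<ge> 1" "M \<ge> 1 + \<bar>A\<bar> + \<bar>B\<bar>" "- M < r" unfolding M_def by linarith+
  have "M ^ 3 = M ^ 2 * M" by (simp add: power3_eq_cube power2_eq_square)
  also have "\<dots> \<ge> M ^ 2 * (1 + \<bar>A\<bar> + \<bar>B\<bar>)" using M1 by (intro mult_left_mono) auto
  finally have 1: "M ^ 3 \<ge> M ^ 2 + \<bar>A\<bar> * M ^ 2 + \<bar>B\<bar> * M ^ 2" by (simp add: algebra_simps)
  have 2: "M ^ 2 \<ge> M" "M ^ 2 \<ge> 1" using M1 self_le_power[of M 2] one_le_power[of M 2] by auto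
  have "\<bar>A\<bar> * M ^ 2 \<ge> \<bar>A\<bar> * M" "\<bar>B\<bar> * M ^ 2 \<ge> \<bar>B\<bar>"
    using 2 mult_left_mono[of M "M ^ 2" "\<bar>A\<bar>"] mult_left_mono[of 1 "M ^ 2" "\<bar>B\<bar>"] by auto
  moreover have "\<bar>A\<bar> * M \<ge> - A * M" using M1 by (intro mult_right_mono) auto
  ultimately have "f (- M) < 0" using 1 2 unfolding f_def by simp
  moreover have "f r > 0" using r by (simp add: f_def)
  moreover have "continuous_on {- M..r} f" unfolding f_def by (intro continuous_intros)
  ultimately obtain e where e: "- M \<le> e" "e \<le> r" "f e = 0"
    using IVT'[of f "- M" 0 r] M1 by auto
  then have er: "e < r" using \<open>f r > 0\<close> by (cases "e = r") auto
  have fe: "e ^ 3 + A * e + B = 0" using e by (simp add: f_def)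
  show ?thesis
  proof (cases "3 * e ^ 2 + A > 0")
    case True
    then show ?thesis using that er fe by blast
  next
    case False
    have "3 * e ^ 2 + A \<noteq> 0"
    proof
      assume "3 * e ^ 2 + A = 0"
      with fe have "4 * A ^ 3 + 27 * B ^ 2 = 0" by algebra
      with disc show False by simp
    qed
    with False have A: "A < - 3 * e ^ 2" by simp
    define q where "q = sqrt (- 3 * e ^ 2 - 4 * A)"
    have "- 3 * e ^ 2 - 4 * A > (3 * e) ^ 2" using A by (simp add: power_mult_distrib)
    moreover have "(3 * e) ^ 2 \<ge> 0" by simp
    ultimately have q: "q ^ 2 = - 3 * e ^ 2 - 4 * A" "q > sqrt ((3 * e) ^ 2)"
      unfolding q_def by (simp_all only: real_sqrt_less_iff) (simp only: real_sqrt_pow2)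
    then have q2: "q > \<bar>3 * e\<bar>" by (simp only: real_sqrt_abs)
    \<comment> \<open>The smaller root of the cofactor of \<open>x - e\<close>, a quadratic of
      discriminant \<open>q ^ 2\<close>.\<close>
    define e2 where "e2 = (- e - q) / 2"
    have e2: "2 * e2 = - e - q" by (simp add: e2_def)
    have lt: "e2 < e" using q2 e2 by linarith
    have "8 * (e2 ^ 3 + A * e2 + B) = 0" using e2 q(1) fe by algebra
    then have 1: "e2 ^ 3 + A * e2 + B = 0" by (simp only: mult_eq_0_iff) simp
    have "4 * (3 * e2 ^ 2 + A) = 2 * (e - e2) * (2 * q)" using e2 q(1) by algebra
    moreover have "2 * (e - e2) * (2 * q) > 0" using lt q2 by (intro mult_pos_pos) auto
    ultimately have "4 * (3 * e2 ^ 2 + A) > 0" by simp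
    then have "3 * e2 ^ 2 + A > 0" by (simp only: zero_less_mult_iff) simp
    with 1 lt er show ?thesis using that[of e2] by linarith
  qed
qed

lemma cubic_root_bound:
  fixes A B e m :: real
  assumes "e ^ 3 + A * e + B = 0" "\<bar>A\<bar> \<le> m ^ 2" "\<bar>B\<bar> \<le> m ^ 3" "m > 0"
  shows "\<bar>e\<bar> \<le> 2 * m"
proof (rule ccontr)
  assume "\<not> ?thesis"
  then have e: "\<bar>e\<bar> > 2 * m" by simp
  have "\<bar>e\<bar> ^ 3 = \<bar>- A * e - B\<bar>" using assms(1) by (simp add: power_abs[symmetric] algebra_simps)
  also have "\<dots> \<le> \<bar>A\<bar> * \<bar>e\<bar> + \<bar>B\<bar>" by (metis abs_minus_cancel abs_mult abs_triangle_ineq4 mult_minus_left)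
  also have "\<dots> \<le> m ^ 2 * \<bar>e\<bar> + m ^ 3" using assms by (intro add_mono mult_right_mono) auto
  finally have 1: "\<bar>e\<bar> ^ 3 \<le> m ^ 2 * \<bar>e\<bar> + m ^ 3" .
  have "(2 * m) ^ 2 \<le> \<bar>e\<bar> ^ 2" using e assms(4) by (intro power_mono) auto
  then have "4 * m ^ 2 * \<bar>e\<bar> \<le> \<bar>e\<bar> ^ 2 * \<bar>e\<bar>" by (intro mult_right_mono) (auto simp: power_mult_distrib)
  then have 2: "4 * m ^ 2 * \<bar>e\<bar> \<le> \<bar>e\<bar> ^ 3" by (simp add: power3_eq_cube power2_eq_square)
  have "m ^ 2 * (2 * m) \<le> m ^ 2 * \<bar>e\<bar>" using e by (intro mult_left_mono) auto
  then have 3: "2 * m ^ 3 \<le> m ^ 2 * \<bar>e\<bar>" by (simp add: power3_eq_cube power2_eq_square)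
  have "m ^ 3 > 0" using assms(4) by simp
  then show False using 1 2 3 by linarith
qed

text \<open>
  With \<open>\<rho>\<^sup>2 = r - e\<close>, \<open>\<sigma> = - s / \<rho>\<close> and \<open>k\<^sup>2 = 3 e\<^sup>2 + A\<close>, translation by the 2-torsion point \<open>(e, 0)\<close>
  acts on the roots of the quartic as an involution whose fixed points are the zeros of
  \<open>\<rho> x + (\<sigma> - k) y\<close> and \<open>\<rho> x + (\<sigma> + k) y\<close>. In these coordinates the quartic is even.
\<close>
lemma point_quartic_even:
  fixes A :: "'a::field_char_0"
  assumes "r = \<rho> ^ 2 + e" "s = - \<rho> * \<sigma>" "A = k ^ 2 - 3 * e ^ 2" "\<sigma> ^ 2 = k ^ 2 + 3 * e * \<rho> ^ 2 + \<rho> ^ 4"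
  shows "4 * k ^ 2 * \<rho> ^ 4 * point_quartic A r s x y =
    ((\<sigma> + k) ^ 2 - \<rho> ^ 4) * (\<rho> * x + (\<sigma> - k) * y) ^ 4
    - 2 * (3 * e * \<rho> ^ 2) * (\<rho> * x + (\<sigma> - k) * y) ^ 2 * (\<rho> * x + (\<sigma> + k) * y) ^ 2
    + ((\<sigma> - k) ^ 2 - \<rho> ^ 4) * (\<rho> * x + (\<sigma> + k) * y) ^ 4"
proof -
  define F where "F = 3 * e * \<rho> ^ 2"
  have F: "F = \<sigma> ^ 2 - k ^ 2 - \<rho> ^ 4" using assms(4) by (simp add: F_def)
  have "3 * (\<rho> ^ 4 * point_quartic A r s x y) = 3 * \<rho> ^ 4 * x ^ 4 - 6 * \<rho> ^ 2 * (3 * \<rho> ^ 4 + F) * x ^ 2 * y ^ 2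
      - 24 * \<rho> ^ 5 * \<sigma> * x * y ^ 3 - (12 * k ^ 2 * \<rho> ^ 4 - 4 * F ^ 2 + (3 * \<rho> ^ 4 + F) ^ 2) * y ^ 4"
    unfolding point_quartic_def quartic_def assms(1-3) F_def by algebra
  then have "3 * (4 * k ^ 2 * \<rho> ^ 4 * point_quartic A r s x y) = 4 * k ^ 2 * (3 * \<rho> ^ 4 * x ^ 4 - 6 * \<rho> ^ 2 * (3 * \<rho> ^ 4 + F) * x ^ 2 * y ^ 2
      - 24 * \<rho> ^ 5 * \<sigma> * x * y ^ 3 - (12 * k ^ 2 * \<rho> ^ 4 - 4 * F ^ 2 + (3 * \<rho> ^ 4 + F) ^ 2) * y ^ 4)"
    by algebra
  also have "\<dots> = 3 * (((\<sigma> + k) ^ 2 - \<rho> ^ 4) * (\<rho> * x + (\<sigma> - k) * y) ^ 4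
    - 2 * F * (\<rho> * x + (\<sigma> - k) * y) ^ 2 * (\<rho> * x + (\<sigma> + k) * y) ^ 2
    + ((\<sigma> - k) ^ 2 - \<rho> ^ 4) * (\<rho> * x + (\<sigma> + k) * y) ^ 4)"
    unfolding F by algebra
  finally show ?thesis unfolding F_def by (rule iffD1[OF mult_left_cancel[OF numeral_neq_zero]])
qed

text \<open>In the even form the product of the outer coefficients is
  \<open>- (3 * e ^ 2 + 4 * A)\<close>, at most \<open>16 * m ^ 2\<close> in size whatever the point
  is. Balancing the two by a diagonal change of determinant 1 bounds each by
  \<open>4 * m\<close>.\<close>

lemma point_quartic_diagonal:
  fixes A B r s m :: real
  assumes disc: "4 * A ^ 3 + 27 * B ^ 2 \<noteq> 0" and s: "s ^ 2 = r ^ 3 + A * r + B" "s \<noteq> 0"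
    and m: "\<bar>A\<bar> \<le> m ^ 2" "\<bar>B\<bar> \<le> m ^ 3" "m > 0"
  obtains x1 x2 y1 y2 c0 c1 c2 where "x1 * y2 - x2 * y1 = 1"
    "\<bar>c0\<bar> \<le> 4 * m" "\<bar>c1\<bar> \<le> 4 * m" "\<bar>c2\<bar> \<le> 4 * m"
    "\<And>x y. point_quartic A r s x y = quartic c0 0 c1 0 c2 (x1 * x + x2 * y) (y1 * x + y2 * y)"
proof -
  have "s ^ 2 > 0" using s(2) by simp
  then have "r ^ 3 + A * r + B > 0" using s(1) by simp
  from cubic_root_below[OF disc this] obtain e where e: "e < r" "e ^ 3 + A * e + B = 0" "3 * e ^ 2 + A > 0" .
  have eb: "\<bar>e\<bar> \<le> 2 * m" by (rule cubic_root_bound[OF e(2) m])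
  define \<rho> k where "\<rho> = sqrt (r - e)" and "k = sqrt (3 * e ^ 2 + A)"
  have \<rho>: "\<rho> > 0" "\<rho> ^ 2 = r - e" using e by (auto simp: \<rho>_def)
  have k: "k > 0" "k ^ 2 = 3 * e ^ 2 + A" using e by (auto simp: k_def)
  define \<sigma> where "\<sigma> = - s / \<rho>"
  have s\<sigma>: "s = - \<rho> * \<sigma>" using \<rho> by (simp add: \<sigma>_def)
  have rr: "r = \<rho> ^ 2 + e" and AA: "A = k ^ 2 - 3 * e ^ 2" and BB: "B = - (e ^ 3) - A * e" using \<rho> k e by auto
  have "\<rho> ^ 2 * \<sigma> ^ 2 = \<rho> ^ 2 * (k ^ 2 + 3 * e * \<rho> ^ 2 + \<rho> ^ 4)"
    using s(1) unfolding s\<sigma> rr BB AA by algebra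
  then have \<sigma>: "\<sigma> ^ 2 = k ^ 2 + 3 * e * \<rho> ^ 2 + \<rho> ^ 4" using \<rho>(1) by simp
  define P Q where "P = (\<sigma> + k) ^ 2 - \<rho> ^ 4" and "Q = (\<sigma> - k) ^ 2 - \<rho> ^ 4"
  have PQ: "P * Q = - (\<rho> ^ 4) * (3 * e ^ 2 + 4 * A)"
    unfolding P_def Q_def AA using \<sigma> by algebra
  \<comment> \<open>Up to sign, the discriminant of the cubic is the squared derivative at
    \<open>e\<close> times the discriminant of the cofactor of \<open>x - e\<close>.\<close>
  have "(3 * e ^ 2 + A) ^ 2 * (3 * e ^ 2 + 4 * A) = 4 * A ^ 3 + 27 * B ^ 2" unfolding BB by algebra
  then have ne: "3 * e ^ 2 + 4 * A \<noteq> 0" using disc by auto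
  then have PQ0: "P \<noteq> 0" "Q \<noteq> 0" using PQ \<rho>(1) by auto
  \<comment> \<open>The outer coefficients are divided and multiplied by \<open>w ^ 4\<close>, so
    the ratio \<open>\<bar>P\<bar> / \<bar>Q\<bar>\<close> is evened out by an eighth root.\<close>
  define w where "w = root 8 (\<bar>P\<bar> / \<bar>Q\<bar>)"
  have w: "w > 0" "w ^ 8 = \<bar>P\<bar> / \<bar>Q\<bar>" using PQ0 by (auto simp: w_def)
  \<comment> \<open>The coordinates of \<open>point_quartic_even\<close> have determinant
    \<open>2 * k * \<rho>\<close>; dividing both by \<open>h\<close> makes it 1.\<close>
  define h where "h = sqrt (2 * k * \<rho>)"
  have h: "h > 0" "h ^ 2 = 2 * k * \<rho>" using k \<rho> by (auto simp: h_def)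
  define c0 c1 c2 where "c0 = P / (\<rho> ^ 2 * w ^ 4)" and "c1 = - e" and "c2 = Q * w ^ 4 / \<rho> ^ 2"
  have h4: "h ^ 4 = 4 * k ^ 2 * \<rho> ^ 2" using h(2) by algebra
  have id: "point_quartic A r s x y = quartic c0 0 c1 0 c2 (w * \<rho> / h * x + w * (\<sigma> - k) / h * y) (\<rho> / (w * h) * x + (\<sigma> + k) / (w * h) * y)" for x y
  proof -
    define X Y where "X = \<rho> * x + (\<sigma> - k) * y" and "Y = \<rho> * x + (\<sigma> + k) * y"
    have "w * \<rho> / h * x + w * (\<sigma> - k) / h * y = w / h * X" "\<rho> / (w * h) * x + (\<sigma> + k) / (w * h) * y = 1 / (w * h) * Y"
      using w h by (simp_all add: X_def Y_def field_simps)
    then have "quartic c0 0 c1 0 c2 (w * \<rho> / h * x + w * (\<sigma> - k) / h * y) (\<rho> / (w * h) * x + (\<sigma> + k) / (w * h) * y)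
      = c0 * (w / h * X) ^ 4 + 6 * c1 * (w / h * X) ^ 2 * (1 / (w * h) * Y) ^ 2 + c2 * (1 / (w * h) * Y) ^ 4"
      by (simp add: quartic_def)
    also have "\<dots> = c0 * w ^ 4 / h ^ 4 * X ^ 4 + 6 * c1 / h ^ 4 * X ^ 2 * Y ^ 2 + c2 / (w ^ 4 * h ^ 4) * Y ^ 4"
    proof -
      have "(w / h * X) ^ 2 * (1 / (w * h) * Y) ^ 2 = X ^ 2 * Y ^ 2 / h ^ 4"
        using w(1) h by (simp add: power_mult_distrib power_divide field_simps) (simp add: power4_eq_xxxx power2_eq_square)
      then show ?thesis using w(1) by (simp add: power_mult_distrib power_divide mult.assoc)
    qed
    also have "\<dots> = (P * X ^ 4 - 2 * (3 * e * \<rho> ^ 2) * X ^ 2 * Y ^ 2 + Q * Y ^ 4) / (4 * k ^ 2 * \<rho> ^ 4)"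
    proof -
      have "c0 * w ^ 4 / h ^ 4 = P / (4 * k ^ 2 * \<rho> ^ 4)" "6 * c1 / h ^ 4 = - 2 * (3 * e * \<rho> ^ 2) / (4 * k ^ 2 * \<rho> ^ 4)"
        "c2 / (w ^ 4 * h ^ 4) = Q / (4 * k ^ 2 * \<rho> ^ 4)"
        unfolding c0_def c1_def c2_def h4 unfolding power4_eq_xxxx power2_eq_square
        using w(1) k(1) \<rho>(1) by (simp_all add: field_simps)
      then show ?thesis by (simp add: add_divide_distrib diff_divide_distrib)
    qed
    also have "\<dots> = point_quartic A r s x y"
      unfolding P_def Q_def X_def Y_def point_quartic_even[OF rr s\<sigma> AA \<sigma>, symmetric] using k(1) \<rho>(1) by simp
    finally show ?thesis ..
  qed
  have det: "w * \<rho> / h * ((\<sigma> + k) / (w * h)) - w * (\<sigma> - k) / h * (\<rho> / (w * h)) = 1"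
  proof -
    have "w * \<rho> / h * ((\<sigma> + k) / (w * h)) - w * (\<sigma> - k) / h * (\<rho> / (w * h)) = (\<rho> * (\<sigma> + k) - (\<sigma> - k) * \<rho>) / h ^ 2"
      using w h by (simp add: field_simps power2_eq_square)
    also have "\<dots> = 1" unfolding h(2) using k(1) \<rho>(1) by (simp add: field_simps)
    finally show ?thesis .
  qed
  have c02: "\<bar>c0\<bar> = \<bar>c2\<bar>"
  proof -
    have "\<bar>P\<bar> = \<bar>Q\<bar> * w ^ 8" using w PQ0 by (simp add: field_simps)
    then show ?thesis unfolding c0_def c2_def abs_mult abs_divide using w \<rho>
      by (simp add: field_simps flip: power_add)
  qed
  have "c0 * c2 = P * Q / \<rho> ^ 4" using w \<rho> by (simp add: c0_def c2_def field_simps flip: power_add)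
  also have "\<dots> = - (3 * e ^ 2 + 4 * A)" unfolding PQ using \<rho> by simp
  finally have "\<bar>c0\<bar> * \<bar>c2\<bar> = \<bar>3 * e ^ 2 + 4 * A\<bar>" by (metis abs_minus_cancel abs_mult)
  also have "\<dots> \<le> 3 * e ^ 2 + 4 * \<bar>A\<bar>"
    using abs_triangle_ineq[of "3 * e ^ 2" "4 * A"] by (simp add: abs_mult)
  also have "\<dots> \<le> 3 * (2 * m) ^ 2 + 4 * m ^ 2"
    using eb m(1) power_mono[OF eb, of 2] by simp
  also have "\<dots> = (4 * m) ^ 2" by (simp add: power_mult_distrib)
  finally have sq: "\<bar>c0\<bar> ^ 2 \<le> (4 * m) ^ 2" "\<bar>c2\<bar> ^ 2 \<le> (4 * m) ^ 2" using c02 by (simp_all add: power2_eq_square)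
  have "\<bar>c0\<bar> \<le> 4 * m" "\<bar>c2\<bar> \<le> 4 * m" using sq m(3) by (auto intro: power2_le_imp_le)
  moreover have "\<bar>c1\<bar> \<le> 4 * m" using eb m(3) unfolding c1_def by linarith
  ultimately show ?thesis using that[OF det _ _ _ id] m(3) by simp
qed

section \<open>Integral substitutions and lattice reduction\<close>

type_synonym 'a form = "'a \<times> 'a \<times> 'a \<times> 'a \<times> 'a"

fun form_eval :: "'a::comm_ring_1 form \<Rightarrow> 'a \<Rightarrow> 'a \<Rightarrow> 'a" where
  "form_eval (a, b, c, d, e) x y = quartic a b c d e x y"

fun form_I :: "'a::comm_ring_1 form \<Rightarrow> 'a" where
  "form_I (a, b, c, d, e) = a * e - 4 * b * d + 3 * c ^ 2"

fun form_J :: "'a::comm_ring_1 form \<Rightarrow> 'a" where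
  "form_J (a, b, c, d, e) = a * c * e + 2 * b * c * d - a * d ^ 2 - b ^ 2 * e - c ^ 3"

text \<open>The middle entries are again those without their binomial factors, written out so that
  no division occurs and integral forms stay integral.\<close>

fun form_subst :: "'a::comm_ring_1 \<Rightarrow> 'a \<Rightarrow> 'a \<Rightarrow> 'a \<Rightarrow> 'a form \<Rightarrow> 'a form" where
  "form_subst p q u v (a, b, c, d, e) =
    (a * p ^ 4 + 4 * b * p ^ 3 * q + 6 * c * p ^ 2 * q ^ 2 + 4 * d * p * q ^ 3 + e * q ^ 4,
     a * p ^ 3 * u + b * (3 * p ^ 2 * q * u + p ^ 3 * v) + 3 * c * (p * q ^ 2 * u + p ^ 2 * q * v)
       + d * (q ^ 3 * u + 3 * p * q ^ 2 * v) + e * q ^ 3 * v,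
     a * p ^ 2 * u ^ 2 + 2 * b * (p * q * u ^ 2 + p ^ 2 * u * v) + c * (q ^ 2 * u ^ 2 + 4 * p * q * u * v + p ^ 2 * v ^ 2)
       + 2 * d * (p * q * v ^ 2 + q ^ 2 * u * v) + e * q ^ 2 * v ^ 2,
     a * p * u ^ 3 + b * (3 * u ^ 2 * v * p + u ^ 3 * q) + 3 * c * (u * v ^ 2 * p + u ^ 2 * v * q)
       + d * (v ^ 3 * p + 3 * u * v ^ 2 * q) + e * v ^ 3 * q,
     a * u ^ 4 + 4 * b * u ^ 3 * v + 6 * c * u ^ 2 * v ^ 2 + 4 * d * u * v ^ 3 + e * v ^ 4)"

lemma form_eval_subst:
  fixes F :: "'a::idom form"
  shows "form_eval (form_subst p q u v F) x y = form_eval F (p * x + u * y) (q * x + v * y)"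
proof (cases F)
  case (fields a b c d e)
  show ?thesis unfolding fields form_subst.simps form_eval.simps quartic_def by algebra
qed

lemma form_I_subst:
  fixes F :: "int form"
  assumes "p * v - q * u = 1" shows "form_I (form_subst p q u v F) = form_I F"
proof (cases F)
  case (fields a b c d e)
  have "form_I (form_subst p q u v F) = (p * v - q * u) ^ 4 * form_I F"
    unfolding fields form_subst.simps form_I.simps by algebra
  then show ?thesis using assms by simp
qed

lemma form_J_subst:
  fixes F :: "int form"
  assumes "p * v - q * u = 1" shows "form_J (form_subst p q u v F) = form_J F"
proof (cases F)
  case (fields a b c d e)
  have "form_J (form_subst p q u v F) = (p * v - q * u) ^ 6 * form_J F"
    unfolding fields form_subst.simps form_J.simps by algebra
  then show ?thesis using assms by simp
qed

fun form_of_int :: "int form \<Rightarrow> 'a::comm_ring_1 form" where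
  "form_of_int (a, b, c, d, e) = (of_int a, of_int b, of_int c, of_int d, of_int e)"

lemma form_subst_of_int:
  "form_of_int (form_subst p q u v F) = form_subst (of_int p) (of_int q) (of_int u) (of_int v) (form_of_int F)"
  by (cases F) simp

lemma form_eq_iff:
  fixes F G :: "real form"
  assumes "\<And>x y. form_eval F x y = form_eval G x y" shows "F = G"
proof -
  obtain a b c d e where F: "F = (a, b, c, d, e)" by (cases F)
  obtain a' b' c' d' e' where G: "G = (a', b', c', d', e')" by (cases G)
  have "a = a'" "e = e'" using assms[of 1 0] assms[of 0 1] by (simp_all add: F G quartic_def)
  then show ?thesis
    using assms[of 1 1] assms[of 1 "- 1"] assms[of 2 1] by (simp add: F G quartic_def)
qed

text \<open>Gauss reduction of a positive definite form of determinant 1. Lagrange's identity gives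
  \<open>N p q * N u v = 1 + B ^ 2\<close> for the inner product \<open>B\<close> of the basis
  vectors, and a size-reduced basis has \<open>B ^ 2 \<le> N p q * N u v / 4\<close>.\<close>

lemma reduced_basis:
  fixes x1 x2 y1 y2 :: real
  assumes det: "x1 * y2 - x2 * y1 = 1"
  defines "N \<equiv> \<lambda>(p :: int) (q :: int). (x1 * p + x2 * q) ^ 2 + (y1 * p + y2 * q) ^ 2"
  obtains p q u v where "p * v - q * u = 1" "N p q \<le> N u v" "N p q * N u v \<le> 4 / 3"
proof -
  define S where "S = {z. coprime (fst z) (snd z) \<and> N (fst z) (snd z) \<le> N 1 0}"
  define R where "R = sqrt (N 1 0)"
  define M where "M = \<lceil>(\<bar>x1\<bar> + \<bar>x2\<bar> + \<bar>y1\<bar> + \<bar>y2\<bar>) * R\<rceil>"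
  have N0: "N p q \<ge> 0" for p q by (simp add: N_def)
  have "S \<subseteq> {- M..M} \<times> {- M..M}"
  proof
    fix z assume "z \<in> S"
    then obtain p q where z: "z = (p, q)" and pq: "N p q \<le> N 1 0" by (cases z) (auto simp: S_def)
    define X Y where "X = x1 * p + x2 * q" and "Y = y1 * p + y2 * q"
    have XY: "\<bar>X\<bar> \<le> R" "\<bar>Y\<bar> \<le> R"
      using pq unfolding R_def N_def X_def[symmetric] Y_def[symmetric] real_sqrt_abs[symmetric]
      by (auto intro!: real_sqrt_le_mono intro: order_trans[rotated])
    have R0: "R \<ge> 0" by (simp add: R_def N0)
    have "real_of_int p = y2 * X - x2 * Y" "real_of_int q = x1 * Y - y1 * X"
      using det unfolding X_def Y_def by algebra+
    then have "\<bar>real_of_int p\<bar> \<le> \<bar>y2\<bar> * \<bar>X\<bar> + \<bar>x2\<bar> * \<bar>Y\<bar>" "\<bar>real_of_int q\<bar> \<le> \<bar>x1\<bar> * \<bar>Y\<bar> + \<bar>y1\<bar> * \<bar>X\<bar>"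
      by (simp_all flip: abs_mult)
    moreover have "\<bar>c\<bar> * \<bar>X\<bar> \<le> \<bar>c\<bar> * R" "\<bar>c\<bar> * \<bar>Y\<bar> \<le> \<bar>c\<bar> * R" for c
      using XY by (auto intro: mult_left_mono)
    moreover have "\<bar>c\<bar> * R \<ge> 0" for c using R0 by simp
    ultimately have "\<bar>real_of_int p\<bar> \<le> (\<bar>x1\<bar> + \<bar>x2\<bar> + \<bar>y1\<bar> + \<bar>y2\<bar>) * R" "\<bar>real_of_int q\<bar> \<le> (\<bar>x1\<bar> + \<bar>x2\<bar> + \<bar>y1\<bar> + \<bar>y2\<bar>) * R"
      unfolding distrib_right by (smt (verit))+
    then have "\<bar>p\<bar> \<le> M" "\<bar>q\<bar> \<le> M" unfolding M_def by linarith+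
    then show "z \<in> {- M..M} \<times> {- M..M}" using z by auto
  qed
  then have fin: "finite S" by (rule finite_subset) auto
  have "(1, 0) \<in> S" by (simp add: S_def)
  then have "S \<noteq> {}" by auto
  define z where "z = arg_min_on (\<lambda>z. N (fst z) (snd z)) S"
  have zS: "z \<in> S" and zmin: "\<And>y. y \<in> S \<Longrightarrow> N (fst z) (snd z) \<le> N (fst y) (snd y)"
    using arg_min_if_finite[OF fin \<open>S \<noteq> {}\<close>, of "\<lambda>z. N (fst z) (snd z)"]
    unfolding z_def[symmetric] by (simp_all add: not_less)
  define p q where "p = fst z" and "q = snd z"
  have pq: "coprime p q" "N p q \<le> N 1 0" using zS by (auto simp: S_def p_def q_def)
  have min: "N p q \<le> N u v" if "coprime u v" for u v
  proof (cases "N u v \<le> N 1 0")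
    case True
    then show ?thesis using zmin[of "(u, v)"] that by (simp add: S_def p_def q_def)
  qed (use pq in linarith)
  obtain v0 u0 where "v0 * p + u0 * q = 1" using bezout_int[of p q] pq(1) by auto
  then have uv0: "p * v0 - q * (- u0) = 1" by (simp add: algebra_simps)
  define X1 Y1 where "X1 = x1 * p + x2 * q" and "Y1 = y1 * p + y2 * q"
  define X0 Y0 where "X0 = x1 * (- u0) + x2 * v0" and "Y0 = y1 * (- u0) + y2 * v0"
  \<comment> \<open>Subtracting the nearest multiple of the shortest vector leaves an inner product
    of at most half its squared length.\<close>
  define m where "m = round ((X1 * X0 + Y1 * Y0) / N p q)"
  define u v where "u = - u0 - m * p" and "v = v0 - m * q"
  have uv: "p * v - q * u = 1" using uv0 unfolding u_def v_def by algebra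
  then have "v * p + (- u) * q = 1" by (simp add: algebra_simps)
  then have "coprime u v" by (metis coprime_def dvd_add dvd_minus_iff dvd_mult2)
  note le = min[OF this]
  define X2 Y2 where "X2 = x1 * u + x2 * v" and "Y2 = y1 * u + y2 * v"
  have "X1 * Y2 - X2 * Y1 = (x1 * y2 - x2 * y1) * real_of_int (p * v - q * u)"
    unfolding X1_def X2_def Y1_def Y2_def by (simp add: algebra_simps)
  then have d1: "X1 * Y2 - X2 * Y1 = 1" using det uv by simp
  have N1: "N p q = X1 ^ 2 + Y1 ^ 2" and N2: "N u v = X2 ^ 2 + Y2 ^ 2"
    by (simp_all add: N_def X1_def X2_def Y1_def Y2_def)
  have "N p q \<noteq> 0" using d1 by (auto simp: N1 sum_power2_eq_zero_iff)
  then have pos: "N p q > 0" using N0[of p q] by simp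
  define B where "B = X1 * X2 + Y1 * Y2"
  have "X2 = X0 - m * X1" "Y2 = Y0 - m * Y1"
    unfolding X2_def X0_def X1_def Y2_def Y0_def Y1_def u_def v_def by (simp_all add: algebra_simps)
  then have "B = (X1 * X0 + Y1 * Y0) - m * N p q" unfolding B_def N1 by algebra
  then have "B / N p q = (X1 * X0 + Y1 * Y0) / N p q - m" using pos by (simp add: field_simps)
  then have "\<bar>B / N p q\<bar> \<le> 1 / 2" using of_int_round_abs_le[of "(X1 * X0 + Y1 * Y0) / N p q"]
    unfolding m_def by (simp add: abs_minus_commute)
  then have "\<bar>B\<bar> \<le> N p q / 2" using pos by (simp add: field_simps)
  then have "B ^ 2 \<le> (N p q / 2) ^ 2" by (metis abs_ge_zero power2_abs power_mono)
  also have "\<dots> = N p q * N p q / 4" by (simp add: power2_eq_square)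
  also have "\<dots> \<le> N p q * N u v / 4" using le pos by simp
  finally have "B ^ 2 \<le> N p q * N u v / 4" .
  moreover have "N p q * N u v = 1 + B ^ 2"
    unfolding N1 N2 B_def using d1 by algebra
  ultimately have "N p q * N u v \<le> 4 / 3" by simp
  then show ?thesis using that uv le by blast
qed

text \<open>The box for \<open>k = 0\<close>, transformed by scaling \<open>x\<close> by
  \<open>2 ^ (- k / 2)\<close> and \<open>y\<close> by \<open>2 ^ (k / 2)\<close>; the product of
  its sides does not depend on \<open>k\<close>.\<close>

definition form_box :: "nat \<Rightarrow> real \<Rightarrow> int form set" where
  "form_box k N = {(a, b, c, d, e). 4 ^ k * \<bar>real_of_int a\<bar> \<le> N \<and> 2 ^ k * \<bar>real_of_int b\<bar> \<le> N \<and>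
     \<bar>real_of_int c\<bar> \<le> N \<and> \<bar>real_of_int d\<bar> \<le> N * 2 ^ k \<and> \<bar>real_of_int e\<bar> \<le> N * 4 ^ k}"

text \<open>The multiplicities of the monomials add up to 8 in every coefficient:
  \<open>1 + 6 + 1\<close>, \<open>1 + 3 + 3 + 1\<close> and
  \<open>1 + 1 + 4 + 1 + 1\<close>.\<close>

lemma form_subst_even_bound:
  fixes p q u v P U M :: real
  assumes c: "\<bar>c0\<bar> \<le> M" "\<bar>c1\<bar> \<le> M" "\<bar>c2\<bar> \<le> M" and P: "\<bar>p\<bar> \<le> P" "\<bar>q\<bar> \<le> P" and U: "\<bar>u\<bar> \<le> U" "\<bar>v\<bar> \<le> U"
    and F: "form_subst p q u v (c0, 0, c1, 0, c2) = (a, b, c, d, e)"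
  shows "\<bar>a\<bar> \<le> 8 * M * P ^ 4" "\<bar>b\<bar> \<le> 8 * M * (P ^ 3 * U)" "\<bar>c\<bar> \<le> 8 * M * (P ^ 2 * U ^ 2)"
    "\<bar>d\<bar> \<le> 8 * M * (P * U ^ 3)" "\<bar>e\<bar> \<le> 8 * M * U ^ 4"
proof -
  have t: "- (m * (y1 * y2 * y3 * y4)) \<le> x * (x1 * x2 * x3 * x4) \<and> x * (x1 * x2 * x3 * x4) \<le> m * (y1 * y2 * y3 * y4)"
    if "\<bar>x\<bar> \<le> m" "\<bar>x1\<bar> \<le> y1" "\<bar>x2\<bar> \<le> y2" "\<bar>x3\<bar> \<le> y3" "\<bar>x4\<bar> \<le> y4" for x x1 x2 x3 x4 m y1 y2 y3 y4 :: real
  proof -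
    have "\<bar>x * (x1 * x2 * x3 * x4)\<bar> \<le> m * (y1 * y2 * y3 * y4)"
      unfolding abs_mult using that by (intro mult_mono) (auto intro: order_trans[OF abs_ge_zero] mult_nonneg_nonneg)
    then show ?thesis by linarith
  qed
  have a: "a = c0 * (p * p * p * p) + 6 * (c1 * (p * p * q * q)) + c2 * (q * q * q * q)"
    and b: "b = c0 * (p * p * p * u) + 3 * (c1 * (p * q * q * u)) + 3 * (c1 * (p * p * q * v)) + c2 * (q * q * q * v)"
    and cc: "c = c0 * (p * p * u * u) + c1 * (q * q * u * u) + 4 * (c1 * (p * q * u * v)) + c1 * (p * p * v * v) + c2 * (q * q * v * v)"
    and d: "d = c0 * (p * u * u * u) + 3 * (c1 * (p * u * v * v)) + 3 * (c1 * (q * u * u * v)) + c2 * (q * v * v * v)"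
    and e: "e = c0 * (u * u * u * u) + 6 * (c1 * (u * u * v * v)) + c2 * (v * v * v * v)"
    using F by (auto simp: power4_eq_xxxx power3_eq_cube power2_eq_square algebra_simps)
  have "\<bar>a\<bar> \<le> 8 * (M * (P * P * P * P))"
    unfolding a abs_le_iff using t[OF c(1) P(1) P(1) P(1) P(1)] t[OF c(2) P(1) P(1) P(2) P(2)] t[OF c(3) P(2) P(2) P(2) P(2)]
    by linarith
  then show "\<bar>a\<bar> \<le> 8 * M * P ^ 4" by (simp add: power4_eq_xxxx mult_ac)
  have "\<bar>b\<bar> \<le> 8 * (M * (P * P * P * U))"
    unfolding b abs_le_iff using t[OF c(1) P(1) P(1) P(1) U(1)] t[OF c(2) P(1) P(2) P(2) U(1)] t[OF c(2) P(1) P(1) P(2) U(2)] t[OF c(3) P(2) P(2) P(2) U(2)]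
    by linarith
  then show "\<bar>b\<bar> \<le> 8 * M * (P ^ 3 * U)" by (simp add: power3_eq_cube mult_ac)
  have "\<bar>c\<bar> \<le> 8 * (M * (P * P * U * U))"
    unfolding cc abs_le_iff using t[OF c(1) P(1) P(1) U(1) U(1)] t[OF c(2) P(2) P(2) U(1) U(1)] t[OF c(2) P(1) P(2) U(1) U(2)]
       t[OF c(2) P(1) P(1) U(2) U(2)] t[OF c(3) P(2) P(2) U(2) U(2)]
    by linarith
  then show "\<bar>c\<bar> \<le> 8 * M * (P ^ 2 * U ^ 2)" by (simp add: power2_eq_square mult_ac)
  have "\<bar>d\<bar> \<le> 8 * (M * (P * U * U * U))"
    unfolding d abs_le_iff using t[OF c(1) P(1) U(1) U(1) U(1)] t[OF c(2) P(1) U(1) U(2) U(2)] t[OF c(2) P(2) U(1) U(1) U(2)] t[OF c(3) P(2) U(2) U(2) U(2)]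
    by linarith
  then show "\<bar>d\<bar> \<le> 8 * M * (P * U ^ 3)" by (simp add: power3_eq_cube mult_ac)
  have "\<bar>e\<bar> \<le> 8 * (M * (U * U * U * U))"
    unfolding e abs_le_iff using t[OF c(1) U(1) U(1) U(1) U(1)] t[OF c(2) U(1) U(1) U(2) U(2)] t[OF c(3) U(2) U(2) U(2) U(2)]
    by linarith
  then show "\<bar>e\<bar> \<le> 8 * M * U ^ 4" by (simp add: power4_eq_xxxx mult_ac)
qed

lemma power_of_2_between:
  fixes h :: real
  assumes "h \<ge> 1" obtains k :: nat where "2 ^ k \<le> h" "h < 2 * 2 ^ k"
proof -
  define n where "n = nat \<lfloor>h\<rfloor>"
  have n: "n \<ge> 1" "real n \<le> h" "h < real n + 1" using assms unfolding n_def by linarith+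
  obtain k where k: "2 ^ k \<le> n" "n < 2 ^ (k + 1)" using ex_power_ivl1[of 2 n] n by auto
  have "(2 :: real) ^ k \<le> real n" using k(1) by (metis of_nat_le_iff of_nat_numeral of_nat_power)
  then have "2 ^ k \<le> h" using n(2) by linarith
  moreover have "real (n + 1) \<le> 2 ^ (k + 1)"
    using k(2) by (metis Suc_eq_plus1 Suc_leI of_nat_le_iff of_nat_numeral of_nat_power)
  then have "h < 2 * 2 ^ k" using n(3) by simp
  ultimately show ?thesis by (rule that)
qed

text \<open>The box records how stretched a reduced basis is: its squared lengths are at most
  \<open>2 / 2 ^ k\<close> and \<open>2 * 2 ^ k\<close>. The constant 32 is the 8 of
  \<open>form_subst_even_bound\<close> times 4 from these lengths.\<close>

lemma even_form_reduced:
  fixes F :: "int form"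
  assumes det: "x1 * y2 - x2 * y1 = 1"
    and c: "\<bar>c0\<bar> \<le> M" "\<bar>c1\<bar> \<le> M" "\<bar>c2\<bar> \<le> M"
    and F: "form_of_int F = form_subst x1 y1 x2 y2 (c0, 0, c1, 0, c2 :: real)"
  obtains p q u v k where "p * v - q * u = 1" "form_subst p q u v F \<in> form_box k (32 * M)"
proof -
  obtain p q u v :: int where uv: "p * v - q * u = 1" and
    "(x1 * p + x2 * q) ^ 2 + (y1 * p + y2 * q) ^ 2 \<le> (x1 * u + x2 * v) ^ 2 + (y1 * u + y2 * v) ^ 2" and
    prod: "((x1 * p + x2 * q) ^ 2 + (y1 * p + y2 * q) ^ 2) * ((x1 * u + x2 * v) ^ 2 + (y1 * u + y2 * v) ^ 2) \<le> 4 / 3"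
    using reduced_basis[OF det] by metis
  define X1 Y1 X2 Y2 where "X1 = x1 * p + x2 * q" and "Y1 = y1 * p + y2 * q"
    and "X2 = x1 * u + x2 * v" and "Y2 = y1 * u + y2 * v"
  define N1 N2 where "N1 = X1 ^ 2 + Y1 ^ 2" and "N2 = X2 ^ 2 + Y2 ^ 2"
  have le: "N1 \<le> N2" and N12: "N1 * N2 \<le> 4 / 3"
    unfolding N1_def N2_def X1_def Y1_def X2_def Y2_def by fact+
  have nn: "N1 \<ge> 0" "N2 \<ge> 0" by (simp_all add: N1_def N2_def)
  have "X1 * Y2 - X2 * Y1 = (x1 * y2 - x2 * y1) * real_of_int (p * v - q * u)"
    unfolding X1_def X2_def Y1_def Y2_def by (simp add: algebra_simps)
  then have "X1 * Y2 - X2 * Y1 = 1" using det uv by simp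
  then have "N1 \<noteq> 0" by (auto simp: N1_def sum_power2_eq_zero_iff)
  then have N1: "N1 > 0" using nn by simp
  have "N1 * N1 \<le> N1 * N2" using le nn by (intro mult_left_mono)
  then have "N1 ^ 2 \<le> 2 ^ 2" using N12 by (simp add: power2_eq_square)
  then have N1b: "N1 \<le> 2" by (rule power2_le_imp_le) simp
  then have "2 / N1 \<ge> 1" using N1 by simp
  then obtain k :: nat where k: "2 ^ k \<le> 2 / N1" "2 / N1 < 2 * 2 ^ k" by (rule power_of_2_between)
  have N1k: "N1 \<le> 2 / 2 ^ k" using k(1) N1 by (simp add: field_simps)
  have "N2 \<le> 4 / 3 / N1" using N12 N1 by (simp add: field_simps)
  also have "\<dots> \<le> 2 / N1" using N1 by (simp add: field_simps)
  also have "\<dots> \<le> 2 * 2 ^ k" using k(2) by simp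
  finally have N2k: "N2 \<le> 2 * 2 ^ k" .
  define P U where "P = sqrt N1" and "U = sqrt N2"
  have PU: "P \<ge> 0" "U \<ge> 0" "P ^ 2 = N1" "U ^ 2 = N2" using nn by (simp_all add: P_def U_def)
  have PUb: "P * U \<le> 2"
  proof (rule power2_le_imp_le)
    show "(P * U)\<^sup>2 \<le> 2\<^sup>2" using N12 PU by (simp add: power_mult_distrib)
  qed simp
  have XY: "\<bar>X1\<bar> \<le> P" "\<bar>Y1\<bar> \<le> P" "\<bar>X2\<bar> \<le> U" "\<bar>Y2\<bar> \<le> U"
    unfolding P_def U_def N1_def N2_def by (simp_all add: real_le_rsqrt)
  obtain a b c d e where G: "form_subst p q u v F = (a, b, c, d, e)" by (cases "form_subst p q u v F")
  have "form_of_int (form_subst p q u v F) = form_subst X1 Y1 X2 Y2 (c0, 0, c1, 0, c2)"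
  proof (rule form_eq_iff)
    fix x y
    show "form_eval (form_of_int (form_subst p q u v F)) x y = form_eval (form_subst X1 Y1 X2 Y2 (c0, 0, c1, 0, c2)) x y"
      unfolding form_subst_of_int F form_eval_subst X1_def X2_def Y1_def Y2_def by (simp add: algebra_simps)
  qed
  then have eq: "form_subst X1 Y1 X2 Y2 (c0, 0, c1, 0, c2) = (real_of_int a, real_of_int b, real_of_int c, real_of_int d, real_of_int e)"
    using G by simp
  note bd = form_subst_even_bound[OF c XY eq]
  have M: "M \<ge> 0" using c(1) by linarith
  have "8 * M * P ^ 4 = 8 * M * (N1 * N1)" using PU(3) by (simp add: power4_eq_xxxx power2_eq_square)
  also have "\<dots> \<le> 8 * M * (2 / 2 ^ k * (2 / 2 ^ k))" using N1k N1 M by (intro mult_left_mono mult_mono) auto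
  finally have a: "\<bar>real_of_int a\<bar> \<le> 32 * M / 4 ^ k" using bd(1) by (simp flip: power_mult_distrib)
  have "8 * M * (P ^ 3 * U) = 8 * M * (N1 * (P * U))" using PU(3) by (simp add: power3_eq_cube power2_eq_square)
  also have "\<dots> \<le> 8 * M * (2 / 2 ^ k * 2)" using N1k N1 M PUb PU by (intro mult_left_mono mult_mono) auto
  finally have b: "\<bar>real_of_int b\<bar> \<le> 32 * M / 2 ^ k" using bd(2) by simp
  have "8 * M * (P ^ 2 * U ^ 2) \<le> 8 * M * 4" using N12 PU M by (intro mult_left_mono) auto
  then have c': "\<bar>real_of_int c\<bar> \<le> 32 * M" using bd(3) by simp
  have "8 * M * (P * U ^ 3) = 8 * M * (N2 * (P * U))" using PU(4) by (simp add: power3_eq_cube power2_eq_square)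
  also have "\<dots> \<le> 8 * M * (2 * 2 ^ k * 2)" using N2k nn M PUb PU by (intro mult_left_mono mult_mono) auto
  finally have d: "\<bar>real_of_int d\<bar> \<le> 32 * M * 2 ^ k" using bd(4) by simp
  have "8 * M * U ^ 4 = 8 * M * (N2 * N2)" using PU(4) by (simp add: power4_eq_xxxx power2_eq_square)
  also have "\<dots> \<le> 8 * M * (2 * 2 ^ k * (2 * 2 ^ k))" using N2k nn M by (intro mult_left_mono mult_mono) auto
  finally have e: "\<bar>real_of_int e\<bar> \<le> 32 * M * 4 ^ k" using bd(5) by (simp flip: power_mult_distrib)
  have "form_subst p q u v F \<in> form_box k (32 * M)"
    unfolding G form_box_def using a b c' d e by (simp add: field_simps)
  then show ?thesis using that uv by blast
qed

text \<open>For a prime \<open>p\<close> this is a root on the projective line modulo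
  \<open>p\<close>; coprime integer representatives are carried along by unimodular
  substitutions.\<close>

definition root_mod :: "int \<Rightarrow> int form \<Rightarrow> bool" where
  "root_mod p F \<longleftrightarrow> (\<exists>x y. coprime x y \<and> p dvd form_eval F x y)"

lemma root_mod_subst:
  assumes "p * v - q * u = 1" "root_mod l F"
  shows "root_mod l (form_subst p q u v F)"
proof -
  obtain x y where xy: "coprime x y" "l dvd form_eval F x y" using assms(2) by (auto simp: root_mod_def)
  define x' y' where "x' = v * x - u * y" and "y' = p * y - q * x"
  have x: "p * x' + u * y' = x" and y: "q * x' + v * y' = y"
    unfolding x'_def y'_def using assms(1) by algebra+
  have "coprime x' y'"
  proof (rule coprimeI)
    fix c assume "c dvd x'" "c dvd y'"
    then have "c dvd p * x' + u * y'" "c dvd q * x' + v * y'" by simp_all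
    then show "is_unit c" unfolding x y using xy(1) by (rule coprime_common_divisor[rotated])
  qed
  moreover have "l dvd form_eval (form_subst p q u v F) x' y'" unfolding form_eval_subst x y by (rule xy(2))
  ultimately show ?thesis unfolding root_mod_def by blast
qed

theorem reduced_covering_form:
  fixes A B D :: int and r s l z :: rat and m :: real
  assumes s: "s ^ 2 = r ^ 3 + of_int A * r + of_int B" "s \<noteq> 0" and D: "squarefree D"
    and disc: "4 * A ^ 3 + 27 * B ^ 2 \<noteq> 0"
    and l: "point_quartic (of_int A) r s l 1 = of_int D * z ^ 2"
    and nz: "\<And>m. point_quartic (of_int A) r s m 1 \<noteq> 0"
    and m: "m > 0" "\<bar>real_of_int A\<bar> \<le> m ^ 2" "\<bar>real_of_int B\<bar> \<le> m ^ 3"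
  obtains k F where "F \<in> form_box k (128 * m)" "form_I F = - 4 * A" "form_J F = - 4 * B" "fst F \<noteq> 0"
    "\<And>p. prime p \<Longrightarrow> p dvd D \<Longrightarrow> root_mod p F"
proof -
  obtain a b c d e t :: int and k :: real where
    IJ: "a * e - 4 * b * d + 3 * c ^ 2 = - 4 * A"
    "a * c * e + 2 * b * c * d - a * d ^ 2 - b ^ 2 * e - c ^ 3 = - 4 * B" and
    zero: "\<And>x y :: int. quartic a b c d e x y = 0 \<Longrightarrow> x = 0 \<and> y = 0" and
    rt: "\<And>p. prime p \<Longrightarrow> p dvd D \<Longrightarrow> \<exists>x y. coprime x y \<and> p dvd quartic a b c d e x y" and
    t: "t > 0" and
    id: "\<And>x y :: real. of_int t ^ 2 * quartic (of_int a) (of_int b) (of_int c) (of_int d) (of_int e) x y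
      = point_quartic (of_int A) (of_rat r) (of_rat s) (of_int t * x + k * y) y"
    by (rule covering_quartic[OF s(1) D l nz]) (rule that)
  have disc': "4 * real_of_int A ^ 3 + 27 * real_of_int B ^ 2 \<noteq> 0"
  proof -
    have "real_of_int (4 * A ^ 3 + 27 * B ^ 2) \<noteq> 0" using disc by (simp only: of_int_eq_0_iff not_False_eq_True)
    then show ?thesis by simp
  qed
  have s': "(of_rat s :: real) ^ 2 = of_rat r ^ 3 + of_int A * of_rat r + of_int B"
    using s(1)[THEN arg_cong[of _ _ "of_rat :: rat \<Rightarrow> real"]]
    by (simp add: of_rat_add of_rat_mult of_rat_power)
  have s0: "(of_rat s :: real) \<noteq> 0" using s(2) by simp
  obtain x1 x2 y1 y2 c0 c1 c2 where det: "x1 * y2 - x2 * y1 = 1" and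
    cb: "\<bar>c0\<bar> \<le> 4 * m" "\<bar>c1\<bar> \<le> 4 * m" "\<bar>c2\<bar> \<le> 4 * m" and
    ev: "\<And>x y. point_quartic (of_int A) (of_rat r) (of_rat s) x y = quartic c0 0 c1 0 c2 (x1 * x + x2 * y) (y1 * x + y2 * y)"
    by (rule point_quartic_diagonal[OF disc' s' s0 m(2) m(3) m(1)]) (rule that)
  define F where "F = (a, b, c, d, e)"
  \<comment> \<open>The substitution linking the two quartics has determinant \<open>t\<close> and
    comes with a factor \<open>t ^ 2 = h ^ 4\<close>; dividing both new variables by
    \<open>h\<close> removes both.\<close>
  define h where "h = sqrt (real_of_int t)"
  have h: "h > 0" "h ^ 2 = real_of_int t" using t by (simp_all add: h_def)
  have F: "form_of_int F = form_subst (x1 * h) (y1 * h) ((x1 * k + x2) / h) ((y1 * k + y2) / h) (c0, 0, c1, 0, c2)"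
  proof (rule form_eq_iff)
    fix x y
    define X Y where "X = x1 * (of_int t * x + k * y) + x2 * y" and "Y = y1 * (of_int t * x + k * y) + y2 * y"
    have "of_int t ^ 2 * form_eval (form_of_int F) x y = quartic c0 0 c1 0 c2 X Y"
      using id[of x y] ev[of "of_int t * x + k * y" y] by (simp add: F_def X_def Y_def)
    also have "X = h * (x1 * h * x + (x1 * k + x2) / h * y)"
      unfolding X_def h(2)[symmetric] using h(1) by (simp add: field_simps power2_eq_square)
    also have "Y = h * (y1 * h * x + (y1 * k + y2) / h * y)"
      unfolding Y_def h(2)[symmetric] using h(1) by (simp add: field_simps power2_eq_square)
    also note quartic_homogeneous
    also have "h ^ 4 = of_int t ^ 2" unfolding h(2)[symmetric] by simp
    finally show "form_eval (form_of_int F) x y =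
       form_eval (form_subst (x1 * h) (y1 * h) ((x1 * k + x2) / h) ((y1 * k + y2) / h) (c0, 0, c1, 0, c2)) x y"
      unfolding form_eval_subst using t by simp
  qed
  have det': "x1 * h * ((y1 * k + y2) / h) - (x1 * k + x2) / h * (y1 * h) = 1"
    using det h(1) by (simp add: field_simps)
  obtain p q u v j where uv: "p * v - q * u = 1" and box: "form_subst p q u v F \<in> form_box j (32 * (4 * m))"
    by (rule even_form_reduced[OF det' cb F]) (rule that)
  have "fst (form_subst p q u v F) = quartic a b c d e p q"
    by (simp add: F_def quartic_def)
  moreover have "\<not> (p = 0 \<and> q = 0)" using uv by auto
  ultimately have "fst (form_subst p q u v F) \<noteq> 0" using zero by metis
  moreover have "form_subst p q u v F \<in> form_box j (128 * m)" using box by simp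
  moreover have "form_I (form_subst p q u v F) = - 4 * A" "form_J (form_subst p q u v F) = - 4 * B"
    unfolding form_I_subst[OF uv] form_J_subst[OF uv] using IJ by (simp_all add: F_def)
  moreover have "root_mod l (form_subst p q u v F)" if "prime l" "l dvd D" for l
    using rt[OF that] by (intro root_mod_subst[OF uv]) (simp add: root_mod_def F_def)
  ultimately show ?thesis using that by blast
qed

section \<open>Local densities\<close>

text \<open>Synthetic division by a root \<open>r\<close> leaves a remainder divisible by
  \<open>p\<close> and hands the leading coefficient on to the quotient.\<close>

lemma card_roots_mod_prime:
  fixes f :: "int poly" and p :: int
  assumes "prime p" "\<not> p dvd lead_coeff f"
  shows "card {x \<in> {0..<p}. p dvd poly f x} \<le> degree f"
  using assms(2)
proof (induction "degree f" arbitrary: f)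
  case 0
  then have "f = [:coeff f 0:]" by (metis degree_eq_zeroE coeff_pCons_0)
  then have "poly f x = lead_coeff f" for x using 0 by (metis mult_zero_right add.right_neutral poly_0 poly_pCons)
  then show ?case using 0 by simp
next
  case (Suc n)
  show ?case
  proof (cases "\<exists>r\<in>{0..<p}. p dvd poly f r")
    case False
    then have none: "{x \<in> {0..<p}. p dvd poly f x} = {}" by blast
    show ?thesis unfolding none by simp
  next
    case True
    then obtain r where r: "r \<in> {0..<p}" "p dvd poly f r" by blast
    define q where "q = synthetic_div f r"
    have f: "f = [:- r, 1:] * q + [:poly f r:]" unfolding q_def by (rule synthetic_div_correct'[symmetric])
    have dq: "degree q = n" using Suc(2) by (simp add: q_def degree_synthetic_div)
    have "lead_coeff f = coeff ([:- r, 1:] * q + [:poly f r:]) (Suc n)" using f Suc(2) by simp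
    also have "\<dots> = - r * coeff q (Suc n) + coeff q n" by (simp add: mult_pCons_left)
    also have "\<dots> = lead_coeff q" using dq by (simp add: coeff_eq_0)
    finally have "\<not> p dvd lead_coeff q" using Suc.prems by simp
    then have IH: "card {x \<in> {0..<p}. p dvd poly q x} \<le> n" using Suc(1)[of q] dq by simp
    have fin: "finite {x \<in> {0..<p}. p dvd poly q x}"
      by (rule finite_subset[of _ "{0..<p}"]) auto
    have "{x \<in> {0..<p}. p dvd poly f x} \<subseteq> insert r {x \<in> {0..<p}. p dvd poly q x}"
    proof
      fix x assume x: "x \<in> {x \<in> {0..<p}. p dvd poly f x}"
      have "poly f x = (x - r) * poly q x + poly f r" by (subst f) (simp add: algebra_simps)
      then have "p dvd (x - r) * poly q x" using x r by (simp add: dvd_add_left_iff)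
      then consider "p dvd x - r" | "p dvd poly q x" using assms(1) by (auto simp: prime_dvd_mult_iff)
      then show "x \<in> insert r {x \<in> {0..<p}. p dvd poly q x}"
      proof cases
        case 1
        then have "x mod p = r mod p" by (simp add: mod_eq_dvd_iff)
        then show ?thesis using x r by simp
      qed (use x in auto)
    qed
    then have "card {x \<in> {0..<p}. p dvd poly f x} \<le> card (insert r {x \<in> {0..<p}. p dvd poly q x})"
      by (rule card_mono[OF finite.insertI[OF fin]])
    also have "\<dots> \<le> Suc (card {x \<in> {0..<p}. p dvd poly q x})" unfolding card_insert_if[OF fin] by simp
    finally show ?thesis using IH Suc(2) by simp
  qed
qed

lemma ex_solution_mod_prime:
  fixes p :: int
  assumes "prime p" "\<not> p dvd u"
  obtains d where "d \<in> {0..<p}" "p dvd u * d - w"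
proof -
  have "coprime u p" using assms by (metis coprime_commute prime_imp_coprime)
  then obtain i j where ij: "i * u + j * p = 1" using bezout_int[of u p] by auto
  have p0: "p > 0" using assms(1) by (rule prime_gt_0_int)
  define d where "d = (i * w) mod p"
  have "p dvd i * w - d" by (simp add: d_def minus_mod_eq_mult_div)
  moreover have "u * d - w = - (u * (i * w - d)) - p * (j * w)" using ij by algebra
  ultimately have "p dvd u * d - w" by simp
  then show ?thesis using that[of d] p0 by (simp add: d_def)
qed

text \<open>
  If \<open>N \<le> 4\<close> is the number of roots of a quartic mod \<open>p\<close>, then \<open>4 N - N (N - 1)\<close> is at least \<open>4\<close>
  as soon as there is a root, so the first two moments of \<open>N\<close> bound the number of quartics with a root.
\<close>
lemma card_affine_root_mod_prime:
  fixes p a :: int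
  assumes p: "prime p" "p \<ge> 5" and a: "\<not> p dvd a"
  shows "4 * card {(d, e). d \<in> {0..<p} \<and> e \<in> {0..<p} \<and> (\<exists>x\<in>{0..<p}. p dvd quartic a b c d e x 1)}
    \<le> 3 * nat p ^ 2 + nat p"
proof -
  define V where "V = {0..<p}"
  define Rt where "Rt = (\<lambda>(d, e). {x \<in> V. p dvd quartic a b c d e x 1})"
  define Z where "Z = {(d, e). d \<in> V \<and> e \<in> V \<and> (\<exists>x\<in>V. p dvd quartic a b c d e x 1)}"
  have p0: "p > 0" using p by simp
  have fV [simp]: "finite V" "card V = nat p" by (simp_all add: V_def)
  have fRt [simp]: "finite (Rt de)" for de by (cases de) (simp add: Rt_def)
  have p2: "\<not> p dvd 4"
  proof
    assume "p dvd 4" then have "p \<le> 4" by (rule zdvd_imp_le) simp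
    then show False using p by simp
  qed
  have N4: "card (Rt de) \<le> 4" for de
  proof (cases de)
    case (Pair d e)
    define f where "f = [:e, 4 * d, 6 * c, 4 * b, a:]"
    have "a \<noteq> 0" using a by auto
    then have "degree f = 4" "lead_coeff f = a" by (simp_all add: f_def)
    moreover have "poly f x = quartic a b c d e x 1" for x
      by (simp add: f_def quartic_def algebra_simps power2_eq_square power3_eq_cube power4_eq_xxxx)
    ultimately show ?thesis using card_roots_mod_prime[OF p(1), of f] a by (simp add: Rt_def Pair V_def)
  qed
  have uniq: "x = y" if "x \<in> V" "y \<in> V" "p dvd x - y" for x y
    using that by (metis V_def atLeastLessThan_iff mod_eq_dvd_iff mod_pos_pos_trivial)
  \<comment> \<open>First moment: \<open>d\<close> and the root \<open>x\<close> determine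
    \<open>e\<close> modulo \<open>p\<close>.\<close>
  define S1 where "S1 = (SIGMA de:V \<times> V. Rt de)"
  have "card S1 \<le> card (V \<times> V)"
  proof (rule card_inj_on_le[where f = "\<lambda>(de, x). (fst de, x)"])
    show "inj_on (\<lambda>(de, x). (fst de, x)) S1"
    proof (rule inj_onI)
      fix s1 s2 assume s: "s1 \<in> S1" "s2 \<in> S1" and eq: "(\<lambda>(de, x). (fst de, x)) s1 = (\<lambda>(de, x). (fst de, x)) s2"
      obtain d e x where s1: "s1 = ((d, e), x)" by (metis surj_pair)
      obtain e' where s2: "s2 = ((d, e'), x)" using eq s1 by (cases s2) auto
      have h: "e \<in> V" "e' \<in> V" "p dvd quartic a b c d e x 1" "p dvd quartic a b c d e' x 1"
        using s by (auto simp: S1_def Rt_def s1 s2)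
      have "e - e' = quartic a b c d e x 1 - quartic a b c d e' x 1" by (simp add: quartic_def)
      then have "p dvd e - e'" using h by simp
      then show "s1 = s2" using uniq h s1 s2 by simp
    qed
  qed (auto simp: S1_def Rt_def)
  then have S1: "(\<Sum>de\<in>V \<times> V. card (Rt de)) \<le> nat p * nat p"
    unfolding S1_def by (simp add: card_SigmaI card_cartesian_product)
  define O2 where "O2 = (\<lambda>S :: int set. {(x, y). x \<in> S \<and> y \<in> S \<and> x \<noteq> y})"
  have O2: "card (O2 S) = card S * card S - card S" if "finite S" for S
  proof -
    have "O2 S = S \<times> S - (\<lambda>x. (x, x)) ` S" by (auto simp: O2_def)
    moreover have "card ((\<lambda>x. (x, x)) ` S) = card S" by (intro card_image inj_onI) auto
    ultimately show ?thesis using that by (simp add: card_Diff_subset card_cartesian_product image_subset_iff)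
  qed
  have fO2: "finite (O2 S)" if "finite S" for S
    by (rule finite_subset[of _ "S \<times> S"]) (use that in \<open>auto simp: O2_def\<close>)
  \<comment> \<open>Second moment: having two given distinct roots is a linear system in
    \<open>d\<close> and \<open>e\<close>, solvable because \<open>p\<close> does not divide
    \<open>4 * (x - y)\<close>.\<close>
  define S2 where "S2 = (SIGMA de:V \<times> V. O2 (Rt de))"
  have "O2 V \<subseteq> snd ` S2"
  proof
    fix z assume "z \<in> O2 V"
    then obtain x y where z: "z = (x, y)" "x \<in> V" "y \<in> V" "x \<noteq> y" by (auto simp: O2_def)
    have "\<not> p dvd x - y" using uniq z by blast
    then have "\<not> p dvd 4 * (x - y)" using p2 p(1) prime_dvd_mult_iff by blast
    then obtain d where d: "d \<in> V" "p dvd 4 * (x - y) * d - (quartic a b c 0 0 y 1 - quartic a b c 0 0 x 1)"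
      using ex_solution_mod_prime[OF p(1)] unfolding V_def by metis
    have "\<not> p dvd 1" using p(1) not_prime_unit by blast
    then obtain e where e: "e \<in> V" "p dvd 1 * e - (- quartic a b c d 0 x 1)"
      using ex_solution_mod_prime[OF p(1)] unfolding V_def by metis
    have "1 * e - (- quartic a b c d 0 x 1) = quartic a b c d e x 1" by (simp add: quartic_def)
    then have x: "p dvd quartic a b c d e x 1" using e by simp
    have "quartic a b c d e y 1 = quartic a b c d e x 1 - (4 * (x - y) * d - (quartic a b c 0 0 y 1 - quartic a b c 0 0 x 1))"
      by (simp add: quartic_def algebra_simps)
    then have y: "p dvd quartic a b c d e y 1" using x d(2) by (simp only: dvd_diff)
    have "((d, e), (x, y)) \<in> S2" using x y z d e by (simp add: S2_def O2_def Rt_def)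
    then show "z \<in> snd ` S2" unfolding z(1) by force
  qed
  moreover have "finite S2" unfolding S2_def by (intro finite_SigmaI fO2) auto
  ultimately have "card (O2 V) \<le> card S2" by (rule surj_card_le[rotated])
  then have S2: "nat p * nat p - nat p \<le> (\<Sum>de\<in>V \<times> V. card (Rt de) * card (Rt de) - card (Rt de))"
    unfolding S2_def by (simp add: card_SigmaI fO2 O2)
  have "4 * int (card Z) = (\<Sum>de\<in>Z. 4)" by simp
  also have "\<dots> \<le> (\<Sum>de\<in>Z. 4 * int (card (Rt de)) - (int (card (Rt de)) * int (card (Rt de)) - int (card (Rt de))))"
  proof (rule sum_mono)
    fix de assume "de \<in> Z"
    then have "Rt de \<noteq> {}" by (auto simp: Z_def Rt_def)
    then have "card (Rt de) \<noteq> 0" by simp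
    then have "card (Rt de) = 1 \<or> card (Rt de) = 2 \<or> card (Rt de) = 3 \<or> card (Rt de) = 4" using N4[of de] by linarith
    then show "4 \<le> 4 * int (card (Rt de)) - (int (card (Rt de)) * int (card (Rt de)) - int (card (Rt de)))" by auto
  qed
  also have "\<dots> = (\<Sum>de\<in>V \<times> V. 4 * int (card (Rt de)) - (int (card (Rt de)) * int (card (Rt de)) - int (card (Rt de))))"
  proof (rule sum.mono_neutral_left)
    show "\<forall>de\<in>V \<times> V - Z. 4 * int (card (Rt de)) - (int (card (Rt de)) * int (card (Rt de)) - int (card (Rt de))) = 0"
    proof
      fix de assume "de \<in> V \<times> V - Z"
      then have "Rt de = {}" by (auto simp: Z_def Rt_def)
      then show "4 * int (card (Rt de)) - (int (card (Rt de)) * int (card (Rt de)) - int (card (Rt de))) = 0" by simp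
    qed
  qed (auto simp: Z_def)
  also have "\<dots> = 4 * int (\<Sum>de\<in>V \<times> V. card (Rt de)) - int (\<Sum>de\<in>V \<times> V. card (Rt de) * card (Rt de) - card (Rt de))"
  proof -
    have "int (n * n - n) = int n * int n - int n" for n :: nat
      by (cases n) (auto simp: algebra_simps)
    then show ?thesis by (simp only: of_nat_sum sum_subtractf sum_distrib_left)
  qed
  also have "\<dots> \<le> 4 * int (nat p * nat p) - int (nat p * nat p - nat p)"
    using S1 S2 by linarith
  also have "\<dots> = 3 * (p * p) + p" using p0 by (simp add: of_nat_diff)
  finally have "4 * int (card Z) \<le> 3 * (p * p) + p" .
  moreover have "int (3 * nat p ^ 2 + nat p) = 3 * (p * p) + p" using p0 by (simp add: power2_eq_square)
  ultimately show ?thesis unfolding Z_def V_def by linarith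
qed

definition form_cube :: "int \<Rightarrow> int form set" where
  "form_cube n = {0..<n} \<times> {0..<n} \<times> {0..<n} \<times> {0..<n} \<times> {0..<n}"

lemma card_root_mod_prime:
  fixes p :: int
  assumes p: "prime p" "p \<ge> 5"
  shows "real (card {F \<in> form_cube p. root_mod p F}) \<le> 23 / 24 * real_of_int p ^ 5"
proof -
  define V where "V = {0..<p}"
  define Z where "Z a b c = {(d, e). d \<in> V \<and> e \<in> V \<and> (\<exists>x\<in>V. p dvd quartic a b c d e x 1)}" for a b c
  define q where "q = nat p"
  have q: "q \<ge> 5" "real q = real_of_int p" using p by (simp_all add: q_def)
  have fV [simp]: "finite V" "card V = q" by (simp_all add: V_def q_def)
  have fZ: "finite (Z a b c)" for a b c
    by (rule finite_subset[of _ "V \<times> V"]) (auto simp: Z_def)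
  define S1 S2 where "S1 = {0 :: int} \<times> V \<times> V \<times> V \<times> V" and
    "S2 = (SIGMA a:V - {0}. SIGMA b:V. SIGMA c:V. Z a b c)"
  have "{F \<in> form_cube p. root_mod p F} \<subseteq> S1 \<union> S2"
  proof
    fix F assume F: "F \<in> {F \<in> form_cube p. root_mod p F}"
    obtain a b c d e where Fe: "F = (a, b, c, d, e)" by (cases F)
    have V: "a \<in> V" "b \<in> V" "c \<in> V" "d \<in> V" "e \<in> V" using F by (auto simp: Fe form_cube_def V_def)
    obtain x y where xy: "coprime x y" "p dvd quartic a b c d e x y" using F by (auto simp: Fe root_mod_def)
    show "F \<in> S1 \<union> S2"
    proof (cases "a = 0")
      case True
      then show ?thesis using V by (simp add: S1_def Fe)
    next
      case False
      then have pa: "\<not> p dvd a" using V by (auto simp: V_def dest: zdvd_imp_le)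
      \<comment> \<open>Since \<open>p\<close> does not divide \<open>a\<close>, infinity is no
        root, and the root can be scaled to \<open>y = 1\<close>.\<close>
      have "\<not> p dvd y"
      proof
        assume py: "p dvd y"
        have "quartic a b c d e x y = a * x ^ 4 + y * (4 * b * x ^ 3 + 6 * c * x ^ 2 * y + 4 * d * x * y ^ 2 + e * y ^ 3)"
          by (simp add: quartic_def algebra_simps power2_eq_square power3_eq_cube power4_eq_xxxx)
        then have "p dvd a * x ^ 4" using xy(2) py by (simp add: dvd_add_left_iff)
        then have "p dvd x" using pa p(1) by (metis prime_dvd_mult_iff prime_dvd_power)
        then show False using py xy(1) p(1) by (metis coprime_common_divisor not_prime_unit)
      qed
      then obtain z where z: "z \<in> V" "p dvd y * z - x" using ex_solution_mod_prime[OF p(1)] unfolding V_def by metis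
      then obtain j where j: "x = y * z - p * j" by (metis dvdE add_diff_cancel_left' diff_add_cancel diff_diff_eq2)
      have "[quartic a b c d e x y = quartic a b c d e (y * z) (y * 1)] (mod p)"
        unfolding quartic_def by (intro cong_add cong_mult cong_pow cong_refl) (simp_all add: j cong_iff_dvd_diff)
      then have "p dvd quartic a b c d e (y * z) (y * 1)" using xy(2) by (simp add: cong_dvd_iff)
      then have "p dvd y ^ 4 * quartic a b c d e z 1" unfolding quartic_homogeneous .
      then have "p dvd quartic a b c d e z 1" using \<open>\<not> p dvd y\<close> p(1) by (metis prime_dvd_mult_iff prime_dvd_power)
      then show ?thesis using V z False by (auto simp: S2_def Fe Z_def)
    qed
  qed
  then have "card {F \<in> form_cube p. root_mod p F} \<le> card (S1 \<union> S2)"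
    by (rule card_mono[rotated]) (auto simp: S1_def S2_def intro!: finite_SigmaI fZ)
  also have "\<dots> \<le> card S1 + card S2" by (rule card_Un_le)
  finally have 1: "4 * card {F \<in> form_cube p. root_mod p F} \<le> 4 * card S1 + 4 * card S2" by simp
  have c1: "card S1 = q ^ 4" by (simp add: S1_def card_cartesian_product power4_eq_xxxx)
  have "4 * card (Z a b c) \<le> 3 * q ^ 2 + q" if "a \<in> V - {0}" for a b c
  proof -
    have "\<not> p dvd a" using that by (auto simp: V_def dest: zdvd_imp_le)
    from card_affine_root_mod_prime[OF p this] show ?thesis unfolding Z_def V_def q_def .
  qed
  then have "(\<Sum>a\<in>V - {0}. \<Sum>b\<in>V. \<Sum>c\<in>V. 4 * card (Z a b c)) \<le> (\<Sum>a\<in>V - {0}. \<Sum>b\<in>V. \<Sum>c\<in>V. 3 * q ^ 2 + q)"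
    by (intro sum_mono)
  also have "\<dots> = (q - 1) * (q * (q * (3 * q ^ 2 + q)))"
    using q(1) \<open>prime p\<close> by (simp add: V_def card_Diff_singleton prime_gt_0_int flip: q_def)
  also have "(\<Sum>a\<in>V - {0}. \<Sum>b\<in>V. \<Sum>c\<in>V. 4 * card (Z a b c)) = 4 * card S2"
    by (simp add: S2_def card_SigmaI fZ finite_SigmaI sum_distrib_left)
  finally have "4 * card {F \<in> form_cube p. root_mod p F} \<le> 4 * q ^ 4 + (q - 1) * (q * (q * (3 * q ^ 2 + q)))"
    using 1 c1 by simp
  then have "real (4 * card {F \<in> form_cube p. root_mod p F}) \<le> real (4 * q ^ 4 + (q - 1) * (q * (q * (3 * q ^ 2 + q))))"
    by (simp only: of_nat_le_iff)
  also have "\<dots> = 4 * real q ^ 4 + (real q - 1) * (real q * (real q * (3 * real q ^ 2 + real q)))"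
    using q(1) by (simp add: of_nat_diff)
  also have "\<dots> = 3 * real q ^ 5 + 2 * real q ^ 4 - real q ^ 3"
    by (simp add: algebra_simps power2_eq_square power3_eq_cube power4_eq_xxxx numeral_eq_Suc)
  finally have "4 * real (card {F \<in> form_cube p. root_mod p F}) \<le> 3 * real q ^ 5 + 2 * real q ^ 4 - real q ^ 3"
    by simp
  moreover have "5 * real q ^ 4 \<le> real q * real q ^ 4" using q(1) by (intro mult_right_mono) auto
  then have "5 * real q ^ 4 \<le> real q ^ 5" by (simp add: numeral_eq_Suc)
  moreover have "real q ^ 3 \<ge> 0" by simp
  ultimately show ?thesis unfolding q(2)[symmetric] by linarith
qed

section \<open>Counting classes of forms\<close>

fun form_map :: "(int \<Rightarrow> int) \<Rightarrow> int form \<Rightarrow> int form" where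
  "form_map f (a, b, c, d, e) = (f a, f b, f c, f d, f e)"

abbreviation form_mod :: "int \<Rightarrow> int form \<Rightarrow> int form" where
  "form_mod n \<equiv> form_map (\<lambda>x. x mod n)"

lemma root_mod_form_mod:
  assumes "p dvd n" shows "root_mod p (form_mod n F) \<longleftrightarrow> root_mod p F"
proof -
  have "p dvd form_eval (form_mod n F) x y \<longleftrightarrow> p dvd form_eval F x y" for x y
  proof (cases F)
    case (fields a b c d e)
    have "[z mod n = z] (mod p)" for z
      using assms by (meson cong_dvd_modulus cong_mod_left cong_refl)
    then have "[form_eval (form_mod n F) x y = form_eval F x y] (mod p)"
      unfolding fields form_map.simps form_eval.simps quartic_def by (intro cong_add cong_mult cong_refl)
    then show ?thesis by (simp add: cong_dvd_iff)
  qed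
  then show ?thesis by (simp add: root_mod_def)
qed

lemma form_mod_in_cube: "n > 0 \<Longrightarrow> form_mod n F \<in> form_cube n"
  by (cases F) (simp add: form_cube_def)

lemma finite_form_cube [simp]: "finite (form_cube n)"
  by (simp add: form_cube_def)

lemma mod_eq_coprime_imp_eq:
  fixes x y m n :: int
  assumes "coprime m n" "x mod m = y mod m" "x mod n = y mod n" "x \<in> {0..<m * n}" "y \<in> {0..<m * n}"
  shows "x = y"
proof -
  have "m dvd x - y" "n dvd x - y" using assms by (simp_all add: mod_eq_dvd_iff)
  then have "m * n dvd x - y" using assms(1) by (rule divides_mult)
  then have "x mod (m * n) = y mod (m * n)" by (simp add: mod_eq_dvd_iff)
  then show ?thesis using assms by simp
qed

text \<open>By the Chinese remainder theorem, reduction modulo \<open>p\<close> and modulo the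
  remaining product is injective on residues.\<close>

lemma card_root_mod_primes:
  assumes "finite P" "\<And>p. p \<in> P \<Longrightarrow> prime p \<and> p \<ge> 5"
  shows "real (card {F \<in> form_cube (\<Prod>P). \<forall>p\<in>P. root_mod p F}) \<le> (23 / 24) ^ card P * real_of_int (\<Prod>P) ^ 5"
  using assms
proof (induction P rule: finite_induct)
  case empty
  have "form_cube 1 = {(0, 0, 0, 0, 0)}" by (auto simp: form_cube_def)
  then show ?case by simp
next
  case (insert p P)
  define M where "M = \<Prod>P"
  define S where "S Q n = {F \<in> form_cube n. \<forall>p\<in>Q. root_mod p F}" for Q n
  have pp: "prime p" "p \<ge> 5" using insert.prems by auto
  have p0: "0 \<le> p" using pp(2) by simp
  have pos: "\<And>q. q \<in> P \<Longrightarrow> q > 0" using insert.prems by force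
  then have M0: "M > 0" unfolding M_def by (intro prod_pos)
  have "coprime p M" unfolding M_def
    using insert.prems insert.hyps by (intro prod_coprime_right primes_coprime) auto
  define g where "g F = (form_mod p F, form_mod M F)" for F
  have "card (S (insert p P) (p * M)) \<le> card (S {p} p \<times> S P M)"
  proof (rule card_inj_on_le)
    show "inj_on g (S (insert p P) (p * M))"
    proof (rule inj_onI)
      fix F G assume F: "F \<in> S (insert p P) (p * M)" "G \<in> S (insert p P) (p * M)" and e: "g F = g G"
      obtain a b c d e where Fe: "F = (a, b, c, d, e)" by (cases F)
      obtain a' b' c' d' e' where Ge: "G = (a', b', c', d', e')" by (cases G)
      show "F = G" using F e unfolding S_def g_def Fe Ge form_cube_def
        by (auto intro!: mod_eq_coprime_imp_eq[OF \<open>coprime p M\<close>])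
    qed
    have rM: "root_mod q (form_mod M F) \<longleftrightarrow> root_mod q F" if "q \<in> P" for q F
      using that insert.hyps dvd_prodI[of P q "\<lambda>x. x"] by (intro root_mod_form_mod) (simp add: M_def)
    show "g ` S (insert p P) (p * M) \<subseteq> S {p} p \<times> S P M"
    proof
      fix z assume "z \<in> g ` S (insert p P) (p * M)"
      then obtain F where z: "z = g F" and F: "\<forall>q\<in>insert p P. root_mod q F" by (auto simp: S_def)
      have "form_mod p F \<in> S {p} p"
        using F pp form_mod_in_cube[of p F] root_mod_form_mod[of p p F] by (simp add: S_def)
      moreover have "form_mod M F \<in> S P M"
        using F M0 form_mod_in_cube[of M F] rM by (simp add: S_def)
      ultimately show "z \<in> S {p} p \<times> S P M" by (simp add: z g_def)
    qed
    show "finite (S {p} p \<times> S P M)" by (simp add: S_def)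
  qed
  also have "\<dots> = card (S {p} p) * card (S P M)" by (rule card_cartesian_product)
  finally have "real (card (S (insert p P) (p * M))) \<le> real (card (S {p} p)) * real (card (S P M))"
    by (metis of_nat_le_iff of_nat_mult)
  also have "\<dots> \<le> (23 / 24 * real_of_int p ^ 5) * ((23 / 24) ^ card P * real_of_int M ^ 5)"
    using card_root_mod_prime[OF pp] insert.IH insert.prems M0 p0
    by (intro mult_mono) (auto simp: S_def M_def)
  also have "\<dots> = (23 / 24) ^ card (insert p P) * real_of_int (\<Prod>(insert p P)) ^ 5"
    using insert.hyps by (simp add: M_def power_mult_distrib)
  finally show ?case using insert.hyps by (simp add: S_def M_def)
qed

section \<open>Counting forms in boxes by residues\<close>

lemma card_div_interval:
  fixes L :: real and M :: int
  assumes "M > 0" "real_of_int M \<le> L"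
  shows "finite {x div M |x. \<bar>real_of_int x\<bar> \<le> L}" "real (card {x div M |x. \<bar>real_of_int x\<bar> \<le> L}) \<le> 4 * L / M"
proof -
  define y where "y = L / real_of_int M"
  have y: "y \<ge> 1" using assms by (simp add: y_def)
  have sub: "{x div M |x. \<bar>real_of_int x\<bar> \<le> L} \<subseteq> {\<lfloor>- y\<rfloor>..\<lfloor>y\<rfloor>}"
  proof (clarify)
    fix x :: int assume x: "\<bar>real_of_int x\<bar> \<le> L"
    have "x div M = \<lfloor>real_of_int x / real_of_int M\<rfloor>" by (simp add: floor_divide_of_int_eq)
    moreover have "- y \<le> real_of_int x / real_of_int M" "real_of_int x / real_of_int M \<le> y"
      using x assms unfolding y_def by (simp_all add: field_simps abs_le_iff)
    ultimately show "x div M \<in> {\<lfloor>- y\<rfloor>..\<lfloor>y\<rfloor>}" by (simp add: floor_mono)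
  qed
  then show "finite {x div M |x. \<bar>real_of_int x\<bar> \<le> L}" by (rule finite_subset) simp
  have "card {x div M |x. \<bar>real_of_int x\<bar> \<le> L} \<le> card {\<lfloor>- y\<rfloor>..\<lfloor>y\<rfloor>}" by (rule card_mono[OF _ sub]) simp
  then have "real (card {x div M |x. \<bar>real_of_int x\<bar> \<le> L}) \<le> real_of_int (\<lfloor>y\<rfloor> + 1 - \<lfloor>- y\<rfloor>)"
    using y by simp linarith
  \<comment> \<open>At most \<open>2 * y + 2\<close> blocks of length \<open>M\<close> meet the
    interval, and \<open>y \<ge> 1\<close>. This is the source of \<open>4 ^ 5\<close>
    below.\<close>
  also have "\<dots> \<le> 4 * y" using y by linarith
  finally show "real (card {x div M |x. \<bar>real_of_int x\<bar> \<le> L}) \<le> 4 * L / M" by (simp add: y_def)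
qed

text \<open>A form is determined by its residues and quotients modulo \<open>M\<close>; as no
  half-side is below \<open>M\<close>, the number of quotient vectors is bounded by a multiple of
  the volume.\<close>

lemma card_box_residues:
  fixes M :: int
  assumes M: "M > 0" and L: "real_of_int M \<le> l1" "real_of_int M \<le> l2" "real_of_int M \<le> l3" "real_of_int M \<le> l4" "real_of_int M \<le> l5"
    and T: "\<And>F. F \<in> T \<Longrightarrow> form_mod M F \<in> R \<and> (case F of (a, b, c, d, e) \<Rightarrow> \<bar>real_of_int a\<bar> \<le> l1 \<and> \<bar>real_of_int b\<bar> \<le> l2
      \<and> \<bar>real_of_int c\<bar> \<le> l3 \<and> \<bar>real_of_int d\<bar> \<le> l4 \<and> \<bar>real_of_int e\<bar> \<le> l5)"
    and R: "finite R"
  shows "finite T" "real (card T) \<le> real (card R) * (4 ^ 5 * (l1 * l2 * l3 * l4 * l5) / real_of_int M ^ 5)"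
proof -
  define Q where "Q l = {x div M |x. \<bar>real_of_int x\<bar> \<le> l}" for l
  have Q: "finite (Q l)" "real (card (Q l)) \<le> 4 * l / M" if "real_of_int M \<le> l" for l
    using card_div_interval[OF M that] by (simp_all add: Q_def)
  define g where "g F = (form_mod M F, form_map (\<lambda>x. x div M) F)" for F
  define W where "W = R \<times> (Q l1 \<times> Q l2 \<times> Q l3 \<times> Q l4 \<times> Q l5)"
  have inj: "inj_on g T"
  proof (rule inj_onI)
    fix F G assume eq: "g F = g G"
    obtain a b c d e where Fe: "F = (a, b, c, d, e)" by (cases F)
    obtain a' b' c' d' e' where Ge: "G = (a', b', c', d', e')" by (cases G)
    have dm: "x = y" if "x div M = y div M" "x mod M = y mod M" for x y using that by (metis div_mult_mod_eq)
    have dv: "a div M = a' div M" "b div M = b' div M" "c div M = c' div M" "d div M = d' div M" "e div M = e' div M"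
      and md: "a mod M = a' mod M" "b mod M = b' mod M" "c mod M = c' mod M" "d mod M = d' mod M" "e mod M = e' mod M"
      using eq by (simp_all add: Fe Ge g_def)
    show "F = G" unfolding Fe Ge dm[OF dv(1) md(1)] dm[OF dv(2) md(2)] dm[OF dv(3) md(3)] dm[OF dv(4) md(4)] dm[OF dv(5) md(5)] ..
  qed
  have im: "g ` T \<subseteq> W"
  proof (rule image_subsetI)
    fix F assume "F \<in> T"
    from T[OF this] show "g F \<in> W" by (cases F) (auto simp: g_def W_def Q_def)
  qed
  have fin: "finite W" using R Q L by (simp add: W_def)
  show "finite T" using finite_imageD[OF finite_subset[OF im fin] inj] .
  have "card T \<le> card W" by (rule card_inj_on_le[OF inj im fin])
  then have "real (card T) \<le> real (card R * (card (Q l1) * (card (Q l2) * (card (Q l3) * (card (Q l4) * card (Q l5))))))"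
    unfolding W_def card_cartesian_product by (simp only: of_nat_le_iff)
  also have "\<dots> = real (card R) * (real (card (Q l1)) * (real (card (Q l2)) * (real (card (Q l3)) * (real (card (Q l4)) * real (card (Q l5))))))"
    by simp
  also have "\<dots> \<le> real (card R) * ((4 * l1 / M) * ((4 * l2 / M) * ((4 * l3 / M) * ((4 * l4 / M) * (4 * l5 / M)))))"
    using Q L M by (intro mult_left_mono mult_mono) auto
  also have "(4 * l1 / M) * ((4 * l2 / M) * ((4 * l3 / M) * ((4 * l4 / M) * (4 * l5 / M)))) = 4 ^ 5 * (l1 * l2 * l3 * l4 * l5) / real_of_int M ^ 5"
    by (simp add: field_simps numeral_eq_Suc)
  finally show "real (card T) \<le> real (card R) * (4 ^ 5 * (l1 * l2 * l3 * l4 * l5) / real_of_int M ^ 5)" .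
qed

text \<open>The premise on \<open>N\<close> concerns the shortest side, that of
  \<open>a\<close>.\<close>

lemma card_form_box_residues:
  assumes M: "M > 0" and N: "4 ^ k * real_of_int M \<le> N" and R: "finite R"
    and T: "T \<subseteq> form_box k N" "\<And>F. F \<in> T \<Longrightarrow> form_mod M F \<in> R"
  shows "finite T" "real (card T) \<le> real (card R) * (4 ^ 5 * N ^ 5 / real_of_int M ^ 5)"
proof -
  have M1: "real_of_int M \<ge> 1" using M by simp
  have k1: "(1 :: real) \<le> 2 ^ k" "(2 :: real) ^ k \<le> 4 ^ k" by (auto intro: power_mono)
  have N0: "N \<ge> 0" using N M1 by (smt (verit) zero_le_power mult_nonneg_nonneg)
  have "2 ^ k * real_of_int M \<le> 4 ^ k * real_of_int M" "1 * real_of_int M \<le> 2 ^ k * real_of_int M"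
    using k1 M1 by (auto intro: mult_right_mono)
  then have h: "2 ^ k * real_of_int M \<le> N" "real_of_int M \<le> N" using N by auto
  have h1: "N * 1 \<le> N * 2 ^ k" "N * 2 ^ k \<le> N * 4 ^ k" using mult_left_mono[OF k1(1) N0] mult_left_mono[OF k1(2) N0] by simp_all
  have L: "real_of_int M \<le> N / 4 ^ k" "real_of_int M \<le> N / 2 ^ k" "real_of_int M \<le> N" "real_of_int M \<le> N * 2 ^ k" "real_of_int M \<le> N * 4 ^ k"
    using N h h1 by (simp_all add: field_simps)
  have T': "form_mod M F \<in> R \<and> (case F of (a, b, c, d, e) \<Rightarrow> \<bar>real_of_int a\<bar> \<le> N / 4 ^ k \<and> \<bar>real_of_int b\<bar> \<le> N / 2 ^ k
      \<and> \<bar>real_of_int c\<bar> \<le> N \<and> \<bar>real_of_int d\<bar> \<le> N * 2 ^ k \<and> \<bar>real_of_int e\<bar> \<le> N * 4 ^ k)" if "F \<in> T" for F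
    using T(1) T(2)[OF that] that by (auto simp: form_box_def field_simps)
  note c = card_box_residues[OF M L T' R]
  show "finite T" by (rule c(1))
  have "N / 4 ^ k * (N / 2 ^ k) * N * (N * 2 ^ k) * (N * 4 ^ k) = N ^ 5" by (simp add: field_simps numeral_eq_Suc)
  then show "real (card T) \<le> real (card R) * (4 ^ 5 * N ^ 5 / real_of_int M ^ 5)" using c(2) by simp
qed

text \<open>
  Each orbit of the translations \<open>x \<mapsto> x + m y\<close> with \<open>0 \<le> m < 2\<^sup>k\<close> stays in a box of comparable size,
  which makes the number of classes smaller than the number of forms by a factor \<open>2\<^sup>k\<close>.
\<close>
lemma translate_in_form_box:
  assumes "F \<in> form_box k N" "m \<in> {0..<2 ^ k}"
  shows "form_subst 1 0 m 1 F \<in> form_box k (16 * N)"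
proof -
  obtain a b c d e where F: "F = (a, b, c, d, e)" by (cases F)
  define m' where "m' = real_of_int m"
  define w where "w = (2 :: real) ^ k"
  have "m < 2 ^ k" using assms by simp
  then have "real_of_int m < real_of_int (2 ^ k)" by (simp only: of_int_less_iff)
  then have m: "0 \<le> m'" "m' \<le> w" using assms by (simp_all add: m'_def w_def)
  have w: "w \<ge> 1" by (simp add: w_def)
  have w4: "4 ^ k = w * w" by (simp add: w_def flip: power_mult_distrib)
  define A B C D E where "A = real_of_int a" and "B = real_of_int b" and "C = real_of_int c" and "D = real_of_int d" and "E = real_of_int e"
  have bd: "w * w * \<bar>A\<bar> \<le> N" "w * \<bar>B\<bar> \<le> N" "\<bar>C\<bar> \<le> N" "\<bar>D\<bar> \<le> N * w" "\<bar>E\<bar> \<le> N * (w * w)"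
    using assms(1) by (auto simp: F form_box_def w4 A_def B_def C_def D_def E_def w_def)
  have mul: "m' * x \<le> w * y" if "0 \<le> x" "x \<le> y" for x y
    using mult_mono[of m' w x y] m that w by simp
  have n1: "0 \<le> m' * x" if "0 \<le> x" for x using that m by simp
  note n = n1[OF abs_ge_zero] n1[OF n1[OF abs_ge_zero]] n1[OF n1[OF n1[OF abs_ge_zero]]]
  have a1: "m' * \<bar>A\<bar> \<le> w * \<bar>A\<bar>" by (rule mul) simp_all
  have "w * (m' * \<bar>A\<bar>) \<le> w * (w * \<bar>A\<bar>)" using a1 w by (intro mult_left_mono) simp_all
  then have A1: "w * (m' * \<bar>A\<bar>) \<le> N" using bd(1) by (simp only: mult.assoc)
  have "m' * (m' * \<bar>A\<bar>) \<le> w * (w * \<bar>A\<bar>)" by (rule mul[OF n(1) a1])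
  then have A2: "m' * (m' * \<bar>A\<bar>) \<le> N" using bd(1) by (simp only: mult.assoc)
  have A3: "m' * (m' * (m' * \<bar>A\<bar>)) \<le> w * N" by (rule mul[OF n(2) A2])
  have A4: "m' * (m' * (m' * (m' * \<bar>A\<bar>))) \<le> w * (w * N)" by (rule mul[OF n(3) A3])
  have "m' * \<bar>B\<bar> \<le> w * \<bar>B\<bar>" by (rule mul) simp_all
  then have B1: "m' * \<bar>B\<bar> \<le> N" using bd(2) by simp
  have B2: "m' * (m' * \<bar>B\<bar>) \<le> w * N" by (rule mul[OF n(1) B1])
  have B3: "m' * (m' * (m' * \<bar>B\<bar>)) \<le> w * (w * N)" by (rule mul[OF n(2) B2])
  have C1: "m' * \<bar>C\<bar> \<le> w * N" by (rule mul[OF abs_ge_zero bd(3)])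
  have C2: "m' * (m' * \<bar>C\<bar>) \<le> w * (w * N)" by (rule mul[OF n(1) C1])
  have D1: "m' * \<bar>D\<bar> \<le> w * (w * N)" using mul[OF abs_ge_zero bd(4)] by (simp only: mult_ac)
  have N0: "N \<ge> 0" using bd(3) by linarith
  have "w * \<bar>A * m' + B\<bar> \<le> w * (\<bar>A\<bar> * m' + \<bar>B\<bar>)"
    using w m abs_triangle_ineq[of "A * m'" B] by (intro mult_left_mono) (auto simp: abs_mult)
  then have b': "w * \<bar>A * m' + B\<bar> \<le> 16 * N" using A1 bd(2) N0 by (simp add: algebra_simps)
  have ab: "\<bar>x * y\<bar> = y * \<bar>x\<bar>" if "y \<ge> 0" for x y :: real using that by (simp add: abs_mult)
  have mm: "m' * m' \<ge> 0" "m' * (m' * m') \<ge> 0" "m' * (m' * (m' * m')) \<ge> 0" using m by simp_all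
  have wN: "0 \<le> w * N" "0 \<le> w * (w * N)" using w N0 by simp_all
  have tA: "\<bar>A * (m' * m')\<bar> \<le> N" "\<bar>A * (m' * (m' * m'))\<bar> \<le> w * N" "\<bar>A * (m' * (m' * (m' * m')))\<bar> \<le> w * (w * N)"
    using A2 A3 A4 unfolding ab[OF mm(1)] ab[OF mm(2)] ab[OF mm(3)] by (simp_all only: mult.assoc)
  have tB: "\<bar>B * m'\<bar> \<le> N" "\<bar>B * (m' * m')\<bar> \<le> w * N" "\<bar>B * (m' * (m' * m'))\<bar> \<le> w * (w * N)"
    using B1 B2 B3 unfolding ab[OF m(1)] ab[OF mm(1)] ab[OF mm(2)] by (simp_all only: mult.assoc)
  have tC: "\<bar>C * m'\<bar> \<le> w * N" "\<bar>C * (m' * m')\<bar> \<le> w * (w * N)"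
    using C1 C2 unfolding ab[OF m(1)] ab[OF mm(1)] by (simp_all only: mult.assoc)
  have tD: "\<bar>D * m'\<bar> \<le> w * (w * N)" using D1 unfolding ab[OF m(1)] .
  have bd45: "\<bar>D\<bar> \<le> w * N" "\<bar>E\<bar> \<le> w * (w * N)" using bd(4,5) by (simp_all only: mult_ac)
  have tri3: "\<bar>x + 2 * y + z\<bar> \<le> 16 * n" if "\<bar>x\<bar> \<le> n" "\<bar>y\<bar> \<le> n" "\<bar>z\<bar> \<le> n" for x y z n :: real
    using that by linarith
  have tri4: "\<bar>x + 3 * y + 3 * z + u\<bar> \<le> 16 * n" if "\<bar>x\<bar> \<le> n" "\<bar>y\<bar> \<le> n" "\<bar>z\<bar> \<le> n" "\<bar>u\<bar> \<le> n" for x y z u n :: real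
    using that by linarith
  \<comment> \<open>The loss factor 16 is \<open>1 + 4 + 6 + 4 + 1\<close>.\<close>
  have tri5: "\<bar>x + 4 * y + 6 * z + 4 * u + v\<bar> \<le> 16 * n" if "\<bar>x\<bar> \<le> n" "\<bar>y\<bar> \<le> n" "\<bar>z\<bar> \<le> n" "\<bar>u\<bar> \<le> n" "\<bar>v\<bar> \<le> n" for x y z u v n :: real
    using that by linarith
  note c' = tri3[OF tA(1) tB(1) bd(3)]
  note d' = tri4[OF tA(2) tB(2) tC(1) bd45(1)]
  note e' = tri5[OF tA(3) tB(3) tC(2) tD bd45(2)]
  have a': "w * w * \<bar>A\<bar> \<le> 16 * N" using bd(1) N0 by linarith
  show ?thesis
    unfolding F form_box_def using a' b' c' d' e'
    by (simp add: w4 A_def B_def C_def D_def E_def m'_def w_def[symmetric] power2_eq_square power3_eq_cube power4_eq_xxxx mult_ac)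
qed

text \<open>A translate determines the curve by its invariants, and then \<open>m\<close>, because
  its second coefficient is \<open>b + a * m\<close> with \<open>a \<noteq> 0\<close>.\<close>

lemma card_classes:
  assumes T: "\<And>E. E \<in> T \<Longrightarrow> \<exists>F \<in> form_box k N. form_I F = - 4 * fst E \<and> form_J F = - 4 * snd E \<and> fst F \<noteq> 0 \<and> (\<forall>p\<in>P. root_mod p F)"
    and fin: "finite {F \<in> form_box k (16 * N). \<forall>p\<in>P. root_mod p F}"
  shows "card T * 2 ^ k \<le> card {F \<in> form_box k (16 * N). \<forall>p\<in>P. root_mod p F}"
proof -
  define V where "V = {0..<2 ^ k :: int}"
  obtain f where f: "\<And>E. E \<in> T \<Longrightarrow> f E \<in> form_box k N \<and> form_I (f E) = - 4 * fst E \<and> form_J (f E) = - 4 * snd E \<and> fst (f E) \<noteq> 0 \<and> (\<forall>p\<in>P. root_mod p (f E))"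
    using T by metis
  define g where "g = (\<lambda>(E, m). form_subst 1 0 m 1 (f E))"
  have "inj_on g (T \<times> V)"
  proof (rule inj_onI)
    fix x y assume x: "x \<in> T \<times> V" and y: "y \<in> T \<times> V" and e: "g x = g y"
    obtain E m where xe: "x = (E, m)" by (cases x)
    obtain E' m' where ye: "y = (E', m')" by (cases y)
    have E: "E \<in> T" "E' \<in> T" using x y xe ye by auto
    have "form_I (f E) = form_I (f E')" "form_J (f E) = form_J (f E')"
      using arg_cong[OF e, of form_I] arg_cong[OF e, of form_J] by (simp_all add: g_def xe ye form_I_subst form_J_subst)
    then have "fst E = fst E'" "snd E = snd E'" using f[OF E(1)] f[OF E(2)] by simp_all
    then have EE: "E = E'" by (simp add: prod_eq_iff)
    obtain a b c d e' where F: "f E = (a, b, c, d, e')" by (cases "f E")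
    then have "a \<noteq> 0" using f[OF E(1)] by simp
    moreover have "a * m = a * m'" using e F EE by (simp add: g_def xe ye)
    ultimately show "x = y" using EE xe ye by simp
  qed
  moreover have "g ` (T \<times> V) \<subseteq> {F \<in> form_box k (16 * N). \<forall>p\<in>P. root_mod p F}"
  proof (rule image_subsetI)
    fix x assume "x \<in> T \<times> V"
    then obtain E m where x: "x = (E, m)" and h: "E \<in> T" "m \<in> V" by auto
    have "root_mod p (form_subst 1 0 m 1 (f E))" if "p \<in> P" for p
      using f[OF h(1)] that by (intro root_mod_subst) simp_all
    moreover have "form_subst 1 0 m 1 (f E) \<in> form_box k (16 * N)"
      using f[OF h(1)] h(2) by (intro translate_in_form_box) (simp_all add: V_def)
    ultimately show "g x \<in> {F \<in> form_box k (16 * N). \<forall>p\<in>P. root_mod p F}"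
      by (simp add: g_def x)
  qed
  ultimately have "card (T \<times> V) \<le> card {F \<in> form_box k (16 * N). \<forall>p\<in>P. root_mod p F}"
    using fin by (rule card_inj_on_le)
  moreover have "card V = 2 ^ k" by (simp add: V_def nat_power_eq)
  ultimately show ?thesis by (simp add: card_cartesian_product)
qed

section \<open>Counting curves\<close>

text \<open>Heights are parametrised as \<open>m ^ 6\<close>, so that a root of the cubic,
  \<open>A\<close> and \<open>B\<close> have sizes of order \<open>m\<close>, \<open>m ^ 2\<close>
  and \<open>m ^ 3\<close>.\<close>

lemma curves_upto_bounds:
  fixes m :: real
  assumes "(A, B) \<in> curves_upto (m ^ 6)" "m > 0"
  shows "\<bar>real_of_int A\<bar> \<le> m ^ 2" "\<bar>real_of_int B\<bar> \<le> m ^ 3"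
proof -
  have "real_of_int (max (4 * \<bar>A\<bar> ^ 3) (27 * B ^ 2)) \<le> m ^ 6" using assms by (simp add: curves_upto_def)
  then have h: "4 * \<bar>real_of_int A\<bar> ^ 3 \<le> m ^ 6" "27 * real_of_int B ^ 2 \<le> m ^ 6"
    by (simp_all add: of_int_max)
  have "\<bar>real_of_int A\<bar> ^ 3 \<le> m ^ 6" using h(1) zero_le_power[of "\<bar>real_of_int A\<bar>" 3] by linarith
  then have "\<bar>real_of_int A\<bar> ^ Suc 2 \<le> (m ^ 2) ^ Suc 2" by (simp flip: power_mult)
  then show "\<bar>real_of_int A\<bar> \<le> m ^ 2" by (rule power_le_imp_le_base) simp
  have "real_of_int B ^ 2 \<le> m ^ 6" using h(2) zero_le_power2[of "real_of_int B"] by linarith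
  then have "\<bar>real_of_int B\<bar> ^ 2 \<le> (m ^ 3) ^ 2" by (simp flip: power_mult)
  then show "\<bar>real_of_int B\<bar> \<le> m ^ 3" by (rule power2_le_imp_le) (use assms in simp)
qed

lemma rational_root_is_integer:
  fixes q :: rat
  assumes "q ^ 3 + of_int A * q + of_int B = 0"
  obtains n :: int where "B = - (n ^ 3) - A * n"
proof -
  obtain m n where q: "n > 0" "coprime m n" "q = of_int m / of_int n" by (rule rat_coprime_quotient)
  have "(of_int m :: rat) ^ 3 + of_int A * of_int m * of_int n ^ 2 + of_int B * of_int n ^ 3 = 0"
    using assms q by (simp add: field_simps power2_eq_square power3_eq_cube)
  then have "(of_int (m ^ 3 + A * m * n ^ 2 + B * n ^ 3) :: rat) = 0" by simp
  then have e: "m ^ 3 + A * m * n ^ 2 + B * n ^ 3 = 0" by (simp only: of_int_eq_0_iff)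
  then have "m ^ 3 = n * (- (A * m * n) - B * n ^ 2)" by algebra
  then have "n dvd m ^ 3" by simp
  moreover have "coprime n (m ^ 3)" using q(2) by (simp add: coprime_commute)
  ultimately have "is_unit n" by (metis coprime_common_divisor dvd_refl)
  then have "n = 1" using q(1) by simp
  then show ?thesis using e that[of m] by simp
qed

text \<open>Such a curve is determined by \<open>A\<close> and an integral root \<open>n\<close>
  with \<open>\<bar>n\<bar> \<le> 2 * m\<close>.\<close>

lemma card_curves_with_root:
  fixes m :: real
  assumes "m \<ge> 1"
  shows "real (card {(A, B) \<in> curves_upto (m ^ 6). \<exists>q::rat. q ^ 3 + of_int A * q + of_int B = 0}) \<le> 15 * m ^ 3"
    (is "real (card ?R) \<le> _")
proof -
  define a b where "a = \<lfloor>m ^ 2\<rfloor>" and "b = \<lfloor>2 * m\<rfloor>"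
  have ab: "a \<ge> 0" "b \<ge> 0" "real_of_int a \<le> m ^ 2" "real_of_int b \<le> 2 * m" using assms by (simp_all add: a_def b_def)
  have sub: "?R \<subseteq> (\<lambda>(A, n). (A, - (n ^ 3) - A * n)) ` ({- a..a} \<times> {- b..b})"
  proof
    fix E assume "E \<in> ?R"
    then obtain A B and q :: rat where E: "E = (A, B)" "(A, B) \<in> curves_upto (m ^ 6)" and q: "q ^ 3 + of_int A * q + of_int B = 0"
      by auto
    obtain n where n: "B = - (n ^ 3) - A * n" using q by (rule rational_root_is_integer)
    have bd: "\<bar>real_of_int A\<bar> \<le> m ^ 2" "\<bar>real_of_int B\<bar> \<le> m ^ 3" using curves_upto_bounds[OF E(2)] assms by simp_all
    have "real_of_int n ^ 3 + real_of_int A * real_of_int n + real_of_int B = 0" by (simp add: n)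
    from cubic_root_bound[OF this bd] have "\<bar>real_of_int n\<bar> \<le> 2 * m" using assms by simp
    then have "\<bar>n\<bar> \<le> b" unfolding b_def by linarith
    moreover have "\<bar>A\<bar> \<le> a" using bd(1) unfolding a_def by linarith
    ultimately have "A \<in> {- a..a}" "n \<in> {- b..b}" by auto
    then show "E \<in> (\<lambda>(A, n). (A, - (n ^ 3) - A * n)) ` ({- a..a} \<times> {- b..b})" unfolding E n by force
  qed
  have "card ?R \<le> card ({- a..a} \<times> {- b..b})"
    by (rule order_trans[OF card_mono[OF _ sub] card_image_le]) auto
  then have "real (card ?R) \<le> real (card ({- a..a} \<times> {- b..b}))" by (simp only: of_nat_le_iff)
  also have "\<dots> = real (nat (2 * a + 1) * nat (2 * b + 1))"
    by (simp add: card_cartesian_product algebra_simps)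
  also have "\<dots> = (2 * real_of_int a + 1) * (2 * real_of_int b + 1)" using ab by simp
  also have "\<dots> \<le> (3 * m ^ 2) * (5 * m)"
  proof (rule mult_mono)
    have "1 \<le> m ^ 2" using assms by (simp add: one_le_power)
    then show "2 * real_of_int a + 1 \<le> 3 * m ^ 2" using ab by linarith
    show "2 * real_of_int b + 1 \<le> 5 * m" using ab assms by linarith
  qed (use ab assms in auto)
  also have "\<dots> = 15 * m ^ 3" by (simp add: power2_eq_square power3_eq_cube)
  finally show ?thesis .
qed

section \<open>A lower bound for the number of curves\<close>

lemma sum_inverse_fourth_power: "(\<Sum>k = 2..n. 1 / real k ^ 4) \<le> 1 / 2"
proof -
  \<comment> \<open>The subtracted term makes the induction telescope.\<close>
  have "(\<Sum>k = 2..n. 1 / real k ^ 4) \<le> 1 / 2 - 1 / (2 * real n)" if "n \<ge> 1"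
    using that
  proof (induction n rule: dec_induct)
    case (step n)
    have "real (Suc n) ^ 4 \<ge> 2 * (real n * real (Suc n))"
    proof -
      have "1 * (real n * real (Suc n)) \<le> (real (Suc n) * real (Suc n)) * (real (Suc n) * real (Suc n))"
        using mult_mono[of 1 "real (Suc n)" 1 "real (Suc n)"] by (intro mult_mono) auto
      moreover have "4 * (real (Suc n) * real (Suc n)) \<le> (real (Suc n) * real (Suc n)) * (real (Suc n) * real (Suc n))"
        using step(1) mult_mono[of 2 "real (Suc n)" 2 "real (Suc n)"] by (intro mult_right_mono) auto
      moreover have "real n * real (Suc n) \<le> real (Suc n) * real (Suc n)" by (intro mult_right_mono) auto
      ultimately show ?thesis unfolding power4_eq_xxxx by (simp only: mult.assoc)
    qed
    then have "1 / real (Suc n) ^ 4 \<le> 1 / (2 * (real n * real (Suc n)))"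
      using step(1) by (intro divide_left_mono) auto
    also have "\<dots> = 1 / (2 * real n) - 1 / (2 * real (Suc n))" using step(1) by (simp add: field_simps)
    finally show ?case using step by simp
  qed simp
  moreover have "1 / (2 * real n) \<ge> 0" by simp
  ultimately show ?thesis by (cases "n \<ge> 1") (linarith, simp add: not_le)
qed

lemma card_multiples:
  fixes a d :: int
  assumes "a \<ge> 0" "d > 0"
  shows "real (card {x \<in> {1..a}. d dvd x}) \<le> a / d"
proof -
  have "card {x \<in> {1..a}. d dvd x} \<le> card {1..a div d}"
  proof (rule card_inj_on_le[where f = "\<lambda>x. x div d"])
    show "inj_on (\<lambda>x. x div d) {x \<in> {1..a}. d dvd x}"
      by (rule inj_onI) (metis (no_types, lifting) dvd_div_mult_self mem_Collect_eq)
    show "(\<lambda>x. x div d) ` {x \<in> {1..a}. d dvd x} \<subseteq> {1..a div d}"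
      using assms by (auto simp: zdiv_mono1 pos_imp_zdiv_pos_iff zdvd_imp_le int_one_le_iff_zero_less)
  qed simp
  then have "real (card {x \<in> {1..a}. d dvd x}) \<le> real (card {1..a div d})" by (simp only: of_nat_le_iff)
  also have "\<dots> = real_of_int (a div d)" using assms by (simp add: pos_imp_zdiv_nonneg_iff)
  also have "\<dots> \<le> a / d" by (rule real_of_int_div4)
  finally show ?thesis .
qed

text \<open>The union bound over all \<open>k \<ge> 2\<close>, not just primes, already loses at
  most half.\<close>

lemma card_fourth_power_free:
  fixes a :: int
  assumes "a \<ge> 1"
  shows "real_of_int a / 2 \<le> real (card {x \<in> {1..a}. \<forall>p. prime p \<longrightarrow> \<not> p ^ 4 dvd x})" (is "_ \<le> real (card ?G)")
proof -
  define n where "n = nat a"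
  define H where "H k = {x \<in> {1..a}. int k ^ 4 dvd x}" for k
  have fin: "finite {x \<in> {1..a}. Q x}" for Q by (rule finite_subset[of _ "{1..a}"]) auto
  have "{1..a} \<subseteq> ?G \<union> (\<Union>k\<in>{2..n}. H k)"
  proof
    fix x assume x: "x \<in> {1..a}"
    show "x \<in> ?G \<union> (\<Union>k\<in>{2..n}. H k)"
    proof (cases "x \<in> ?G")
      case False
      then obtain p where p: "prime p" "p ^ 4 dvd x" using x by auto
      have p2: "p \<ge> 2" using p(1) by (rule prime_ge_2_int)
      have "p \<le> p ^ 4" using p2 by (intro self_le_power) auto
      also have "\<dots> \<le> x" using p(2) x by (intro zdvd_imp_le) auto
      finally have "nat p \<in> {2..n}" "x \<in> H (nat p)" using p2 p(2) x by (auto simp: n_def H_def)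
      then show ?thesis by blast
    qed simp
  qed
  then have "card {1..a} \<le> card (?G \<union> (\<Union>k\<in>{2..n}. H k))"
    unfolding H_def by (intro card_mono finite_UnI finite_UN_I fin) auto
  also have "\<dots> \<le> card ?G + card (\<Union>k\<in>{2..n}. H k)" by (rule card_Un_le)
  also have "card (\<Union>k\<in>{2..n}. H k) \<le> (\<Sum>k = 2..n. card (H k))" by (rule card_UN_le) simp
  finally have "real (card {1..a}) \<le> real (card ?G + (\<Sum>k = 2..n. card (H k)))" by (simp only: of_nat_le_iff)
  then have "real_of_int a \<le> real (card ?G) + (\<Sum>k = 2..n. real (card (H k)))" using assms by simp
  also have "(\<Sum>k = 2..n. real (card (H k))) \<le> (\<Sum>k = 2..n. real_of_int a * (1 / real k ^ 4))"
  proof (rule sum_mono)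
    fix k assume "k \<in> {2..n}"
    then show "real (card (H k)) \<le> real_of_int a * (1 / real k ^ 4)"
      using card_multiples[of a "int k ^ 4"] assms by (simp add: H_def)
  qed
  also have "\<dots> \<le> real_of_int a * (1 / 2)"
    unfolding sum_distrib_left[symmetric] using sum_inverse_fourth_power assms by (intro mult_left_mono) auto
  finally show ?thesis by simp
qed

text \<open>If \<open>A\<close> is free of fourth powers, \<open>p ^ 12\<close> never divides
  \<open>A ^ 3\<close>, so \<open>B\<close> is unrestricted. The ranges keep the height below
  \<open>m ^ 6\<close> as \<open>4 / 8\<close> and \<open>27 / 36\<close> are below 1; rounding down
  and the choice of \<open>A\<close> each cost at most a factor 2 per range, which gives
  \<open>8 * 12 = 96\<close>.\<close>

lemma card_curves_upto:
  fixes m :: real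
  assumes "m \<ge> 3"
  shows "m ^ 5 / 96 \<le> real (card (curves_upto (m ^ 6)))"
proof -
  define a b where "a = \<lfloor>m ^ 2 / 2\<rfloor>" and "b = \<lfloor>m ^ 3 / 6\<rfloor>"
  have m2: "m ^ 2 \<ge> 9" "m ^ 3 \<ge> 27" using power_mono[OF assms, of 2] power_mono[OF assms, of 3] by simp_all
  have a: "real_of_int a \<le> m ^ 2 / 2" "m ^ 2 / 4 \<le> real_of_int a" "a \<ge> 1" using m2 unfolding a_def by linarith+
  have b: "real_of_int b \<le> m ^ 3 / 6" "m ^ 3 / 12 \<le> real_of_int b" "b \<ge> 1" using m2 unfolding b_def by linarith+
  define G where "G = {x \<in> {1..a}. \<forall>p. prime p \<longrightarrow> \<not> p ^ 4 dvd x}"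
  have "G \<times> {1..b} \<subseteq> curves_upto (m ^ 6)"
  proof
    fix E assume "E \<in> G \<times> {1..b}"
    then obtain A B where E: "E = (A, B)" "A \<in> G" "B \<in> {1..b}" by auto
    have A: "1 \<le> A" "real_of_int A \<le> m ^ 2 / 2" and B: "1 \<le> B" "real_of_int B \<le> m ^ 3 / 6"
      using E a b by (auto simp: G_def)
    have "real_of_int A ^ 3 \<le> (m ^ 2 / 2) ^ 3" using A by (intro power_mono) auto
    also have "\<dots> = m ^ 6 / 8" by (simp add: power_divide flip: power_mult)
    finally have hA: "4 * real_of_int A ^ 3 \<le> m ^ 6" using zero_le_power[of m 6] assms by linarith
    have "real_of_int B ^ 2 \<le> (m ^ 3 / 6) ^ 2" using B by (intro power_mono) auto
    also have "\<dots> = m ^ 6 / 36" by (simp add: power_divide flip: power_mult)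
    finally have hB: "27 * real_of_int B ^ 2 \<le> m ^ 6" using zero_le_power[of m 6] assms by linarith
    have "real_of_int (height (A, B)) \<le> m ^ 6" using hA hB A by (simp add: of_int_max)
    moreover have "4 * A ^ 3 + 27 * B ^ 2 > 0" using A by (intro add_pos_nonneg) auto
    moreover have "\<not> p ^ 12 dvd gcd (A ^ 3) (B ^ 2)" if "prime p" for p
    proof
      assume "p ^ 12 dvd gcd (A ^ 3) (B ^ 2)"
      then have "(p ^ 4) ^ 3 dvd A ^ 3" by (simp flip: power_mult)
      then have "p ^ 4 dvd A" by (subst (asm) pow_divides_pow_iff) auto
      then show False using E(2) that by (auto simp: G_def)
    qed
    ultimately show "E \<in> curves_upto (m ^ 6)" by (auto simp: E curves_upto_def curves_def)
  qed
  then have "card (G \<times> {1..b}) \<le> card (curves_upto (m ^ 6))" by (rule card_mono[OF finite_curves_upto])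
  then have "real (card G * nat b) \<le> real (card (curves_upto (m ^ 6)))"
    by (simp add: card_cartesian_product flip: of_nat_mult)
  then have "real (card G) * real_of_int b \<le> real (card (curves_upto (m ^ 6)))" using b by simp
  moreover have "real_of_int a / 2 * real_of_int b \<le> real (card G) * real_of_int b"
    using card_fourth_power_free[OF a(3)] b unfolding G_def by (intro mult_right_mono) auto
  moreover have "(m ^ 2 / 4 / 2) * (m ^ 3 / 12) \<le> real_of_int a / 2 * real_of_int b"
    using a b assms by (intro mult_mono) auto
  moreover have "(m ^ 2 / 4 / 2) * (m ^ 3 / 12) = m ^ 5 / 96" by (simp flip: power_add)
  ultimately show ?thesis by linarith
qed

section \<open>Assembling the bounds\<close>

definition large_primes :: "int \<Rightarrow> int set" where
  "large_primes D = {p. prime p \<and> p \<ge> 5 \<and> p dvd D}"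

lemma finite_large_primes: "D \<noteq> 0 \<Longrightarrow> finite (large_primes D)"
  unfolding large_primes_def by (rule finite_subset[OF _ finite_divisors_int]) auto

lemma omega_le: "D \<noteq> 0 \<Longrightarrow> omega D \<le> card (large_primes D) + 2"
proof -
  assume "D \<noteq> 0"
  have "p = 2 \<or> p = 3" if "prime p" "\<not> p \<ge> 5" for p :: int
  proof -
    have "p \<noteq> 4" using that(1) by auto
    then show ?thesis using prime_ge_2_int[OF that(1)] that(2) by linarith
  qed
  then have "{p. prime p \<and> p dvd D} \<subseteq> large_primes D \<union> {2, 3}"
    by (auto simp: large_primes_def)
  then have "omega D \<le> card (large_primes D \<union> {2, 3})"
    unfolding omega_def using finite_large_primes[OF \<open>D \<noteq> 0\<close>] by (intro card_mono) auto
  also have "\<dots> \<le> card (large_primes D) + card {2 :: int, 3}" by (rule card_Un_le)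
  finally show ?thesis by simp
qed

lemma not_iso_cases:
  fixes m :: real
  assumes D: "squarefree D" "D \<noteq> 1" and E: "(A, B) \<in> curves_upto (m ^ 6)" "\<not> eta_is_iso (A, B) D" and m: "m > 0"
    and noroot: "\<not> (\<exists>q::rat. q ^ 3 + of_int A * q + of_int B = 0)"
  obtains k F where "F \<in> form_box k (128 * m)" "form_I F = - 4 * A" "form_J F = - 4 * B" "fst F \<noteq> 0"
    "\<forall>p\<in>large_primes D. root_mod p F"
proof -
  have disc: "4 * A ^ 3 + 27 * B ^ 2 \<noteq> 0" using E by (auto simp: curves_upto_def curves_def)
  obtain r s l z :: rat where s: "s ^ 2 = r ^ 3 + of_int A * r + of_int B"
    and l: "l ^ 4 - 6 * r * l ^ 2 + 8 * s * l - 3 * r ^ 2 - 4 * of_int A = of_int D * z ^ 2"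
    and nz: "\<And>m. m ^ 4 - 6 * r * m ^ 2 + 8 * s * m - 3 * r ^ 2 - 4 * of_int A \<noteq> 0"
    using eta_not_iso_cases[OF D disc E(2)] noroot by blast
  have pq: "point_quartic (of_int A) r s x 1 = x ^ 4 - 6 * r * x ^ 2 + 8 * s * x - 3 * r ^ 2 - 4 * of_int A" for x
    by (simp add: point_quartic_def quartic_def)
  \<comment> \<open>\<open>s = 0\<close> would make \<open>r\<close> a rational root of the
    cubic.\<close>
  have s0: "s \<noteq> 0" using s noroot by auto
  obtain k F where "F \<in> form_box k (128 * m)" "form_I F = - 4 * A" "form_J F = - 4 * B" "fst F \<noteq> 0"
    "\<And>p. prime p \<Longrightarrow> p dvd D \<Longrightarrow> root_mod p F"
    using reduced_covering_form[OF s s0 D(1) disc l[folded pq] nz[folded pq] m curves_upto_bounds[OF E(1) m]] by metis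
  then show ?thesis using that by (auto simp: large_primes_def)
qed

lemma sum_half_powers_tail: "(\<Sum>k<n. if k < K then 0 else 1 / 2 ^ k) \<le> (2 :: real) / 2 ^ K"
proof -
  have "(\<Sum>k<n. if k < K then 0 else 1 / 2 ^ k) \<le> (if n \<le> K then 0 else (2 :: real) / 2 ^ K - 2 / 2 ^ n)"
  proof (induction n)
    case (Suc n)
    then show ?case by (auto split: if_splits simp: not_le less_Suc_eq_le le_Suc_eq)
  qed simp
  also have "\<dots> \<le> 2 / 2 ^ K" by simp
  finally show ?thesis .
qed

lemma sum_half_powers: "(\<Sum>k<n. c / 2 ^ k) \<le> 2 * (c :: real)" if "c \<ge> 0"
proof -
  have "(\<Sum>k<n. c / 2 ^ k) = c * (\<Sum>k<n. 1 / 2 ^ k)" by (simp add: sum_distrib_left)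
  also have "\<dots> \<le> c * 2" using sum_half_powers_tail[of 0 n] that by (intro mult_left_mono) auto
  finally show ?thesis by simp
qed

text \<open>For \<open>k < K\<close> the box has room for residues modulo \<open>\<Prod>P\<close>,
  and the classes contribute a multiple of \<open>\<delta> / 2 ^ k\<close>; from \<open>K\<close> on
  the bound \<open>1 / 2 ^ k\<close> is used alone. The two sums are at most
  \<open>2 * \<delta>\<close> and \<open>2 / 2 ^ K \<le> 2 * \<delta>\<close>. In \<open>N\<close>,
  \<open>2048 = 16 * 128\<close> comes from the translates and the reduction.\<close>

lemma card_not_iso_without_root:
  fixes m :: real
  assumes D: "squarefree D" "D \<noteq> 1" and m: "m > 0"
  defines "P \<equiv> large_primes D" and "N \<equiv> 2048 * m"
  defines "\<delta> \<equiv> (23 / 24 :: real) ^ card P"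
  assumes K: "1 / 2 ^ K \<le> \<delta>" and mK: "4 ^ K * real_of_int (\<Prod>P) \<le> N"
  shows "real (card {(A, B) \<in> curves_upto (m ^ 6). \<not> eta_is_iso (A, B) D \<and> \<not> (\<exists>q::rat. q ^ 3 + of_int A * q + of_int B = 0)})
    \<le> 4 ^ 6 * N ^ 5 * \<delta>" (is "real (card ?S) \<le> _")
proof -
  have "D \<noteq> 0" using D by auto
  then have finP: "finite P" unfolding P_def by (rule finite_large_primes)
  have P: "prime p \<and> p \<ge> 5" if "p \<in> P" for p using that by (simp add: P_def large_primes_def)
  define M where "M = \<Prod>P"
  have "p > 0" if "p \<in> P" for p using P[OF that] by linarith
  then have M0: "M > 0" unfolding M_def by (intro prod_pos)
  have N0: "N > 0" using m by (simp add: N_def)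
  have \<delta>0: "\<delta> \<ge> 0" by (simp add: \<delta>_def)
  define T where "T k = {E \<in> curves_upto (m ^ 6). \<exists>F \<in> form_box k (128 * m). form_I F = - 4 * fst E \<and> form_J F = - 4 * snd E
     \<and> fst F \<noteq> 0 \<and> (\<forall>p\<in>P. root_mod p F)}" for k
  define W where "W k = {F \<in> form_box k N. \<forall>p\<in>P. root_mod p F}" for k
  have N16: "16 * (128 * m) = N" by (simp add: N_def)
  have finT: "finite (T k)" for k unfolding T_def by (rule finite_subset[OF _ finite_curves_upto]) auto
  \<comment> \<open>A nonzero integer \<open>a\<close> does not fit into a side shorter than 1, so
    only finitely many boxes matter.\<close>
  have empty: "T k = {}" if "\<not> 4 ^ k \<le> N" for k
  proof (rule ccontr)
    assume "T k \<noteq> {}"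
    then obtain F where F: "F \<in> form_box k (128 * m)" "fst F \<noteq> 0" by (auto simp: T_def)
    obtain a b c d e where Fe: "F = (a, b, c, d, e)" by (cases F)
    have "\<bar>real_of_int a\<bar> \<ge> 1" using F(2) by (simp add: Fe)
    then have "4 ^ k * 1 \<le> 4 ^ k * \<bar>real_of_int a\<bar>" by (intro mult_left_mono) auto
    also have "\<dots> \<le> 128 * m" using F(1) by (simp add: Fe form_box_def)
    also have "\<dots> \<le> N" using m by (simp add: N_def)
    finally show False using that by simp
  qed
  \<comment> \<open>Modulus 1 turns the residue count into a plain count of the box.\<close>
  have trivial_bound: "finite (W k)" "real (card (W k)) \<le> 4 ^ 5 * N ^ 5" if k: "4 ^ k \<le> N" for k
  proof -
    have R: "finite (form_cube 1)" by simp
    have "card (form_cube 1) = 1" by (simp add: form_cube_def card_cartesian_product)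
    moreover have "W k \<subseteq> form_box k N" "\<And>F. F \<in> W k \<Longrightarrow> form_mod 1 F \<in> form_cube 1"
      by (auto simp: W_def form_cube_def)
    note card_form_box_residues[OF zero_less_one _ R this]
    ultimately show "finite (W k)" "real (card (W k)) \<le> 4 ^ 5 * N ^ 5" using k by simp_all
  qed
  have density_bound: "real (card (W k)) \<le> 4 ^ 5 * N ^ 5 * \<delta>" if k: "k < K" for k
  proof -
    define R where "R = {F \<in> form_cube M. \<forall>p\<in>P. root_mod p F}"
    have "(4 :: real) ^ k \<le> 4 ^ K" using k by (intro power_increasing) auto
    then have "4 ^ k * real_of_int M \<le> 4 ^ K * real_of_int M" using M0 by (intro mult_right_mono) auto
    then have kM: "4 ^ k * real_of_int M \<le> N" using mK by (simp add: M_def)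
    have "finite R" by (simp add: R_def)
    moreover have "W k \<subseteq> form_box k N" by (auto simp: W_def)
    moreover have "form_mod M F \<in> R" if "F \<in> W k" for F
    proof -
      have "root_mod p (form_mod M F)" if "p \<in> P" for p
        using that \<open>F \<in> W k\<close> root_mod_form_mod[of p M F] dvd_prodI[OF finP that, of "\<lambda>x. x"] by (simp add: W_def M_def)
      then show ?thesis using form_mod_in_cube[OF M0] by (simp add: R_def)
    qed
    ultimately have "real (card (W k)) \<le> real (card R) * (4 ^ 5 * N ^ 5 / real_of_int M ^ 5)"
      by (rule card_form_box_residues(2)[OF M0 kM])
    also have "\<dots> \<le> (\<delta> * real_of_int M ^ 5) * (4 ^ 5 * N ^ 5 / real_of_int M ^ 5)"
    proof (rule mult_right_mono)
      show "real (card R) \<le> \<delta> * real_of_int M ^ 5"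
        using card_root_mod_primes[OF finP P] unfolding R_def M_def \<delta>_def .
    qed (use N0 M0 in simp)
    also have "\<dots> = 4 ^ 5 * N ^ 5 * \<delta>" using M0 by simp
    finally show ?thesis .
  qed
  have Tk: "real (card (T k)) \<le> 4 ^ 5 * N ^ 5 * (\<delta> / 2 ^ k + (if k < K then 0 else 1 / 2 ^ k))" for k
  proof (cases "4 ^ k \<le> N")
    case False
    then show ?thesis using empty N0 \<delta>0 by simp
  next
    case True
    have "card (T k) * 2 ^ k \<le> card (W k)"
      unfolding W_def N16[symmetric]
    proof (rule card_classes)
      show "finite {F \<in> form_box k (16 * (128 * m)). \<forall>p\<in>P. root_mod p F}"
        using trivial_bound(1)[OF True] unfolding W_def N16 .
    qed (auto simp: T_def)
    then have "real (card (T k) * 2 ^ k) \<le> real (card (W k))" by (simp only: of_nat_le_iff)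
    then have 1: "real (card (T k)) \<le> real (card (W k)) / 2 ^ k" by (simp add: field_simps)
    show ?thesis
    proof (cases "k < K")
      case True
      then have "real (card (W k)) / 2 ^ k \<le> 4 ^ 5 * N ^ 5 * \<delta> / 2 ^ k" using density_bound by (intro divide_right_mono) auto
      then show ?thesis using 1 True by simp
    next
      case False
      have "real (card (W k)) / 2 ^ k \<le> 4 ^ 5 * N ^ 5 / 2 ^ k" using trivial_bound(2) \<open>4 ^ k \<le> N\<close> by (intro divide_right_mono) auto
      moreover have "0 \<le> 4 ^ 5 * N ^ 5 * (\<delta> / 2 ^ k)" using N0 \<delta>0 by simp
      ultimately show ?thesis using 1 False by (simp add: distrib_left)
    qed
  qed
  obtain n :: nat where n: "N < 2 ^ n" using real_arch_pow[of 2 N] by auto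
  have "?S \<subseteq> (\<Union>k<n. T k)"
  proof
    fix E assume "E \<in> ?S"
    then obtain A B where E: "E = (A, B)" "(A, B) \<in> curves_upto (m ^ 6)" "\<not> eta_is_iso (A, B) D"
      "\<not> (\<exists>q::rat. q ^ 3 + of_int A * q + of_int B = 0)" by auto
    obtain k F where "F \<in> form_box k (128 * m)" "form_I F = - 4 * A" "form_J F = - 4 * B" "fst F \<noteq> 0" "\<forall>p\<in>P. root_mod p F"
      using not_iso_cases[OF D E(2,3) m E(4)] unfolding P_def by metis
    then have kT: "E \<in> T k" using E by (auto simp: T_def)
    then have "4 ^ k \<le> N" using empty by auto
    moreover have "(2 :: real) ^ k \<le> 4 ^ k" by (intro power_mono) auto
    ultimately have "(2 :: real) ^ k < 2 ^ n" using n by linarith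
    then have "k < n" by (simp add: power_strict_increasing_iff)
    then show "E \<in> (\<Union>k<n. T k)" using kT by auto
  qed
  then have "card ?S \<le> card (\<Union>k<n. T k)" using finT by (intro card_mono) auto
  also have "\<dots> \<le> (\<Sum>k<n. card (T k))" by (rule card_UN_le) simp
  finally have "real (card ?S) \<le> real (\<Sum>k<n. card (T k))" by (simp only: of_nat_le_iff)
  also have "\<dots> = (\<Sum>k<n. real (card (T k)))" by (rule of_nat_sum)
  also have "\<dots> \<le> (\<Sum>k<n. 4 ^ 5 * N ^ 5 * (\<delta> / 2 ^ k + (if k < K then 0 else 1 / 2 ^ k)))"
    using Tk by (intro sum_mono)
  also have "\<dots> = 4 ^ 5 * N ^ 5 * ((\<Sum>k<n. \<delta> / 2 ^ k) + (\<Sum>k<n. if k < K then 0 else 1 / 2 ^ k))"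
    by (simp only: sum_distrib_left[symmetric] sum.distrib)
  also have "\<dots> \<le> 4 ^ 5 * N ^ 5 * (2 * \<delta> + 2 / 2 ^ K)"
    using sum_half_powers[OF \<delta>0] sum_half_powers_tail N0 by (intro mult_left_mono add_mono) auto
  also have "\<dots> \<le> 4 ^ 5 * N ^ 5 * (4 * \<delta>)" using K N0 by (intro mult_left_mono) auto
  finally show ?thesis by simp
qed

text \<open>The premise \<open>15 \<le> \<delta> * m\<close> puts the \<open>15 * m ^ 3\<close>
  curves with a rational root below \<open>\<delta> * m ^ 5\<close>.\<close>

lemma proportion_not_iso:
  fixes m :: real
  assumes D: "squarefree D" "D \<noteq> 1" and m: "m \<ge> 3"
  defines "\<delta> \<equiv> (23 / 24 :: real) ^ card (large_primes D)"
  assumes K: "1 / 2 ^ K \<le> \<delta>" and mK: "4 ^ K * real_of_int (\<Prod>(large_primes D)) \<le> m" and m\<delta>: "15 \<le> \<delta> * m"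
  shows "real (card {E \<in> curves_upto (m ^ 6). \<not> eta_is_iso E D}) / real (card (curves_upto (m ^ 6)))
    \<le> 96 * (4 ^ 6 * 2048 ^ 5 + 1) * \<delta>"
proof -
  let ?S = "{(A, B) \<in> curves_upto (m ^ 6). \<not> eta_is_iso (A, B) D \<and> \<not> (\<exists>q::rat. q ^ 3 + of_int A * q + of_int B = 0)}"
  let ?R = "{(A, B) \<in> curves_upto (m ^ 6). \<exists>q::rat. q ^ 3 + of_int A * q + of_int B = 0}"
  have \<delta>0: "\<delta> \<ge> 0" by (simp add: \<delta>_def)
  have fin: "finite ?S" "finite ?R" by (rule finite_subset[OF _ finite_curves_upto]; auto)+
  have "card {E \<in> curves_upto (m ^ 6). \<not> eta_is_iso E D} \<le> card (?S \<union> ?R)"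
    using fin by (intro card_mono) auto
  also have "\<dots> \<le> card ?S + card ?R" by (rule card_Un_le)
  finally have "real (card {E \<in> curves_upto (m ^ 6). \<not> eta_is_iso E D}) \<le> real (card ?S) + real (card ?R)" by linarith
  also have "real (card ?S) \<le> 4 ^ 6 * (2048 * m) ^ 5 * \<delta>"
    unfolding \<delta>_def using m mK K by (intro card_not_iso_without_root[OF D]) (auto simp: \<delta>_def)
  also have "real (card ?R) \<le> 15 * m ^ 3" using m by (intro card_curves_with_root) simp
  also have "15 * m ^ 3 \<le> \<delta> * m * (m * m ^ 3)"
    using m\<delta> m mult_mono[of 15 "\<delta> * m" "1 * m ^ 3" "m * m ^ 3"] by (simp add: mult_right_mono)
  also have "\<delta> * m * (m * m ^ 3) = \<delta> * m ^ 5" by (simp add: numeral_eq_Suc)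
  finally have "real (card {E \<in> curves_upto (m ^ 6). \<not> eta_is_iso E D}) \<le> (4 ^ 6 * 2048 ^ 5 + 1) * \<delta> * m ^ 5"
    by (simp add: power_mult_distrib algebra_simps)
  also have "\<dots> = 96 * (4 ^ 6 * 2048 ^ 5 + 1) * \<delta> * (m ^ 5 / 96)" by simp
  also have "\<dots> \<le> 96 * (4 ^ 6 * 2048 ^ 5 + 1) * \<delta> * real (card (curves_upto (m ^ 6)))"
    using card_curves_upto[OF m] \<delta>0 by (intro mult_left_mono) auto
  finally have 1: "real (card {E \<in> curves_upto (m ^ 6). \<not> eta_is_iso E D}) \<le> 96 * (4 ^ 6 * 2048 ^ 5 + 1) * \<delta> * real (card (curves_upto (m ^ 6)))" .
  have "0 < m ^ 5 / 96" using m by simp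
  then have "0 < real (card (curves_upto (m ^ 6)))" using card_curves_upto[OF m] by linarith
  then show ?thesis using 1 by (simp only: pos_divide_le_eq)
qed

theorem theorem1p3:
  "\<exists>C::real. C > 0 \<and>
     (\<forall>D::int. squarefree D \<longrightarrow> D \<noteq> 1 \<longrightarrow>
        Limsup at_top (\<lambda>X::real.
          ereal (real (card {E \<in> curves_upto X. \<not> eta_is_iso E D}) / real (card (curves_upto X))))
        \<le> ereal (C * (23 / 24) ^ omega D))"
proof (intro exI conjI allI impI)
  define C0 where "C0 = 96 * (4 ^ 6 * 2048 ^ 5 + 1 :: real)"
  have C0: "C0 > 0" by (simp add: C0_def)
  \<comment> \<open>The factor \<open>(24 / 23) ^ 2\<close> pays for the primes 2 and 3, which
    \<open>omega\<close> counts and \<open>large_primes\<close> omits.\<close>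
  show "C0 * (24 / 23) ^ 2 > 0" using C0 by simp
  fix D :: int
  assume D: "squarefree D" "D \<noteq> 1"
  define \<delta> where "\<delta> = (23 / 24 :: real) ^ card (large_primes D)"
  have \<delta>0: "\<delta> > 0" by (simp add: \<delta>_def)
  obtain K where "(1 / 2 :: real) ^ K < \<delta>" using real_arch_pow_inv[OF \<delta>0, of "1 / 2"] by auto
  then have K: "1 / 2 ^ K \<le> \<delta>" by (simp add: power_one_over)
  \<comment> \<open>This threshold may depend on \<open>D\<close>, as \<open>X\<close> tends to
    infinity for fixed \<open>D\<close>; \<open>C0\<close> does not.\<close>
  define L where "L = max (max 3 (4 ^ K * real_of_int (\<Prod>(large_primes D)))) (15 / \<delta>)"
  have L: "L \<ge> 3" "L \<ge> 4 ^ K * real_of_int (\<Prod>(large_primes D))" "L \<ge> 15 / \<delta>" by (simp_all add: L_def)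
  have "\<forall>\<^sub>F X in at_top. ereal (real (card {E \<in> curves_upto X. \<not> eta_is_iso E D}) / real (card (curves_upto X)))
    \<le> ereal (C0 * (24 / 23) ^ 2 * (23 / 24) ^ omega D)"
    using eventually_ge_at_top[of "L ^ 6"]
  proof eventually_elim
    case (elim X)
    define m where "m = root 6 X"
    have "root 6 (L ^ 6) \<le> m" unfolding m_def using elim by simp
    then have mL: "m \<ge> L" using L(1) by (simp add: real_root_power_cancel)
    have "X \<ge> 0" using elim L(1) zero_le_power[of L 6] by linarith
    then have X: "X = m ^ 6" by (simp add: m_def)
    have "\<delta> * m \<ge> 15" using mult_left_mono[of "15 / \<delta>" m \<delta>] mL L(3) \<delta>0 by simp
    then have "real (card {E \<in> curves_upto X. \<not> eta_is_iso E D}) / real (card (curves_upto X)) \<le> C0 * \<delta>"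
      unfolding X C0_def \<delta>_def using D K mL L by (intro proportion_not_iso) (auto simp: \<delta>_def)
    also have "\<delta> \<le> (24 / 23) ^ 2 * (23 / 24) ^ omega D"
    proof -
      have "D \<noteq> 0" using D by auto
      then have "(23 / 24 :: real) ^ (card (large_primes D) + 2) \<le> (23 / 24) ^ omega D"
        using omega_le by (intro power_decreasing) auto
      then show ?thesis by (simp add: \<delta>_def power_add field_simps)
    qed
    finally show ?case using C0 by (simp add: mult.assoc)
  qed
  then show "Limsup at_top (\<lambda>X::real. ereal (real (card {E \<in> curves_upto X. \<not> eta_is_iso E D}) / real (card (curves_upto X))))
    \<le> ereal (C0 * (24 / 23) ^ 2 * (23 / 24) ^ omega D)"
    by (rule Limsup_bounded)
qed

end
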